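(* For every $n\ge1$ and every integer $L$ with $2^{n-1}<L\le 2^n$, a binary cut-down de Bruijn sequence of length $L$ (of order $n$) can be generated in $\mathcal{O}(n)$ time per symbol using $\mathcal{O}(n)$ space.
   Context: A binary cut-down de Bruijn sequence of length $L$ and order $n$ is a cyclic binary string of length $L$ in which every binary string of length $n$ appears at most once as a (cyclic) substring. *)

theory Defs
  imports Main
begin

definition cyclic_substring :: "'a list \<Rightarrow> nat \<Rightarrow> nat \<Rightarrow> 'a list" where
  "cyclic_substring w n i = map (\<lambda>k. w ! ((i + k) mod length w)) [0..<n]"

text \<open>A cyclic binary string is given by a list over \<open>{0, 1}\<close>, read off from some starting point.\<close>

definition cut_down_de_bruijn :: "nat \<Rightarrow> nat \<Rightarrow> nat list \<Rightarrow> bool" where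
  "cut_down_de_bruijn n L w \<longleftrightarrow>
     length w = L \<and> set w \<subseteq> {0, 1} \<and>
     (\<forall>u. length u = n \<and> set u \<subseteq> {0, 1} \<longrightarrow>
        card {i. i < L \<and> cyclic_substring w n i = u} \<le> 1)"

text \<open>
  The machine model is a random access machine programmed by structured commands over scalar
  variables and finitely many arrays. A run produces a trace with one event for every
  elementary operation: forming a constant or an arithmetic result, reading or writing a memory
  cell, branching, and emitting an output symbol. Each event has unit cost. Values are unbounded
  in the semantics; the word size is a resource that is read off from the trace, like time and space.
\<close>

datatype loc = Scalar nat | Cell nat nat

type_synonym store = "loc \<Rightarrow> nat"

datatype binop = Add | Sub | Mul | Quot | Rem | Lt | Eq

fun apply_op :: "binop \<Rightarrow> nat \<Rightarrow> nat \<Rightarrow> nat" where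
  "apply_op Add x y = x + y"
| "apply_op Sub x y = x - y"
| "apply_op Mul x y = x * y"
| "apply_op Quot x y = x div y"
| "apply_op Rem x y = x mod y"
| "apply_op Lt x y = (if x < y then 1 else 0)"
| "apply_op Eq x y = (if x = y then 1 else 0)"

datatype expr = Const nat | Var nat | Elem nat expr | Op binop expr expr

datatype com =
    Skip
  | Assign nat expr
  | Update nat expr expr
  | Output expr
  | Seq com com
  | Cond expr com com
  | While expr com

datatype event = Compute nat | Load loc nat | Store loc nat | Branch | Emit nat

fun eval :: "expr \<Rightarrow> store \<Rightarrow> nat" where
  "eval (Const c) s = c"
| "eval (Var x) s = s (Scalar x)"
| "eval (Elem a e) s = s (Cell a (eval e s))"
| "eval (Op f e1 e2) s = apply_op f (eval e1 s) (eval e2 s)"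

fun eval_trace :: "expr \<Rightarrow> store \<Rightarrow> event list" where
  "eval_trace (Const c) s = [Compute c]"
| "eval_trace (Var x) s = [Load (Scalar x) (s (Scalar x))]"
| "eval_trace (Elem a e) s =
     eval_trace e s @ [Load (Cell a (eval e s)) (s (Cell a (eval e s)))]"
| "eval_trace (Op f e1 e2) s =
     eval_trace e1 s @ eval_trace e2 s @ [Compute (apply_op f (eval e1 s) (eval e2 s))]"

inductive exec :: "com \<Rightarrow> store \<Rightarrow> event list \<Rightarrow> store \<Rightarrow> bool" where
  Skip: "exec Skip s [] s"
| Assign: "exec (Assign x e) s
     (eval_trace e s @ [Store (Scalar x) (eval e s)]) (s(Scalar x := eval e s))"
| Update: "exec (Update a i e) s
     (eval_trace i s @ eval_trace e s @ [Store (Cell a (eval i s)) (eval e s)])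
     (s(Cell a (eval i s) := eval e s))"
| Output: "exec (Output e) s (eval_trace e s @ [Emit (eval e s)]) s"
| Seq: "exec c1 s t1 s1 \<Longrightarrow> exec c2 s1 t2 s2 \<Longrightarrow> exec (Seq c1 c2) s (t1 @ t2) s2"
| CondTrue: "eval e s \<noteq> 0 \<Longrightarrow> exec c1 s t s' \<Longrightarrow>
     exec (Cond e c1 c2) s (eval_trace e s @ Branch # t) s'"
| CondFalse: "eval e s = 0 \<Longrightarrow> exec c2 s t s' \<Longrightarrow>
     exec (Cond e c1 c2) s (eval_trace e s @ Branch # t) s'"
| WhileFalse: "eval e s = 0 \<Longrightarrow> exec (While e c) s (eval_trace e s @ [Branch]) s"
| WhileTrue: "eval e s \<noteq> 0 \<Longrightarrow> exec c s t1 s1 \<Longrightarrow> exec (While e c) s1 t2 s2 \<Longrightarrow>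
     exec (While e c) s (eval_trace e s @ Branch # t1 @ t2) s2"

text \<open>
  \<open>n\<close> fits into one word, but \<open>L\<close> does not: it is supplied in binary, least significant bit
  first, in array \<open>0\<close>.
\<close>

fun input_store :: "nat \<Rightarrow> nat \<Rightarrow> store" where
  "input_store n L (Scalar x) = (if x = 0 then n else 0)"
| "input_store n L (Cell a i) = (if a = 0 then (L div 2 ^ i) mod 2 else 0)"

definition emitted :: "event list \<Rightarrow> nat list" where
  "emitted t = concat (map (\<lambda>ev. case ev of Emit b \<Rightarrow> [b] | _ \<Rightarrow> []) t)"

definition run_time :: "event list \<Rightarrow> nat" where
  "run_time t = length t"

definition emit_times :: "event list \<Rightarrow> nat list" where
  "emit_times t = filter (\<lambda>i. \<exists>b. t ! i = Emit b) [0..<length t]"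

text \<open>
  At most \<open>d\<close> steps per symbol, both on average over the whole run (initialisation and termination
  included) and in the worst case between two consecutive symbols.
\<close>

definition time_per_symbol_le :: "event list \<Rightarrow> nat \<Rightarrow> bool" where
  "time_per_symbol_le t d \<longleftrightarrow>
     run_time t \<le> d * length (emitted t) \<and>
     (\<forall>k. Suc k < length (emit_times t) \<longrightarrow> emit_times t ! Suc k - emit_times t ! k \<le> d)"

definition cells_used :: "event list \<Rightarrow> loc set" where
  "cells_used t = {l. \<exists>v. Load l v \<in> set t \<or> Store l v \<in> set t}"

definition space :: "event list \<Rightarrow> nat" where
  "space t = card (cells_used t)"

definition values_used :: "event list \<Rightarrow> nat set" where
  "values_used t =
     {v. Compute v \<in> set t \<or> (\<exists>l. Load l v \<in> set t \<or> Store l v \<in> set t) \<or> Emit v \<in> set t}"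

text \<open>
  Words of at most \<open>k * log\<^sub>2 (n + 1)\<close> bits. With unbounded words, or words of \<open>n\<close> bits, unit cost
  would hide the cost of handling counters up to \<open>2 ^ n\<close> and whole strings of length \<open>n\<close>.
\<close>

definition word_size_log :: "event list \<Rightarrow> nat \<Rightarrow> nat \<Rightarrow> bool" where
  "word_size_log t k n \<longleftrightarrow> (\<forall>v \<in> values_used t. v \<le> (n + 1) ^ k)"

inductive_cases SkipE: "exec Skip s t s'"
inductive_cases AssignE: "exec (Assign x e) s t s'"
inductive_cases UpdateE: "exec (Update a i e) s t s'"
inductive_cases OutputE: "exec (Output e) s t s'"
inductive_cases SeqE: "exec (Seq c1 c2) s t s'"
inductive_cases CondE: "exec (Cond e c1 c2) s t s'"
inductive_cases WhileE: "exec (While e c) s t s'"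

lemma exec_deterministic:
  "exec c s t s' \<Longrightarrow> exec c s u s'' \<Longrightarrow> t = u \<and> s' = s''"
proof (induction arbitrary: u s'' rule: exec.induct)
  case (Skip s)
  then show ?case by (elim SkipE) simp
next
  case (Assign x e s)
  then show ?case by (elim AssignE) simp
next
  case (Update a i e s)
  then show ?case by (elim UpdateE) simp
next
  case (Output e s)
  then show ?case by (elim OutputE) simp
next
  case (Seq c1 s t1 s1 c2 t2 s2)
  from Seq.prems obtain u1 r u2 where u: "u = u1 @ u2" "exec c1 s u1 r" "exec c2 r u2 s''"
    by (rule SeqE)
  have "t1 = u1 \<and> s1 = r" using Seq.IH(1)[OF u(2)] .
  moreover from this have "t2 = u2 \<and> s2 = s''" using Seq.IH(2) u(3) by simp
  ultimately show ?case using u(1) by simp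
next
  case (CondTrue e s c1 t s' c2)
  from CondTrue.prems show ?case
  proof (rule CondE)
    fix u1
    assume u: "u = eval_trace e s @ Branch # u1" "exec c1 s u1 s''"
    show ?thesis using CondTrue.IH[OF u(2)] u(1) by simp
  next
    assume "eval e s = 0"
    then show ?thesis using CondTrue.hyps(1) by simp
  qed
next
  case (CondFalse e s c2 t s' c1)
  from CondFalse.prems show ?case
  proof (rule CondE)
    assume "0 < eval e s"
    then show ?thesis using CondFalse.hyps(1) by simp
  next
    fix u1
    assume u: "u = eval_trace e s @ Branch # u1" "exec c2 s u1 s''"
    show ?thesis using CondFalse.IH[OF u(2)] u(1) by simp
  qed
next
  case (WhileFalse e s c)
  from WhileFalse.prems show ?case
  proof (rule WhileE)
    assume "u = eval_trace e s @ [Branch]" "s'' = s"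
    then show ?thesis by simp
  next
    assume "0 < eval e s"
    then show ?thesis using WhileFalse.hyps by simp
  qed
next
  case (WhileTrue e s c t1 s1 t2 s2)
  from WhileTrue.prems show ?case
  proof (rule WhileE)
    fix u1 r u2
    assume u: "u = eval_trace e s @ Branch # u1 @ u2" "exec c s u1 r" "exec (While e c) r u2 s''"
    have "t1 = u1 \<and> s1 = r" using WhileTrue.IH(1)[OF u(2)] .
    moreover from this have "t2 = u2 \<and> s2 = s''" using WhileTrue.IH(2) u(3) by simp
    ultimately show ?thesis using u(1) by simp
  next
    assume "eval e s = 0"
    then show ?thesis using WhileTrue.hyps(1) by contradiction
  qed
qed

lemma finite_cells_used: "finite (cells_used t)"
proof (rule finite_subset)
  show "cells_used t \<subseteq> (\<Union>ev \<in> set t. case ev of Load l v \<Rightarrow> {l} | Store l v \<Rightarrow> {l} | _ \<Rightarrow> {})"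
    unfolding cells_used_def by fastforce
  show "finite (\<Union>ev \<in> set t. case ev of Load l v \<Rightarrow> {l} | Store l v \<Rightarrow> {l} | _ \<Rightarrow> {})"
    by (auto split: event.split)
qed

end

theory Submission imports Defs begin

text \<open>
  Rotation partitions the binary strings of length \<open>n\<close> into cycles. The class whose least rotation (its
  necklace) is \<open>z1\<close> is joined to the class of \<open>z0\<close> by exchanging the successors of \<open>0z\<close> and \<open>1z\<close>. As
  \<open>z0\<close> has smaller weight, the classes form a tree and all strings end up on one cycle. Discarding
  classes by decreasing weight, and by increasing necklace within a weight, always discards leaves of
  the tree, and it can be stopped when the number of remaining strings exceeds \<open>L\<close> by some \<open>r < n\<close>.

  The excess is removed by cutting out the \<open>r\<close> windows of length \<open>n\<close> of the periodic word with period
  \<open>0\<dots>01\<close> of length \<open>r\<close>. Unless \<open>r\<close> divides \<open>n\<close>, they lie in two adjacent classes of the tree that touch in a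
  second place, and exchanging the successors there as well splits off exactly these windows. No other
  join is disturbed as long as \<open>2r \<le> n + 1\<close>; a larger excess is removed in two such parts. Because of
  \<open>2\<^sup>n\<^sup>-\<^sup>1 < L\<close> the classes of the windows are never among those discarded before.

  The program first enumerates all strings in the order of discarding and adds the sizes of the
  classes to \<open>L\<close> until \<open>2\<^sup>n\<close> is reached; this takes \<open>O(n)\<close> time per string and finds the last class \<open>N\<close>
  and the excess \<open>r\<close>. Afterwards a bounded number of scans of the current string, one of them Duval's
  necklace test, determines its successor.
\<close>

section \<open>Iterating an injective map on a finite set\<close>

text \<open>Words have only \<open>O(log n)\<close> bits, so \<open>L\<close> lives in a binary
  counter and no position on the cycle can be stored: each decision of the output loop must be a
  local test of the current string, with \<open>N\<close> and one or two window lengths as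
  parameters. If \<open>2 \<le> r\<close> divides \<open>n\<close>, the windows are one complete
  class without children, and cutting it out undoes a single join. Otherwise, with
  \<open>n = q r + e\<close>, they are the last \<open>e\<close> rotations of the necklace
  \<open>xr r\<close> and the first \<open>r - e\<close> proper rotations of \<open>yr r\<close>,
  which lies in the parent class. These are consecutive on the joined cycle, so one further exchange
  closes them off. For \<open>r = 1\<close> the zero string is the root of the tree and has a single
  child. The bound \<open>2 ^ (n - 1) < L\<close> works twice. Complementing letters shows that at
  most half of all strings are light, so some kept string has weight at least \<open>n / 2\<close>,
  and the windows are lighter or come late within that weight. Moreover
  \<open>2 ^ n \<le> 2 * L\<close> spreads the cost of the enumeration over the output.\<close>

lemma funpow_in: "f ` S \<subseteq> S \<Longrightarrow> x \<in> S \<Longrightarrow> (f ^^ k) x \<in> S"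
  by (induction k) auto

text \<open>Two of the first \<open>card S + 1\<close> iterates coincide. Injectivity cancels the
  common number of steps, so the orbit closes at \<open>x\<close> itself and not at a later
  point.\<close>

lemma funpow_period:
  assumes fin: "finite S" and maps: "f ` S \<subseteq> S" and inj: "inj_on f S" and x: "x \<in> S"
  shows "\<exists>p>0. p \<le> card S \<and> (f ^^ p) x = x"
proof -
  have "\<not> inj_on (\<lambda>k. (f ^^ k) x) {..card S}"
  proof
    assume "inj_on (\<lambda>k. (f ^^ k) x) {..card S}"
    moreover have "(\<lambda>k. (f ^^ k) x) ` {..card S} \<subseteq> S" using funpow_in[OF maps x] by auto
    ultimately have "card {..card S} \<le> card S" using card_inj_on_le fin by blast
    then show False by simp
  qed
  then obtain i j where ij: "i < j" "j \<le> card S" "(f ^^ i) x = (f ^^ j) x"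
    unfolding inj_on_def by (metis atMost_iff linorder_neqE_nat)
  have "(f ^^ i) x = (f ^^ (i + d)) x \<Longrightarrow> x = (f ^^ d) x" for i d
  proof (induction i)
    case 0 then show ?case by simp
  next
    case (Suc i)
    then have "f ((f ^^ i) x) = f ((f ^^ (i + d)) x)" by simp
    then have "(f ^^ i) x = (f ^^ (i + d)) x"
      using inj funpow_in[OF maps x] by (meson inj_onD)
    then show ?case by (rule Suc.IH)
  qed
  from this[of i "j - i"] ij have "x = (f ^^ (j - i)) x" by simp
  then show ?thesis using ij by (intro exI[of _ "j - i"]) auto
qed

definition orb :: "('a \<Rightarrow> 'a) \<Rightarrow> 'a \<Rightarrow> 'a \<Rightarrow> bool" where
  "orb f x y \<longleftrightarrow> (\<exists>k. (f ^^ k) x = y)"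

lemma orb_refl[simp]: "orb f x x"
  unfolding orb_def by (intro exI[of _ 0]) simp

lemma orb_step: "orb f x (f x)"
  unfolding orb_def by (intro exI[of _ 1]) simp

lemma orb_trans[trans]: "orb f x y \<Longrightarrow> orb f y z \<Longrightarrow> orb f x z"
  unfolding orb_def by (metis funpow_add comp_apply)

text \<open>Going on to the multiple \<open>p * k\<close> of the period gives the way back. Symmetry
  allows reachability to be shown towards one fixed string.\<close>

lemma orb_sym:
  assumes "finite S" "f ` S \<subseteq> S" "inj_on f S" "x \<in> S" "orb f x y"
  shows "orb f y x"
proof -
  obtain k where k: "(f ^^ k) x = y" using assms unfolding orb_def by blast
  obtain p where p: "p > 0" "(f ^^ p) x = x" using funpow_period[OF assms(1-4)] by blast
  have *: "(f ^^ (p * m)) x = x" for m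
    by (induction m) (auto simp: funpow_add p(2))
  have "(f ^^ (p * k - k)) y = (f ^^ (p * k - k + k)) x" using k by (simp add: funpow_add)
  also have "p * k - k + k = p * k" using p(1) by (simp add: Suc_leI)
  finally show ?thesis using * unfolding orb_def by metis
qed

text \<open>An orbit that covers \<open>S\<close> cannot have a period below \<open>card S\<close>,
  so one turn visits every element exactly once.\<close>

lemma single_orbit:
  assumes fin: "finite S" and maps: "f ` S \<subseteq> S" and inj: "inj_on f S" and x: "x \<in> S"
    and reach: "\<And>y. y \<in> S \<Longrightarrow> orb f x y"
  shows "bij_betw (\<lambda>k. (f ^^ k) x) {..<card S} S" and "(f ^^ card S) x = x"
proof -
  obtain p where p: "p > 0" "p \<le> card S" "(f ^^ p) x = x"
    using funpow_period[OF assms(1-4)] by blast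
  have mod: "(f ^^ k) x = (f ^^ (k mod p)) x" for k
    using p(3) by (metis funpow_mod_eq)
  have sub: "S \<subseteq> (\<lambda>k. (f ^^ k) x) ` {..<p}"
  proof
    fix y assume "y \<in> S"
    then obtain k where "(f ^^ k) x = y" using reach unfolding orb_def by blast
    then show "y \<in> (\<lambda>k. (f ^^ k) x) ` {..<p}" using mod[of k] p(1) by auto
  qed
  then have img: "(\<lambda>k. (f ^^ k) x) ` {..<p} = S" using funpow_in[OF maps x] by auto
  have "card S \<le> p" using card_image_le[of "{..<p}" "\<lambda>k. (f ^^ k) x"] img by simp
  then have peq: "p = card S" using p(2) by simp
  then have "inj_on (\<lambda>k. (f ^^ k) x) {..<p}" by (intro eq_card_imp_inj_on) (use img peq in simp_all)
  then show "bij_betw (\<lambda>k. (f ^^ k) x) {..<card S} S" "(f ^^ card S) x = x"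
    using img peq p(3) by (auto simp: bij_betw_def)
qed

section \<open>Bit strings and necklaces\<close>

definition bits :: "nat \<Rightarrow> nat list set" where
  "bits n = {v. length v = n \<and> set v \<subseteq> {0, 1}}"

text \<open>The first letter is the most significant one, so for equal lengths \<open>val\<close>
  orders strings lexicographically.\<close>

fun val :: "nat list \<Rightarrow> nat" where
  "val [] = 0"
| "val (b # v) = b * 2 ^ length v + val v"

lemma bits_iff: "v \<in> bits n \<longleftrightarrow> length v = n \<and> (\<forall>i<n. v ! i = 0 \<or> v ! i = 1)"
proof -
  have "set v \<subseteq> {0, 1} \<longleftrightarrow> (\<forall>i<length v. v ! i \<in> {0, 1})"
    unfolding subset_iff all_set_conv_all_nth[of v "\<lambda>b. b \<in> {0, 1}", symmetric] Ball_def ..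
  then show ?thesis by (cases "length v = n") (simp_all add: bits_def)
qed

lemma bitsD:
  assumes "v \<in> bits n"
  shows "length v = n" and "i < n \<Longrightarrow> v ! i = 0 \<or> v ! i = 1"
  using assms by (simp_all add: bits_iff)

lemma bitsI:
  assumes "length v = n" "\<And>i. i < n \<Longrightarrow> v ! i = 0 \<or> v ! i = 1"
  shows "v \<in> bits n"
  using assms by (simp add: bits_iff)

lemma bits_Suc: "bits (Suc n) = (#) 0 ` bits n \<union> (#) 1 ` bits n"
  unfolding bits_def by (auto simp: length_Suc_conv)

lemma finite_bits[simp]: "finite (bits n)" and card_bits: "card (bits n) = 2 ^ n"
proof -
  have "finite (bits n) \<and> card (bits n) = 2 ^ n"
  proof (induction n)
    case 0
    have "bits 0 = {[]}" by (auto simp: bits_def)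
    then show ?case by simp
  next
    case (Suc n)
    have "card ((#) (0::nat) ` bits n \<union> (#) 1 ` bits n) = 2 ^ n + 2 ^ n"
      using Suc by (subst card_Un_disjoint) (auto simp: card_image)
    then show ?case using Suc by (simp add: bits_Suc)
  qed
  then show "finite (bits n)" "card (bits n) = 2 ^ n" by auto
qed

lemma rotate_bits[simp]: "rotate k v \<in> bits n \<longleftrightarrow> v \<in> bits n"
  unfolding bits_def by simp

lemma Cons_bits: "c # z \<in> bits n \<longleftrightarrow> (c = 0 \<or> c = 1) \<and> 0 < n \<and> z \<in> bits (n - 1)"
  unfolding bits_def by auto

lemma snoc_bits: "z @ [c] \<in> bits n \<longleftrightarrow> (c = 0 \<or> c = 1) \<and> 0 < n \<and> z \<in> bits (n - 1)"
  unfolding bits_def by auto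

lemma val_less: "set v \<subseteq> {0, 1} \<Longrightarrow> val v < 2 ^ length v"
  by (induction v) auto

lemma val_less_first_diff:
  assumes "u \<in> bits n" "w \<in> bits n" "j < n" "\<And>i. i < j \<Longrightarrow> u ! i = w ! i" "u ! j < w ! j"
  shows "val u < val w"
  using assms
proof (induction n arbitrary: u w j)
  case 0 then show ?case by simp
next
  case (Suc n)
  obtain a u' where u: "u = a # u'" "u' \<in> bits n"
    using Suc.prems(1) by (auto simp: bits_Suc)
  obtain b w' where w: "w = b # w'" "w' \<in> bits n"
    using Suc.prems(2) by (auto simp: bits_Suc)
  have len: "length u' = n" "length w' = n" using u w by (auto simp: bits_def)
  show ?case
  proof (cases j)
    case 0
    then have "a < b" using Suc.prems u w by simp
    moreover have "b = 0 \<or> b = 1" using Suc.prems(2) w by (auto simp: Cons_bits)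
    ultimately have "a = 0" "b = 1" by auto
    then show ?thesis using u w len val_less[of u'] by (auto simp: bits_def)
  next
    case (Suc j')
    have "a = b" using Suc.prems(4)[of 0] Suc u w by simp
    moreover have "val u' < val w'"
    proof (rule Suc.IH[OF u(2) w(2), of j'])
      show "j' < n" using Suc Suc.prems by simp
      show "u' ! i = w' ! i" if "i < j'" for i using Suc.prems(4)[of "Suc i"] Suc u w that by simp
      show "u' ! j' < w' ! j'" using Suc.prems(5) Suc u w by simp
    qed
    ultimately show ?thesis using u w len by simp
  qed
qed

lemma first_diff:
  assumes "u \<in> bits n" "w \<in> bits n" "u \<noteq> w"
  obtains j where "j < n" "\<And>i. i < j \<Longrightarrow> u ! i = w ! i" "u ! j \<noteq> w ! j"
proof -
  have ex: "\<exists>j. j < n \<and> u ! j \<noteq> w ! j" using assms by (metis bitsD(1) nth_equalityI)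
  define j where "j = (LEAST j. j < n \<and> u ! j \<noteq> w ! j)"
  have "j < n \<and> u ! j \<noteq> w ! j" unfolding j_def by (rule LeastI_ex[OF ex])
  moreover have "u ! i = w ! i" if "i < j" for i
    using not_less_Least[of i "\<lambda>j. j < n \<and> u ! j \<noteq> w ! j"] that calculation unfolding j_def by simp
  ultimately show ?thesis using that by blast
qed

lemma val_inj: "u \<in> bits n \<Longrightarrow> w \<in> bits n \<Longrightarrow> val u = val w \<Longrightarrow> u = w"
proof (rule ccontr)
  assume u: "u \<in> bits n" and w: "w \<in> bits n" and eq: "val u = val w" and "u \<noteq> w"
  then obtain j where j: "j < n" "\<And>i. i < j \<Longrightarrow> u ! i = w ! i" "u ! j \<noteq> w ! j"
    using first_diff[OF u w] by blast
  then consider "u ! j < w ! j" | "w ! j < u ! j" by linarith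
  then show False
    using val_less_first_diff[OF u w j(1)] val_less_first_diff[OF w u j(1)] j(2) eq by cases simp_all
qed

text \<open>The first difference lies at or before \<open>a\<close>, where \<open>u\<close> has only
  zeros. Necklaces are compared by their runs of zeros in this way.\<close>

lemma val_less_leading_zeros:
  assumes "u \<in> bits n" "w \<in> bits n" "a < n" "\<And>i. i \<le> a \<Longrightarrow> u ! i = 0" "w ! a = 1"
  shows "val u < val w"
proof -
  have ne: "u \<noteq> w" using assms by auto
  obtain j where j: "j < n" "\<And>i. i < j \<Longrightarrow> u ! i = w ! i" "u ! j \<noteq> w ! j"
    using first_diff[OF assms(1,2) ne] by blast
  have "j \<le> a" using j(2)[of a] assms by (cases "a < j") auto
  then have "u ! j < w ! j" using assms(4)[of j] j(3) by simp
  then show ?thesis using val_less_first_diff[OF assms(1,2) j(1)] j(2) by blast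
qed

definition neck :: "nat list \<Rightarrow> bool" where
  "neck v \<longleftrightarrow> (\<forall>k. val v \<le> val (rotate k v))"

text \<open>The minimum is taken over strings and not over rotation amounts, which are not unique
  for periodic strings.\<close>

definition nk :: "nat list \<Rightarrow> nat list" where
  "nk v = (ARG_MIN val u. \<exists>k. u = rotate k v)"

lemma nk_rotation: "\<exists>k. nk v = rotate k v"
  unfolding nk_def by (rule arg_min_natI[of _ v]) (metis rotate0 id_apply)

lemma nk_le: "val (nk v) \<le> val (rotate k v)"
  unfolding nk_def by (rule arg_min_nat_le) blast

lemma neck_nk: "neck (nk v)"
proof -
  obtain k where "nk v = rotate k v" using nk_rotation by blast
  then show ?thesis unfolding neck_def using nk_le[of v] by (simp add: rotate_rotate)
qed

lemma rotate_back: "\<exists>j. v = rotate j (rotate k v)"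
proof (cases "v = []")
  case False
  have "rotate (length v - k mod length v) (rotate k v)
      = rotate (length v - k mod length v) (rotate (k mod length v) v)"
    by (metis rotate_conv_mod)
  also have "\<dots> = v" using False by (simp add: rotate_rotate)
  finally show ?thesis by metis
qed simp

lemma neck_unique:
  assumes "v \<in> bits n" "neck v" "neck (rotate k v)" shows "rotate k v = v"
proof -
  obtain j where "v = rotate j (rotate k v)" using rotate_back by blast
  then have "val (rotate k v) \<le> val v" using assms(3) unfolding neck_def by metis
  then show ?thesis using assms(1,2) unfolding neck_def by (metis le_antisym rotate_bits val_inj)
qed

lemma nk_eq:
  assumes "v \<in> bits n" "neck (rotate k v)" shows "nk v = rotate k v"
proof -
  obtain i where i: "nk v = rotate i v" using nk_rotation by blast
  obtain j where "v = rotate j (rotate k v)" using rotate_back by blast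
  then have "nk v = rotate (i + j) (rotate k v)" using i by (metis rotate_rotate)
  moreover have "rotate k v \<in> bits n" using assms by simp
  ultimately show ?thesis using neck_unique assms(2) neck_nk by metis
qed

lemma nk_neck: "v \<in> bits n \<Longrightarrow> neck v \<Longrightarrow> nk v = v"
  using nk_eq[of v n 0] by simp

lemma nk_rotate[simp]: "v \<in> bits n \<Longrightarrow> nk (rotate k v) = nk v"
proof -
  assume v: "v \<in> bits n"
  obtain i where i: "nk (rotate k v) = rotate i (rotate k v)" using nk_rotation by blast
  then have "nk (rotate k v) = rotate (i + k) v" by (simp add: rotate_rotate)
  moreover from this have "neck (rotate (i + k) v)" using neck_nk by metis
  ultimately show ?thesis using nk_eq[OF v] by metis
qed

lemma nk_bits[simp]: "nk v \<in> bits n \<longleftrightarrow> v \<in> bits n"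
  using nk_rotation[of v] by auto

definition wt :: "nat list \<Rightarrow> nat" where "wt v = sum_list v"

lemma sum_list_rotate[simp]: "sum_list (rotate k (v::nat list)) = sum_list v"
proof (induction k)
  case (Suc k)
  then show ?case by (cases "rotate k v") auto
qed simp

lemma wt_rotate[simp]: "wt (rotate k v) = wt v" by (simp add: wt_def)

lemma wt_nk[simp]: "wt (nk v) = wt v"
  using nk_rotation[of v] by auto

lemma wt_simps[simp]: "wt [] = 0" "wt (a # v) = a + wt v" "wt (u @ v) = wt u + wt v"
  by (auto simp: wt_def)

lemma wt_card: "v \<in> bits n \<Longrightarrow> wt v = card {i. i < n \<and> v ! i = 1}"
proof -
  assume v: "v \<in> bits n"
  have "wt v = (\<Sum>i<n. v ! i)"
    using bitsD(1)[OF v] by (simp add: wt_def sum_list_sum_nth atLeast0LessThan)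
  also have "\<dots> = (\<Sum>i<n. if v ! i = 1 then 1 else 0)"
    using bitsD(2)[OF v] by (intro sum.cong) auto
  also have "\<dots> = card {i. i < n \<and> v ! i = 1}"
    by (simp add: sum.If_cases Int_def)
  finally show ?thesis .
qed

text \<open>
  The order of discarding. Heavy strings come first, so that changing a \<open>1\<close> into a \<open>0\<close> never leads
  from a kept class to a discarded one.
\<close>

definition bef :: "nat list \<Rightarrow> nat list \<Rightarrow> bool" where
  "bef y x \<longleftrightarrow> wt y > wt x \<or> (wt y = wt x \<and> val y < val x)"

section \<open>Duval's test\<close>

text \<open>The Lyndon property with the first difference made explicit: each proper suffix exceeds
  the prefix at a letter that lies inside the suffix, so no suffix is a border.\<close>

definition lyndon_prefix :: "nat list \<Rightarrow> nat \<Rightarrow> bool" where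
  "lyndon_prefix x p \<longleftrightarrow>
     (\<forall>s. 0 < s \<and> s < p \<longrightarrow> (\<exists>j. s + j < p \<and> (\<forall>i<j. x ! (s + i) = x ! i) \<and> x ! j < x ! (s + j)))"

text \<open>\<open>p\<close> is the length of the longest Lyndon prefix of the first \<open>i\<close> letters, which have period \<open>p\<close>.\<close>

definition duval_inv :: "nat list \<Rightarrow> nat \<Rightarrow> nat \<Rightarrow> bool" where
  "duval_inv x i p \<longleftrightarrow>
     0 < p \<and> p \<le> i \<and> (\<forall>l. p \<le> l \<and> l < i \<longrightarrow> x ! l = x ! (l - p)) \<and> lyndon_prefix x p"

lemma duval_inv_init: "duval_inv x 1 1"
  by (auto simp: duval_inv_def lyndon_prefix_def)

lemma duval_inv_keep: "duval_inv x i p \<Longrightarrow> x ! i = x ! (i - p) \<Longrightarrow> duval_inv x (Suc i) p"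
  by (auto simp: duval_inv_def less_Suc_eq)

lemma duval_inv_mod: "duval_inv x i p \<Longrightarrow> l < i \<Longrightarrow> x ! l = x ! (l mod p)"
proof (induction l rule: less_induct)
  case (less l)
  show ?case
  proof (cases "l < p")
    case False
    have p: "0 < p" using less.prems by (simp add: duval_inv_def)
    have "x ! l = x ! (l - p)" using less.prems False by (simp add: duval_inv_def)
    also have "\<dots> = x ! ((l - p) mod p)" using less False p by simp
    also have "(l - p) mod p = l mod p" using False by (simp add: le_mod_geq)
    finally show ?thesis .
  qed simp
qed

text \<open>A larger letter makes the whole prefix Lyndon. A suffix that starts at a multiple of
  \<open>p\<close> agrees with the beginning up to the new letter and wins there. Any other suffix
  wins inside the period by the Lyndon property, or at the new letter if it ends before that
  difference.\<close>

lemma duval_inv_jump: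
  assumes inv: "duval_inv x i p" and gt: "x ! (i - p) < x ! i"
  shows "duval_inv x (Suc i) (Suc i)"
proof -
  have p: "0 < p" "p \<le> i" and ly: "lyndon_prefix x p" using inv by (auto simp: duval_inv_def)
  have imod: "x ! (i - p) = x ! (i mod p)"
    using duval_inv_mod[OF inv, of "i - p"] p by (simp add: le_mod_geq)
  have "\<exists>j. s + j < Suc i \<and> (\<forall>l<j. x ! (s + l) = x ! l) \<and> x ! j < x ! (s + j)"
    if s: "0 < s" "s < Suc i" for s
  proof (cases "s mod p = 0")
    case True
    have "x ! (s + l) = x ! l" if "l < i - s" for l
    proof -
      have "x ! (s + l) = x ! ((s + l) mod p)" using duval_inv_mod[OF inv] that by simp
      also have "(s + l) mod p = l mod p" using True by (metis add_0 mod_add_left_eq)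
      also have "x ! (l mod p) = x ! l" using duval_inv_mod[OF inv, of l] that by simp
      finally show ?thesis .
    qed
    moreover have "x ! (i - s) < x ! i"
    proof -
      have "(i - s) mod p = i mod p"
        using True s by (metis add.commute add_0 le_add_diff_inverse less_Suc_eq_le mod_add_right_eq)
      then show ?thesis using duval_inv_mod[OF inv, of "i - s"] s p gt imod by simp
    qed
    ultimately show ?thesis using s by (intro exI[of _ "i - s"]) auto
  next
    case False
    define e where "e = s mod p"
    have e: "0 < e" "e < p" using False p by (auto simp: e_def)
    obtain j where j: "e + j < p" "\<And>l. l < j \<Longrightarrow> x ! (e + l) = x ! l" "x ! j < x ! (e + j)"
      using ly e unfolding lyndon_prefix_def by blast
    have sl: "x ! (s + l) = x ! (e + l)" if "s + l < i" "e + l < p" for l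
    proof -
      have "(s + l) mod p = e + l" using that(2) by (metis e_def mod_add_left_eq mod_less)
      then show ?thesis using duval_inv_mod[OF inv that(1)] by simp
    qed
    show ?thesis
    proof (cases "s + j < i")
      case True
      then show ?thesis using sl j by (intro exI[of _ j]) auto
    next
      case False
      define l where "l = i - s"
      have l: "l \<le> j" "s + l = i" using False s by (auto simp: l_def)
      have "i mod p = e + l" using l j(1) unfolding e_def
        by (metis add_le_cancel_left le_less_trans mod_add_left_eq mod_less)
      then have "x ! (e + l) < x ! i" using gt imod by simp
      moreover have "x ! l \<le> x ! (e + l)" using j l(1) by (cases "l = j") auto
      moreover have "x ! (s + l') = x ! l'" if "l' < l" for l'
        using that sl[of l'] j l by simp
      ultimately show ?thesis using l by (intro exI[of _ l]) auto
    qed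
  qed
  then show ?thesis by (auto simp: duval_inv_def lyndon_prefix_def)
qed

text \<open>Rotation by \<open>p\<close> aligns the string with its own period, so the first
  difference is the new letter, which is smaller.\<close>

lemma duval_fail:
  assumes x: "x \<in> bits n" and inv: "duval_inv x i p" and i: "i < n" and lt: "x ! i < x ! (i - p)"
  shows "\<not> neck x"
proof -
  have p: "0 < p" "p \<le> i" using inv by (auto simp: duval_inv_def)
  have len: "length x = n" using x by (rule bitsD)
  have "val (rotate p x) < val x"
  proof (rule val_less_first_diff[of _ n _ "i - p"])
    show "rotate p x ! l = x ! l" if "l < i - p" for l
    proof -
      have "rotate p x ! l = x ! (p + l)" using that i p len by (simp add: nth_rotate)
      also have "\<dots> = x ! l" using inv that by (simp add: duval_inv_def)
      finally show ?thesis .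
    qed
    show "rotate p x ! (i - p) < x ! (i - p)" using lt i p len by (simp add: nth_rotate)
  qed (use x i in auto)
  then show ?thesis unfolding neck_def by (metis not_le)
qed

text \<open>The incomplete last copy of the period, of length \<open>t = n mod p\<close>, is rotated
  to the front. It agrees with the beginning; after it the Lyndon prefix starts anew, and this is
  smaller than the suffix of the prefix at \<open>t\<close>.\<close>

lemma duval_final_not_dvd:
  assumes x: "x \<in> bits n" and inv: "duval_inv x n p" and nd: "\<not> p dvd n"
  shows "\<not> neck x"
proof -
  have p: "0 < p" "p \<le> n" and ly: "lyndon_prefix x p" using inv by (auto simp: duval_inv_def)
  have len: "length x = n" using x by (rule bitsD)
  define t where "t = n mod p"
  have t: "0 < t" "t < p" using nd p by (auto simp: t_def mod_greater_zero_iff_not_dvd)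
  obtain j where j: "t + j < p" "\<And>l. l < j \<Longrightarrow> x ! (t + l) = x ! l" "x ! j < x ! (t + j)"
    using ly t unfolding lyndon_prefix_def by blast
  have r1: "rotate (n - t) x ! l = x ! l" if "l < t" for l
  proof -
    have "rotate (n - t) x ! l = x ! (n - t + l)" using that t p len by (simp add: nth_rotate)
    also have "\<dots> = x ! ((n - t + l) mod p)" using that t p by (intro duval_inv_mod[OF inv]) simp
    also have "(n - t + l) mod p = l mod p"
      unfolding t_def minus_mod_eq_mult_div by simp
    finally show ?thesis using that t by simp
  qed
  have r2: "rotate (n - t) x ! (t + l) = x ! l" if "t + l < n" for l
    using that t p len by (simp add: nth_rotate le_mod_geq)
  have "val (rotate (n - t) x) < val x"
  proof (rule val_less_first_diff[of _ n _ "t + j"])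
    show "rotate (n - t) x ! l = x ! l" if "l < t + j" for l
    proof (cases "l < t")
      case False
      then show ?thesis using r2[of "l - t"] j(2)[of "l - t"] that j(1) p by simp
    qed (use r1 in simp)
    show "rotate (n - t) x ! (t + j) < x ! (t + j)" using r2[of j] j p by simp
  qed (use x j p in auto)
  then show ?thesis unfolding neck_def by (metis not_le)
qed

text \<open>Here \<open>x\<close> is a power of a Lyndon word of length \<open>p\<close>, and
  rotations by \<open>0 < s < p\<close> are strictly larger. Hence \<open>p\<close> is also the
  number of strings in the class, which is what the enumeration has to add to its counter.\<close>

lemma duval_final_dvd:
  assumes x: "x \<in> bits n" and inv: "duval_inv x n p" and d: "p dvd n"
  shows "neck x" and "card {v. \<exists>k. v = rotate k x} = p"
proof -
  have p: "0 < p" "p \<le> n" and ly: "lyndon_prefix x p" using inv by (auto simp: duval_inv_def)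
  have len: "length x = n" using x by (rule bitsD)
  have nth: "rotate s x ! l = x ! ((s + l) mod p)" if "l < n" for s l
  proof -
    have "rotate s x ! l = x ! ((s + l) mod n)" using that len by (simp add: nth_rotate)
    also have "\<dots> = x ! ((s + l) mod n mod p)" using that by (intro duval_inv_mod[OF inv]) simp
    also have "(s + l) mod n mod p = (s + l) mod p" using d by (rule mod_mod_cancel)
    finally show ?thesis .
  qed
  have mod: "rotate s x = rotate (s mod p) x" for s
    by (rule nth_equalityI) (use len in \<open>auto simp: nth mod_add_left_eq\<close>)
  have strict: "val x < val (rotate s x)" if s: "0 < s" "s < p" for s
  proof -
    obtain j where j: "s + j < p" "\<And>l. l < j \<Longrightarrow> x ! (s + l) = x ! l" "x ! j < x ! (s + j)"
      using ly s unfolding lyndon_prefix_def by blast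
    show ?thesis
      by (rule val_less_first_diff[of _ n _ j]) (use x j p in \<open>auto simp: nth\<close>)
  qed
  show "neck x" unfolding neck_def
  proof
    fix k show "val x \<le> val (rotate k x)"
      using strict[of "k mod p"] mod[of k] p by (cases "k mod p = 0") (auto intro: less_imp_le)
  qed
  have "inj_on (\<lambda>k. rotate k x) {..<p}"
  proof (rule linorder_inj_onI)
    fix i j assume ij: "i < j" "i \<in> {..<p}" "j \<in> {..<p}"
    show "rotate i x \<noteq> rotate j x"
    proof
      assume "rotate i x = rotate j x"
      then have "rotate (p - j) (rotate i x) = rotate (p - j) (rotate j x)" by simp
      then have "rotate (p - j + i) x = x" using ij mod[of p] by (simp add: rotate_rotate)
      moreover have "0 < p - j + i" "p - j + i < p" using ij by auto
      ultimately show False using strict[of "p - j + i"] by simp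
    qed
  qed auto
  moreover have "{v. \<exists>k. v = rotate k x} = (\<lambda>k. rotate k x) ` {..<p}"
  proof (intro set_eqI iffI)
    fix v assume "v \<in> {v. \<exists>k. v = rotate k x}"
    then obtain k where "v = rotate k x" by blast
    then have "v = rotate (k mod p) x" using mod[of k] by simp
    then show "v \<in> (\<lambda>k. rotate k x) ` {..<p}" using p(1) by simp
  qed blast
  ultimately show "card {v. \<exists>k. v = rotate k x} = p" by (simp add: card_image)
qed

section \<open>Enumerating strings by weight\<close>

lemma val_append: "val (u @ v) = val u * 2 ^ length v + val v"
  by (induction u) (auto simp: algebra_simps power_add)

lemma val_replicate0[simp]: "val (replicate j 0) = 0"
  by (induction j) auto

lemma wt_replicate[simp]: "wt (replicate k b) = k * b"
  by (simp add: wt_def sum_list_replicate)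

lemma wt_le: "t \<in> bits n \<Longrightarrow> wt t \<le> n"
proof -
  assume "t \<in> bits n"
  then have "wt t = card {i. i < n \<and> t ! i = 1}" by (rule wt_card)
  also have "\<dots> \<le> card {..<n}" by (rule card_mono) auto
  finally show ?thesis by simp
qed

lemma wt_full: "t \<in> bits n \<Longrightarrow> wt t = n \<Longrightarrow> t = replicate n 1"
proof (induction n arbitrary: t)
  case 0 then show ?case by (simp add: bits_def)
next
  case (Suc n)
  then obtain b t' where t: "t = b # t'" "t' \<in> bits n" "b = 0 \<or> b = 1" by (auto simp: bits_Suc)
  then show ?case using Suc wt_le[of t' n] by auto
qed

lemma wt_zero: "t \<in> bits n \<Longrightarrow> wt t = 0 \<Longrightarrow> t = replicate n 0"
proof (induction n arbitrary: t)
  case 0 then show ?case by (simp add: bits_def)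
next
  case (Suc n)
  then obtain b t' where t: "t = b # t'" "t' \<in> bits n" by (auto simp: bits_Suc)
  then show ?case using Suc by auto
qed

lemma val_weight_min:
  "t \<in> bits (j + k) \<Longrightarrow> wt t = k \<Longrightarrow> val (replicate j 0 @ replicate k 1) \<le> val t"
proof (induction j arbitrary: t)
  case 0 then show ?case using wt_full[of t k] by simp
next
  case (Suc j)
  then obtain b t' where t: "t = b # t'" "t' \<in> bits (j + k)" "b = 0 \<or> b = 1"
    by (auto simp: bits_Suc)
  show ?case
  proof (cases "b = 0")
    case True then show ?thesis using Suc t by simp
  next
    case False
    have "replicate j (0::nat) @ replicate k 1 \<in> bits (j + k)" by (auto simp: bits_def)
    then have "val (replicate j 0 @ replicate k 1) < 2 ^ (j + k)"
      using val_less[of "replicate j 0 @ replicate k 1"] by (simp add: bits_def)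
    then show ?thesis using t False by (auto simp: bits_def)
  qed
qed

lemma val_weight_max:
  "t \<in> bits (k + j) \<Longrightarrow> wt t = k \<Longrightarrow> val t \<le> val (replicate k 1 @ replicate j 0)"
proof (induction k arbitrary: t)
  case 0 then show ?case using wt_zero[of t j] by simp
next
  case (Suc k)
  then obtain b t' where t: "t = b # t'" "t' \<in> bits (k + j)" "b = 0 \<or> b = 1"
    by (auto simp: bits_Suc)
  show ?case
  proof (cases "b = 0")
    case False then show ?thesis using Suc t by (auto simp: bits_def)
  next
    case True
    have "val t' < 2 ^ (k + j)" using val_less[of t'] t by (auto simp: bits_def)
    then show ?thesis using t True by (auto simp: bits_def)
  qed
qed

text \<open>Phrased by initial segments of the order, since these determine which strings have been
  discarded.\<close>

definition next_in_order :: "nat \<Rightarrow> nat list \<Rightarrow> nat list \<Rightarrow> bool" where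
  "next_in_order n x x' \<longleftrightarrow> (\<forall>y\<in>bits n. bef y x' \<longleftrightarrow> bef y x \<or> y = x)"

text \<open>The usual successor among strings with a given number of ones. A competitor with prefix
  \<alpha> either continues with \<open>0\<close> and is at most the maximal filling, which is
  \<open>x\<close>, or continues with \<open>1\<close> and is at least the minimal filling, which is
  \<open>x'\<close>. A different prefix decides the comparison alone.\<close>

lemma next_same_weight:
  assumes x: "x = \<alpha> @ 0 # replicate (Suc k) 1 @ replicate j 0" and xb: "x \<in> bits n"
    and x': "x' = \<alpha> @ 1 # replicate (Suc j) 0 @ replicate k 1"
  shows "next_in_order n x x'"
proof -
  have wt: "wt x' = wt x" by (simp add: x x')
  have x'b: "x' \<in> bits n" using xb by (auto simp: x x' bits_def)
  have lt: "val x < val x'"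
  proof (rule val_less_first_diff[OF xb x'b, of "length \<alpha>"])
    show "length \<alpha> < n" using bitsD(1)[OF xb] by (simp add: x)
  qed (simp_all add: x x' nth_append)
  have "val y \<le> val x" if y: "y \<in> bits n" "wt y = wt x" "val y < val x'" for y
  proof -
    define M where "M = Suc (Suc k + j)"
    define \<beta> t where "\<beta> = take (length \<alpha>) y" and "t = drop (length \<alpha>) y"
    have n: "n = length \<alpha> + M" using xb by (auto simp: x bits_def M_def)
    have len: "length \<beta> = length \<alpha>" "length t = M" using y(1) n by (auto simp: \<beta>_def t_def bits_def)
    have yt: "y = \<beta> @ t" by (simp add: \<beta>_def t_def)
    have \<beta>: "\<beta> \<in> bits (length \<alpha>)" and t: "t \<in> bits M"
      using y(1) len unfolding yt by (auto simp: bits_def)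
    have \<alpha>: "\<alpha> \<in> bits (length \<alpha>)" using xb by (auto simp: x bits_def)
    have valy: "val y = val \<beta> * 2 ^ M + val t" using len by (simp add: yt val_append)
    have valx: "val x = val \<alpha> * 2 ^ M + val (0 # replicate (Suc k) 1 @ replicate j 0)"
      unfolding x val_append by (simp add: M_def)
    have valx': "val x' = val \<alpha> * 2 ^ M + val (1 # replicate (Suc j) 0 @ replicate k 1)"
      unfolding x' val_append by (simp add: M_def add.commute)
    have "val (1 # replicate (Suc j) 0 @ replicate k 1) < 2 ^ length (1 # replicate (Suc j) (0::nat) @ replicate k 1)"
      by (rule val_less) auto
    then have u': "val (1 # replicate (Suc j) 0 @ replicate k 1) < 2 ^ M"
      by (simp add: M_def add.commute)
    have "val \<beta> \<le> val \<alpha>"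
    proof (rule ccontr)
      assume "\<not> val \<beta> \<le> val \<alpha>"
      then have "(val \<alpha> + 1) * 2 ^ M \<le> val \<beta> * 2 ^ M" by (intro mult_right_mono) auto
      then have "val x' < val y" using valy valx' u' by (simp add: algebra_simps)
      then show False using y(3) by simp
    qed
    then consider "val \<beta> < val \<alpha>" | "\<beta> = \<alpha>" using val_inj[OF \<beta> \<alpha>] by linarith
    then show ?thesis
    proof cases
      case 1
      then have "(val \<beta> + 1) * 2 ^ M \<le> val \<alpha> * 2 ^ M" by (intro mult_right_mono) auto
      moreover have "val t < 2 ^ M" using val_less[of t] t len by (simp add: bits_def)
      ultimately show ?thesis using valy valx by (simp add: algebra_simps)
    next
      case 2
      obtain b t' where bt: "t = b # t'" "t' \<in> bits (Suc k + j)" "b = 0 \<or> b = 1"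
        using t unfolding M_def bits_Suc by auto
      have wtt: "wt t = Suc k" using y(2) 2 by (simp add: yt x)
      have lt': "length t' = Suc k + j" using bt(2) by (simp add: bits_def)
      show ?thesis
      proof (cases "b = 0")
        case True
        then have "val t' \<le> val (replicate (Suc k) 1 @ replicate j 0)"
          using val_weight_max[OF bt(2)] wtt bt(1) by simp
        then show ?thesis using True bt(1) 2 valx valy by simp
      next
        case False
        then have "wt t' = k" using wtt bt by simp
        moreover have "t' \<in> bits (Suc j + k)" using bt(2) by (simp add: add.commute)
        ultimately have "val (replicate (Suc j) 0 @ replicate k 1) \<le> val t'"
          by (intro val_weight_min) auto
        then have "val x' \<le> val y" using False bt(1,3) 2 lt' valx' valy by (simp add: add.commute)
        then show ?thesis using y(3) by simp
      qed
    qed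
  qed
  moreover have "val y = val x \<longleftrightarrow> y = x" if "y \<in> bits n" for y using val_inj[OF that xb] by blast
  ultimately show ?thesis using lt wt unfolding next_in_order_def bef_def
    by (metis le_neq_implies_less less_trans)
qed

text \<open>\<open>x\<close> is the largest string of weight \<open>k + 1\<close>, \<open>x'\<close>
  the smallest of weight \<open>k\<close>, and heavy strings come first.\<close>

lemma next_lower_weight:
  assumes x: "x = replicate (Suc k) 1 @ replicate j 0" and xb: "x \<in> bits n"
    and x': "x' = replicate (Suc j) 0 @ replicate k 1"
  shows "next_in_order n x x'"
  unfolding next_in_order_def
proof
  fix y assume y: "y \<in> bits n"
  have n: "n = Suc k + j" using xb by (auto simp: x bits_def)
  have wt: "wt x = Suc k" "wt x' = k" by (auto simp: x x')
  have "val y \<le> val x" if "wt y = Suc k" using val_weight_max[of y "Suc k" j] y n that x by simp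
  moreover have "val x' \<le> val y" if "wt y = k"
    using val_weight_min[of y "Suc j" k] y n that x' by (simp add: add.commute)
  moreover have "val y = val x \<longleftrightarrow> y = x" using val_inj[OF y xb] by blast
  moreover have "y = x \<Longrightarrow> wt y = Suc k" using wt by simp
  ultimately show "bef y x' \<longleftrightarrow> bef y x \<or> y = x"
    unfolding bef_def wt by linarith
qed

text \<open>The necklace is compared and not the string, so that classes are discarded only as a
  whole.\<close>

definition remset :: "nat \<Rightarrow> nat list \<Rightarrow> nat list set" where
  "remset n x = {v \<in> bits n. bef (nk v) x}"

lemma finite_remset[simp]: "finite (remset n x)" by (simp add: remset_def)

lemma remset_replicate1: "remset n (replicate n 1) = {}"
proof -
  have "\<not> bef (nk v) (replicate n 1)" if v: "v \<in> bits n" for v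
  proof
    assume b: "bef (nk v) (replicate n 1)"
    have "wt v \<le> n" using v by (rule wt_le)
    then have "wt (nk v) = n" using b by (simp add: bef_def)
    then have "nk v = replicate n 1" using wt_full[of "nk v" n] v by simp
    then show False using b by (simp add: bef_def)
  qed
  then show ?thesis unfolding remset_def by blast
qed

lemma nk_class:
  assumes "x \<in> bits n"
  shows "{v \<in> bits n. nk v = x} = (if neck x then {v. \<exists>k. v = rotate k x} else {})"
proof (cases "neck x")
  case True
  have "\<exists>k. v = rotate k x" if "v \<in> bits n" "nk v = x" for v
  proof -
    obtain k where k: "nk v = rotate k v" using nk_rotation by blast
    obtain j where "v = rotate j (rotate k v)" using rotate_back by blast
    then have "v = rotate j x" using k that(2) by simp
    then show ?thesis ..
  qed
  moreover have "nk (rotate k x) = x" for k using nk_neck[OF assms True] assms by simp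
  ultimately show ?thesis using True assms by auto
next
  case False
  then show ?thesis using neck_nk by auto
qed

text \<open>The set grows only when the enumeration passes a necklace, and then by the complete
  class of it; by \<open>nk_class\<close> other strings contribute nothing.\<close>

lemma remset_next:
  assumes "x \<in> bits n" "next_in_order n x x'"
  shows "remset n x' = remset n x \<union> {v \<in> bits n. nk v = x}" "remset n x \<inter> {v \<in> bits n. nk v = x} = {}"
proof -
  have "bef (nk v) x' \<longleftrightarrow> bef (nk v) x \<or> nk v = x" if "v \<in> bits n" for v
    using assms that unfolding next_in_order_def by simp
  then show "remset n x' = remset n x \<union> {v \<in> bits n. nk v = x}" unfolding remset_def by blast
  have "\<not> bef x x" by (simp add: bef_def)
  then show "remset n x \<inter> {v \<in> bits n. nk v = x} = {}" unfolding remset_def by blast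
qed

section \<open>The truncated cycle\<close>

text \<open>The number of elements is \<open>(n - a) / r\<close> rounded up. It bounds the weight of
  a window, whose ones fill a residue class.\<close>

lemma card_residue_class:
  fixes r :: nat
  assumes "a < r"
  shows "r * card {i. i < n \<and> i mod r = a} \<le> n - a + (r - 1)"
proof -
  define K where "K = (n - a + (r - 1)) div r"
  have "{i. i < n \<and> i mod r = a} \<subseteq> (\<lambda>k. k * r + a) ` {..<K}"
  proof
    fix i assume i: "i \<in> {i. i < n \<and> i mod r = a}"
    then have eq: "i = i div r * r + a" by (metis (mono_tags, lifting) div_mult_mod_eq mem_Collect_eq)
    then have "i div r * r < n - a" using i by (simp add: less_diff_conv)
    then have "Suc (i div r) * r \<le> n - a + (r - 1)" using assms by simp
    then have "Suc (i div r) \<le> K" using assms unfolding K_def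
      by (subst less_eq_div_iff_mult_less_eq) auto
    then show "i \<in> (\<lambda>k. k * r + a) ` {..<K}" using eq by (intro image_eqI[of _ _ "i div r"]) auto
  qed
  then have "card {i. i < n \<and> i mod r = a} \<le> card ((\<lambda>k. k * r + a) ` {..<K})"
    by (intro card_mono) auto
  also have "\<dots> \<le> K" using card_image_le[of "{..<K}"] by (metis card_lessThan finite_lessThan)
  finally have "r * card {i. i < n \<and> i mod r = a} \<le> r * K" by simp
  also have "\<dots> \<le> n - a + (r - 1)" unfolding K_def by simp
  finally show ?thesis .
qed

lemma Suc_mod_eq: "(a::nat) < r \<Longrightarrow> Suc i mod r = Suc a mod r \<longleftrightarrow> i mod r = a"
  by (auto simp: mod_Suc)

lemma add_mod_neq: "0 < (k::nat) \<Longrightarrow> k < n \<Longrightarrow> (t + k) mod n \<noteq> t mod n"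
  using mod_eq_dvd_iff_nat[of t "t + k" n] by (auto dest: dvd_imp_le)

text \<open>The cyclic successor maps zeros injectively to ones, and by the weight at most one
  \<open>1\<close> is not hit. Read from there, a \<open>1\<close> is never followed by a
  \<open>1\<close>, as that one would have to follow a zero, and a \<open>0\<close> is never
  followed by a \<open>0\<close>.\<close>

lemma alternating_rotation:
  assumes u: "u \<in> bits n" and n: "1 \<le> n" and no00: "\<And>i. i < n \<Longrightarrow> u ! i = 0 \<Longrightarrow> u ! (Suc i mod n) = 1"
    and wt: "n \<le> 2 * wt u" "2 * wt u \<le> n + 1"
  shows "\<exists>t. rotate t u = map (\<lambda>i. of_bool (even i)) [0..<n]"
proof -
  define O1 where "O1 = {i. i < n \<and> u ! i = 1}"
  define Z where "Z = {i. i < n \<and> u ! i = 0}"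
  define f where "f i = Suc i mod n" for i
  have fin: "finite O1" "finite Z" by (auto simp: O1_def Z_def)
  have OZ: "O1 \<union> Z = {..<n}" "O1 \<inter> Z = {}" by (auto simp: O1_def Z_def dest: bitsD(2)[OF u])
  have cO: "card O1 = wt u" using wt_card[OF u] by (simp add: O1_def)
  have cZ: "card Z = n - wt u" using card_Un_disjoint[OF fin OZ(2)] OZ(1) cO by simp
  have inj: "inj_on f {..<n}"
    by (rule inj_onI) (auto simp: f_def mod_Suc split: if_splits)
  have fZ: "f ` Z \<subseteq> O1" using no00 n by (auto simp: f_def Z_def O1_def)
  have "card (f ` Z) = card Z" by (rule card_image) (use inj OZ in \<open>auto intro: inj_on_subset\<close>)
  then have cD: "card (O1 - f ` Z) \<le> 1"
    using card_Diff_subset[of "f ` Z" O1] fin fZ cO cZ wt by simp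
  \<comment> \<open>The starting point is the one that follows no zero, or an arbitrary
    \<open>1\<close> if every one follows a zero.\<close>
  obtain t where t: "t \<in> O1" "O1 - f ` Z \<subseteq> {t}"
  proof (cases "O1 - f ` Z = {}")
    case True
    have "O1 \<noteq> {}" using cO wt n by auto
    then show ?thesis using that True by blast
  next
    case False
    then obtain t where "t \<in> O1 - f ` Z" by blast
    moreover have "O1 - f ` Z \<subseteq> {t}"
      using cD calculation fin card_le_Suc0_iff_eq[of "O1 - f ` Z"] by auto
    ultimately show ?thesis using that by blast
  qed
  have tn: "t < n" "u ! t = 1" using t(1) by (auto simp: O1_def)
  have main: "u ! ((t + i) mod n) = of_bool (even i)" if "i < n" for i
    using that
  proof (induction i)
    case 0 then show ?case using tn by simp
  next
    case (Suc i)
    define k where "k = (t + i) mod n"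
    have k: "k < n" "f k = (t + Suc i) mod n" using n by (auto simp: k_def f_def mod_Suc_eq)
    have uk: "u ! k = of_bool (even i)" using Suc by (simp add: k_def)
    show ?case
    proof (cases "even i")
      case False
      then have "u ! f k = 1" using no00[of k] k(1) uk by (simp add: f_def)
      then show ?thesis using False k(2) by simp
    next
      case True
      have "u ! f k \<noteq> 1"
      proof
        assume "u ! f k = 1"
        then have "f k \<in> O1" using n by (simp add: O1_def f_def)
        moreover have "f k \<noteq> t"
        proof
          assume "f k = t"
          then have "(t + Suc i) mod n = t mod n" using k(2) tn by simp
          then show False using Suc.prems add_mod_neq[of "Suc i" n t] by simp
        qed
        ultimately have "f k \<in> f ` Z" using t(2) by blast
        then obtain k' where "k' \<in> Z" "f k = f k'" by blast
        then have "k \<in> Z" using inj k(1) by (auto simp: inj_on_def Z_def)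
        then show False using uk True by (simp add: Z_def)
      qed
      then have "u ! f k = 0" using bitsD(2)[OF u, of "f k"] n by (auto simp: f_def)
      then show ?thesis using True k(2) by simp
    qed
  qed
  have "rotate t u = map (\<lambda>i. of_bool (even i)) [0..<n]"
    by (rule nth_equalityI) (use bitsD(1)[OF u] main in \<open>auto simp: nth_rotate\<close>)
  then show ?thesis by blast
qed

text \<open>
  The windows of length \<open>n\<close> of the word with period \<open>0\<dots>01\<close> of length \<open>r\<close>. For \<open>r = 1\<close> the zero string
  takes the place of the string of ones, which is the first to be discarded.
\<close>

definition inQ :: "nat \<Rightarrow> nat \<Rightarrow> nat list \<Rightarrow> bool" where
  "inQ n r w \<longleftrightarrow> w \<in> bits n \<and>
     (if r = 1 then \<forall>i<n. w ! i = 0 else \<exists>a<r. \<forall>i<n. w ! i = of_bool (i mod r = a))"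

text \<open>The letter appended on the joined cycle after \<open>c\<close> has been shifted out:
  rotation would append \<open>c\<close>. Each join is indexed by the necklace \<open>z1\<close> of
  its heavier class, so the second condition removes precisely the joins of discarded classes to
  their parents.\<close>

definition nextb :: "nat list \<Rightarrow> nat list \<Rightarrow> nat \<Rightarrow> nat" where
  "nextb N z c = (if neck (z @ [1]) \<and> \<not> bef (z @ [1]) N then 1 - c else c)"

text \<open>
  The successor on the truncated cycle. If the successor on the joined cycle has been cut out, the
  other string with the same prefix is taken instead.
\<close>

definition stp :: "nat \<Rightarrow> nat list \<Rightarrow> nat set \<Rightarrow> nat list \<Rightarrow> nat list" where
  "stp n N J v = (let z = tl v; b = nextb N z (hd v)
     in z @ [if \<exists>r\<in>J. inQ n r (z @ [b]) then 1 - b else b])"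

text \<open>The classes before \<open>N\<close> are discarded; \<open>J\<close> is the set of lengths of the cut out windows.\<close>

locale cutdown =
  fixes n :: nat and N :: "nat list" and J :: "nat set"
  assumes n: "1 \<le> n"
    and many: "2 ^ (n - 1) < card (bits n - remset n N)"
    and J: "\<And>r. r \<in> J \<Longrightarrow> 1 \<le> r \<and> 2 * r \<le> n + 1 \<and> r < n"
    and J2: "\<And>r r'. r \<in> J \<Longrightarrow> r' \<in> J \<Longrightarrow> r' < r \<Longrightarrow> r + r' < n \<and> n \<le> 2 * r"
begin

abbreviation rem :: "nat list \<Rightarrow> bool" where "rem v \<equiv> bef (nk v) N"
abbreviation Q :: "nat \<Rightarrow> nat list \<Rightarrow> bool" where "Q \<equiv> inQ n"
abbreviation step :: "nat list \<Rightarrow> nat list" where "step \<equiv> stp n N J"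

definition S :: "nat list set" where
  "S = {v \<in> bits n. \<not> rem v \<and> (\<forall>r\<in>J. \<not> Q r v)}"

lemma S_bits: "v \<in> S \<Longrightarrow> v \<in> bits n" by (simp add: S_def)

lemma finite_S: "finite S" unfolding S_def by simp

text \<open>Complementing the letters maps strings of weight below \<open>n / 2\<close> injectively
  to strings above it.\<close>

lemma card_light: "card {u \<in> bits n. 2 * wt u < n} \<le> 2 ^ (n - 1)"
proof -
  define A where "A = {u \<in> bits n. 2 * wt u < n}"
  define g :: "nat list \<Rightarrow> nat list" where "g = map (\<lambda>b. 1 - b)"
  have g: "g u \<in> bits k \<and> wt (g u) + wt u = k \<and> g (g u) = u" if "u \<in> bits k" for u k
    using that
  proof (induction k arbitrary: u)
    case 0 then show ?case by (simp add: bits_def g_def)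
  next
    case (Suc k)
    then obtain b u' where u': "u = b # u'" "u' \<in> bits k" "b = 0 \<or> b = 1" by (auto simp: bits_Suc)
    have "g u = (1 - b) # g u'" by (simp add: g_def u')
    then show ?case using Suc.IH[OF u'(2)] u' by (auto simp: Cons_bits g_def)
  qed
  have "inj_on g A" by (rule inj_on_inverseI[of _ g]) (use g in \<open>auto simp: A_def\<close>)
  moreover have "g ` A \<subseteq> bits n - A"
  proof
    fix w assume "w \<in> g ` A"
    then obtain u where u: "w = g u" "u \<in> bits n" "2 * wt u < n" by (auto simp: A_def)
    then show "w \<in> bits n - A" using g[of u n] by (auto simp: A_def)
  qed
  ultimately have "card A \<le> card (bits n - A)" by (intro card_inj_on_le) auto
  moreover have "A \<subseteq> bits n" by (auto simp: A_def)
  ultimately have "2 * card A \<le> 2 ^ n"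
    using card_Diff_subset[of A "bits n"] card_mono[of "bits n" A] finite_subset[of A "bits n"]
    by (simp add: card_bits)
  also have "(2::nat) ^ n = 2 * 2 ^ (n - 1)" using n by (cases n) auto
  finally show ?thesis by (simp add: A_def)
qed

text \<open>The kept strings are too many to be all light. Hence the discarding stops before it gets
  below weight \<open>n / 2\<close>.\<close>

lemma kept_heavy: obtains u where "u \<in> bits n" "\<not> rem u" "n \<le> 2 * wt u"
proof (rule ccontr)
  assume no: "\<not> thesis"
  note found = that
  have "2 * wt u < n" if "u \<in> bits n" "\<not> rem u" for u
    using no found[OF that] by (meson not_less)
  then have "bits n - remset n N \<subseteq> {u \<in> bits n. 2 * wt u < n}"
    by (auto simp: remset_def)
  then have "card (bits n - remset n N) \<le> card {u \<in> bits n. 2 * wt u < n}"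
    by (intro card_mono) auto
  then have "card (bits n - remset n N) \<le> 2 ^ (n - 1)" using card_light by simp
  then show False using many by simp
qed

lemma kept_light: assumes "w \<in> bits n" "2 * wt w < n" shows "\<not> rem w"
proof
  assume "rem w"
  then have "wt N \<le> wt w" by (auto simp: bef_def)
  moreover obtain u where u: "u \<in> bits n" "\<not> rem u" "n \<le> 2 * wt u" by (rule kept_heavy)
  then have "wt u \<le> wt N" by (auto simp: bef_def)
  ultimately show False using assms u by simp
qed

lemma Q_bits: "Q r w \<Longrightarrow> w \<in> bits n" by (simp add: inQ_def)

lemma Q_residue: "Q r w \<Longrightarrow> r \<noteq> 1 \<Longrightarrow> \<exists>a<r. \<forall>i<n. w ! i = of_bool (i mod r = a)"
  by (simp add: inQ_def)

text \<open>Alternating strings may have weight \<open>n / 2\<close> or slightly more, so their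
  weight alone does not save them. In that case every string of the same weight that is not a
  rotation of theirs contains \<open>00\<close> cyclically, and its necklace starts with
  \<open>00\<close>, while theirs does not. Their class is thus the last one of its weight to be
  discarded, and a kept string of weight at least \<open>n / 2\<close> would have to come even
  later.\<close>

lemma kept_Q2: assumes "2 \<in> J" "Q 2 w" shows "\<not> rem w"
proof
  assume rem: "rem w"
  obtain a where a: "a < 2" "\<And>i. i < n \<Longrightarrow> w ! i = of_bool (i mod 2 = a)"
    using Q_residue[OF assms(2)] by auto
  have w: "w \<in> bits n" using assms(2) by (rule Q_bits)
  have n3: "3 \<le> n" using J[OF assms(1)] by simp
  have heavy: "n \<le> 2 * wt w" using kept_light[OF w] rem by linarith
  have "{i. i < n \<and> w ! i = 1} = {i. i < n \<and> i mod 2 = a}" by (auto simp: a(2) of_bool_def split: if_splits)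
  then have wt: "2 * wt w \<le> n - a + 1"
    using wt_card[OF w] card_residue_class[OF a(1), of n] by simp
  \<comment> \<open>Only the seam is critical. For odd \<open>n\<close> the pattern
    \<open>01\<dots>10\<close> has \<open>00\<close> there, but its weight is below
    \<open>n / 2\<close>, which \<open>heavy\<close> excludes.\<close>
  have no00w: "w ! (Suc i mod n) = 1" if i: "i < n" "w ! i = 0" for i
  proof (cases "Suc i < n")
    case True
    then show ?thesis using a i by (auto simp: mod_Suc split: if_splits)
  next
    case False
    then have "Suc i = n" using i by simp
    show ?thesis
    proof (cases "a = 0")
      case True then show ?thesis using a(2)[of 0] n \<open>Suc i = n\<close> by simp
    next
      case False
      then have "a = 1" using a(1) by simp
      then have "i mod 2 = 0" using a(2)[of i] i by auto
      then have "odd n" using \<open>Suc i = n\<close> by (metis even_Suc mod_0_imp_dvd)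
      then show ?thesis using heavy wt \<open>a = 1\<close> by presburger
    qed
  qed
  obtain t where t: "rotate t w = map (\<lambda>i. of_bool (even i)) [0..<n]"
    using alternating_rotation[OF w n no00w heavy] wt by force
  obtain u where u: "u \<in> bits n" "\<not> rem u" "n \<le> 2 * wt u" by (rule kept_heavy)
  have "wt u = wt w" and lt: "val (nk w) < val (nk u)"
    using rem u heavy wt unfolding bef_def by (simp_all, linarith+)
  define y where "y = nk u"
  have y: "y \<in> bits n" "wt y = wt w" "neck y" using u neck_nk \<open>wt u = wt w\<close> by (auto simp: y_def)
  show False
  proof (cases "\<forall>i<n. y ! i = 0 \<longrightarrow> y ! (Suc i mod n) = 1")
    case True
    then obtain t' where "rotate t' y = map (\<lambda>i. of_bool (even i)) [0..<n]"
      using alternating_rotation[OF y(1) n] heavy wt y(2) by force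
    then have "nk y = nk w" using t y(1) w nk_rotate by metis
    then show False using lt nk_neck[OF y(1,3)] by (simp add: y_def)
  next
    case False
    then obtain i where i: "i < n" "y ! i = 0" "y ! (Suc i mod n) \<noteq> 1" by blast
    then have i': "y ! (Suc i mod n) = 0" using bitsD(2)[OF y(1), of "Suc i mod n"] n by auto
    obtain j where j: "nk w = rotate j w" using nk_rotation by blast
    have nkw: "nk w ! 0 = w ! (j mod n)" "nk w ! 1 = w ! (Suc j mod n)"
      using j bitsD(1)[OF w] n3 by (auto simp: nth_rotate)
    have "nk w ! 0 = 1 \<or> nk w ! 1 = 1"
      using no00w[of "j mod n"] bitsD(2)[OF w, of "j mod n"] n unfolding nkw by (auto simp: mod_Suc_eq)
    moreover have r: "rotate i y ! 0 = 0" "rotate i y ! 1 = 0"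
      using i i' bitsD(1)[OF y(1)] n3 by (auto simp: nth_rotate)
    ultimately obtain b where b: "b \<le> 1" "nk w ! b = 1" "\<And>l. l \<le> b \<Longrightarrow> rotate i y ! l = 0"
      by (metis le_0_eq le_SucE One_nat_def le0 le_refl)
    have "val (rotate i y) < val (nk w)"
      by (rule val_less_leading_zeros[of _ n _ b]) (use y w b n3 in auto)
    moreover have "val y \<le> val (rotate i y)" using y(3) by (simp add: neck_def)
    ultimately show False using lt by (simp add: y_def)
  qed
qed

text \<open>From \<open>r = 3\<close> on the ones are so sparse that
  \<open>2 * r \<le> n + 1\<close> keeps the weight below \<open>n / 2\<close>; the zero string for
  \<open>r = 1\<close> is light as well.\<close>

lemma kept_Q: assumes r: "r \<in> J" and q: "Q r w" shows "\<not> rem w"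
proof -
  have w: "w \<in> bits n" using q by (rule Q_bits)
  consider "r = 1" | "r = 2" | "3 \<le> r" using J[OF r] by linarith
  then show ?thesis
  proof cases
    case 1
    then have "w = replicate n 0" using q by (intro nth_equalityI) (auto simp: inQ_def bits_def)
    then show ?thesis using kept_light[OF w] n by simp
  next
    case 2
    then show ?thesis using kept_Q2 r q by simp
  next
    case 3
    then obtain a where a: "a < r" "\<And>i. i < n \<Longrightarrow> w ! i = of_bool (i mod r = a)"
      using Q_residue[OF q] by auto
    have "{i. i < n \<and> w ! i = 1} = {i. i < n \<and> i mod r = a}" by (auto simp: a(2) of_bool_def split: if_splits)
    then have wt: "r * wt w \<le> n - a + (r - 1)"
      using wt_card[OF w] card_residue_class[OF a(1), of n] by simp
    have "2 * wt w < n"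
    proof (rule ccontr)
      assume "\<not> 2 * wt w < n"
      then have "r * n \<le> r * (2 * wt w)" by simp
      also have "\<dots> \<le> 2 * (n + (r - 1))" using wt by simp
      also have "\<dots> \<le> 2 * n + (n - 1)" using J[OF r] by arith
      finally have "r * n < 3 * n" using n by linarith
      then show False using 3 by simp
    qed
    then show ?thesis using kept_light[OF w] by simp
  qed
qed

lemma Q_periodic: assumes "Q r w" "i + r < n" shows "w ! (i + r) = w ! i"
  using assms unfolding inQ_def by (cases "r = 1") auto

text \<open>The periodic word can be shifted by one place. With \<open>Q_succ\<close> this gives
  every window a predecessor and a successor that are windows.\<close>

lemma Q_pred:
  assumes "Q r (z @ [b])" "0 < r"
  obtains c where "c = 0 \<or> c = 1" "Q r (c # z)"
proof (cases "r = 1")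
  case True
  have z: "z \<in> bits (n - 1)" "length z = n - 1" using assms(1) by (auto simp: inQ_def snoc_bits bitsD)
  have "z ! i = 0" if "i < n - 1" for i
    using assms(1) True that z by (auto simp: inQ_def nth_append dest: spec[of _ i])
  then have "Q r (0 # z)" using True z n by (auto simp: inQ_def Cons_bits nth_Cons')
  then show ?thesis using that by blast
next
  case False
  have z: "z \<in> bits (n - 1)" "length z = n - 1" using assms(1) by (auto simp: inQ_def snoc_bits bitsD)
  obtain a where a: "a < r" "\<And>i. i < n \<Longrightarrow> (z @ [b]) ! i = of_bool (i mod r = a)"
    using Q_residue[OF assms(1) False] by auto
  \<comment> \<open>Shifting turns the residue \<open>a\<close> into \<open>Suc a mod r\<close>, and
    the new first letter is a one exactly if this residue is \<open>0\<close>.\<close>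
  define c :: nat where "c = of_bool (Suc a mod r = 0)"
  have "(c # z) ! i = of_bool (i mod r = Suc a mod r)" if "i < n" for i
  proof (cases i)
    case 0 then show ?thesis by (auto simp: c_def)
  next
    case (Suc j)
    moreover have "j < n - 1" using Suc that by simp
    ultimately have "(c # z) ! i = (z @ [b]) ! j" using that z by (simp add: nth_append)
    then show ?thesis using a(2)[of j] Suc that Suc_mod_eq[OF a(1)] by simp
  qed
  then have "Q r (c # z)" using False z n assms(2) by (auto simp: inQ_def Cons_bits c_def intro!: exI[of _ "Suc a mod r"])
  then show ?thesis using that[of c] by (simp add: c_def)
qed

lemma Q_succ:
  assumes "Q r (c # z)" "0 < r"
  obtains b where "b = 0 \<or> b = 1" "Q r (z @ [b])"
proof (cases "r = 1")
  case True
  have z: "z \<in> bits (n - 1)" "length z = n - 1" using assms(1) by (auto simp: inQ_def Cons_bits bitsD)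
  have "z ! i = 0" if "i < n - 1" for i
    using assms(1) True that z by (auto simp: inQ_def dest: spec[of _ "Suc i"])
  then have "Q r (z @ [0])" using True z n by (auto simp: inQ_def snoc_bits nth_append)
  then show ?thesis using that by blast
next
  case False
  have z: "z \<in> bits (n - 1)" "length z = n - 1" using assms(1) by (auto simp: inQ_def Cons_bits bitsD)
  obtain a where a: "a < r" "\<And>i. i < n \<Longrightarrow> (c # z) ! i = of_bool (i mod r = a)"
    using Q_residue[OF assms(1) False] by auto
  define a' where "a' = (if a = 0 then r - 1 else a - 1)"
  have a': "a' < r" "Suc a' mod r = a" using a(1) by (auto simp: a'_def)
  define b :: nat where "b = of_bool ((n - 1) mod r = a')"
  have "(z @ [b]) ! i = of_bool (i mod r = a')" if "i < n" for i
  proof (cases "i = n - 1")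
    case True then show ?thesis using z by (simp add: b_def nth_append)
  next
    case False
    then have "i < n - 1" using that by simp
    then have "(z @ [b]) ! i = (c # z) ! Suc i" using z by (simp add: nth_append)
    then show ?thesis using a(2)[of "Suc i"] False that Suc_mod_eq[OF a'(1), of i] a'(2) by simp
  qed
  then have "Q r (z @ [b])" using False z n a' by (auto simp: inQ_def snoc_bits b_def)
  then show ?thesis using that[of b] by (simp add: b_def)
qed

text \<open>As \<open>r < n\<close>, the last letter repeats the one \<open>r\<close> places
  earlier, which already lies in \<open>z\<close>.\<close>

lemma Q_det: assumes "r \<in> J" "Q r (z @ [b])" "Q r (z @ [b'])" shows "b = b'"
proof -
  have r: "1 \<le> r" "r < n" using J[OF assms(1)] by auto
  have len: "length z = n - 1" using Q_bits[OF assms(2)] by (auto simp: bits_def)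
  have i: "n - 1 - r + r = n - 1" "n - 1 - r < n - 1" using r by auto
  have "b = z ! (n - 1 - r)"
    using Q_periodic[OF assms(2), of "n - 1 - r"] i r len by (simp add: nth_append)
  moreover have "b' = z ! (n - 1 - r)"
    using Q_periodic[OF assms(3), of "n - 1 - r"] i r len by (simp add: nth_append)
  ultimately show ?thesis by simp
qed

text \<open>A window for \<open>r' \<ge> 2\<close> has two ones at distance \<open>r'\<close>, which
  are incongruent modulo a larger \<open>r\<close>; the bound \<open>r + r' < n\<close> makes both
  visible. For \<open>r' = 1\<close> there is no one at all, but a window for \<open>r\<close> has
  one.\<close>

lemma Q_disjoint:
  assumes "r \<in> J" "r' \<in> J" "Q r w" "Q r' w" shows "r = r'"
proof -
  have False if *: "r \<in> J" "r' \<in> J" "Q r w" "Q r' w" "r' < r" for r r'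
  proof -
    have r: "r + r' < n" "1 \<le> r'" using J2[OF *(1,2,5)] J[OF *(2)] by auto
    have r1: "r \<noteq> 1" using *(5) r by simp
    obtain a where a: "a < r" "\<And>i. i < n \<Longrightarrow> w ! i = of_bool (i mod r = a)"
      using Q_residue[OF *(3) r1] by auto
    show False
    proof (cases "r' = 1")
      case True
      then have "w ! a = 0" using *(4) a r by (auto simp: inQ_def)
      moreover have "w ! a = 1" using a(2)[of a] a(1) r by simp
      ultimately show False by simp
    next
      case False
      then obtain a' where a': "a' < r'" "\<And>i. i < n \<Longrightarrow> w ! i = of_bool (i mod r' = a')"
        using Q_residue[OF *(4)] by auto
      have one: "w ! a' = 1" "w ! (a' + r') = 1" using a'(2)[of a'] a'(2)[of "a' + r'"] a'(1) *(5) r by auto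
      have lt: "a' < n" "a' + r' < n" using a'(1) *(5) r by auto
      have "a' mod r = a" using a(2)[OF lt(1)] one(1) by (metis of_bool_eq(1) zero_neq_one)
      moreover have "(a' + r') mod r = a" using a(2)[OF lt(2)] one(2) by (metis of_bool_eq(1) zero_neq_one)
      ultimately have "a' mod r = (a' + r') mod r" by simp
      then show False using *(5) r add_mod_neq[of r' r a'] by simp
    qed
  qed
  then show ?thesis using assms by (meson linorder_neqE_nat)
qed

lemma rem_rotate: "v \<in> bits n \<Longrightarrow> rem (rotate k v) = rem v" by simp

lemma rem_rotate1: "v \<in> bits n \<Longrightarrow> rem (rotate1 v) = rem v"
  using rem_rotate[of v 1] by simp

text \<open>Changing the last letter to \<open>0\<close> lowers the weight, so the parent of a kept
  class is kept: only leaves are ever discarded.\<close>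

lemma kept_children:
  assumes "z @ [1] \<in> bits n" "neck (z @ [1])" "\<not> bef (z @ [1]) N" "b = 0 \<or> b = 1"
  shows "\<not> rem (z @ [b])"
proof -
  have "\<not> rem (z @ [1])" using nk_neck[OF assms(1,2)] assms(3) by simp
  moreover have "\<not> rem (z @ [0])" using assms(3) by (auto simp: bef_def)
  ultimately show ?thesis using assms(4) by auto
qed

text \<open>The window that precedes \<open>z b\<close> is \<open>0z\<close> or \<open>1z\<close>,
  but not \<open>cz\<close>, which lies in \<open>S\<close>. The remaining string is a window for
  only one length and has only one continuation as such. So \<open>z\<close> followed by the other
  letter is no window, and a single flip of the letter suffices.\<close>

lemma not_flagged_both:
  assumes v: "c # z \<in> S" and r: "r \<in> J" "Q r (z @ [b])" and b: "b = 0 \<or> b = 1" and r': "r' \<in> J"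
  shows "\<not> Q r' (z @ [1 - b])" and "Q r ((1 - c) # z)"
proof -
  have c: "c = 0 \<or> c = 1" using S_bits[OF v] by (simp add: Cons_bits)
  have pred: "Q s ((1 - c) # z)" if sJ: "s \<in> J" and sQ: "Q s (z @ [d])" for s d
  proof -
    obtain c' where c': "c' = 0 \<or> c' = 1" "Q s (c' # z)"
      using Q_pred[OF sQ] J[OF sJ] by auto
    have "c' \<noteq> c" using v sJ c' by (auto simp: S_def)
    then show ?thesis using c' c by (metis diff_self_eq_0 diff_zero)
  qed
  show "Q r ((1 - c) # z)" using pred r by blast
  show "\<not> Q r' (z @ [1 - b])"
  proof
    assume q: "Q r' (z @ [1 - b])"
    have "r = r'" using Q_disjoint[OF r(1) r'(1)] pred[OF r] pred[OF r' q] by blast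
    then show False using Q_det[OF r(1), of z b "1 - b"] r q b by auto
  qed
qed

lemma step_S: assumes v: "v \<in> S" shows "step v \<in> S"
proof -
  obtain c z where cz: "v = c # z" "c = 0 \<or> c = 1" "z \<in> bits (n - 1)"
    using S_bits[OF v] n by (cases v) (auto simp: Cons_bits bits_def)
  define b where "b = nextb N z c"
  have b: "b = 0 \<or> b = 1" using cz(2) by (auto simp: b_def nextb_def)
  have z1: "z @ [d] \<in> bits n" if "d = 0 \<or> d = 1" for d using cz(3) n that by (auto simp: snoc_bits)
  have dz: "d # z \<in> bits n" if "d = 0 \<or> d = 1" for d using cz(3) n that by (auto simp: Cons_bits)
  show ?thesis
  proof (cases "\<exists>r\<in>J. Q r (z @ [b])")
    case False
    have "\<not> rem (z @ [b])"
    proof (cases "neck (z @ [1]) \<and> \<not> bef (z @ [1]) N")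
      case True then show ?thesis using kept_children z1 b by blast
    next
      case nc: False
      then have "z @ [b] = rotate1 v" using cz by (auto simp: b_def nextb_def)
      then show ?thesis using v rem_rotate1[of v] S_bits[OF v] by (simp add: S_def)
    qed
    then show ?thesis using False b z1[of b] cz unfolding S_def stp_def Let_def b_def by auto
  next
    case True
    then obtain r where r: "r \<in> J" "Q r (z @ [b])" by blast
    have st: "step v = z @ [1 - b]" using True cz unfolding stp_def Let_def b_def by auto
    have "\<not> rem (z @ [1 - b])"
    proof (cases "neck (z @ [1]) \<and> \<not> bef (z @ [1]) N")
      case True then show ?thesis using kept_children[of z "1 - b"] z1 b by auto
    next
      case nc: False
      then have "b = c" by (auto simp: b_def nextb_def)
      \<comment> \<open>Without an exchange, flipping the letter gives the rotation of the window
        \<open>(1 - c) # z\<close>, and windows lie in kept classes.\<close>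
      have "Q r ((1 - c) # z)" using not_flagged_both(2) v r b cz by metis
      then have "\<not> rem ((1 - c) # z)" using kept_Q r by blast
      moreover have "z @ [1 - b] = rotate1 ((1 - c) # z)" using \<open>b = c\<close> by simp
      moreover have "(1 - c) # z \<in> bits n" using dz[of "1 - c"] cz(2) by auto
      ultimately show ?thesis using rem_rotate1 by metis
    qed
    moreover have "\<forall>r'\<in>J. \<not> Q r' (z @ [1 - b])" using not_flagged_both(1)[of c z r b] v r b cz by blast
    ultimately show ?thesis using z1[of "1 - b"] b unfolding st S_def by auto
  qed
qed

text \<open>Two strings with the same tail \<open>z\<close> get different continuations unless one
  of these is flipped. Then one continuation is a window, and its predecessor among the windows is
  one of the two strings, although both lie in \<open>S\<close>.\<close>

lemma inj_step: "inj_on step S"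
proof (rule inj_onI, rule ccontr)
  fix v v' assume v: "v \<in> S" "v' \<in> S" "step v = step v'" "v \<noteq> v'"
  obtain c z where cz: "v = c # z" "c = 0 \<or> c = 1"
    using S_bits[OF v(1)] n by (cases v) (auto simp: Cons_bits bits_def)
  obtain c' z' where cz': "v' = c' # z'" "c' = 0 \<or> c' = 1"
    using S_bits[OF v(2)] n by (cases v') (auto simp: Cons_bits bits_def)
  have "z' = z" using v(3) cz cz' by (simp add: stp_def Let_def)
  then have "c' = 1 - c" using cz cz' v(4) by auto
  define b where "b = nextb N z c"
  have b: "b = 0 \<or> b = 1" using cz(2) by (auto simp: b_def nextb_def)
  have b': "nextb N z c' = 1 - b" using \<open>c' = 1 - c\<close> cz(2) by (auto simp: b_def nextb_def)
  have "(\<exists>r\<in>J. Q r (z @ [b])) \<or> (\<exists>r\<in>J. Q r (z @ [1 - b]))"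
    using v(3) b b' b_def unfolding cz(1) cz'(1) \<open>z' = z\<close> stp_def Let_def by (auto split: if_splits)
  then obtain r d where r: "r \<in> J" "Q r (z @ [d])" by blast
  then obtain d' where "d' = 0 \<or> d' = 1" "Q r (d' # z)" using Q_pred J by (metis less_le_trans less_one)
  moreover from this have "d' = c \<or> d' = c'" using cz(2) \<open>c' = 1 - c\<close> by auto
  ultimately show False using v r cz cz' \<open>z' = z\<close> by (auto simp: S_def)
qed

lemma orb_symS: "x \<in> S \<Longrightarrow> orb step x y \<Longrightarrow> orb step y x"
  using orb_sym[OF finite_S _ inj_step] step_S by blast

end

lemma of_bool_eq_Suc_0[simp]: "of_bool P = Suc 0 \<longleftrightarrow> P"
  by (cases P) auto

lemma Suc_0_eq_of_bool[simp]: "Suc 0 = of_bool P \<longleftrightarrow> P"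
  by (cases P) auto

lemma replicate_bits: "b = 0 \<or> b = 1 \<Longrightarrow> replicate k b \<in> bits k"
  by (rule bitsI) auto

section \<open>The two classes met by the windows, and the second exchange\<close>

context cutdown
begin

text \<open>
  \<open>xr r\<close> is the necklace of the heavier of the two classes that contain the windows for \<open>r\<close>, and \<open>yr r\<close> is
  the string of the lighter class from which the joined cycle enters it. In terms of
  \<open>n = q r + e\<close>, \<open>xr r\<close> is \<open>(0\<^sup>r\<^sup>-\<^sup>11)\<^sup>q0\<^sup>e\<^sup>-\<^sup>11\<close>.
\<close>

definition xr :: "nat \<Rightarrow> nat list" where
  "xr r = map (\<lambda>i. of_bool (i mod r = r - 1 \<or> i = n - 1)) [0..<n]"

definition yr :: "nat \<Rightarrow> nat list" where
  "yr r = 0 # butlast (xr r)"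

lemma xr_nth: "i < n \<Longrightarrow> xr r ! i = of_bool (i mod r = r - 1 \<or> i = n - 1)"
  by (simp add: xr_def)

lemma xr_bits: "xr r \<in> bits n"
  by (rule bitsI) (auto simp: xr_nth, simp add: xr_def)

lemma length_xr[simp]: "length (xr r) = n" by (simp add: xr_def)

lemma xr_snoc: "xr r = butlast (xr r) @ [1]"
proof -
  have ne: "xr r \<noteq> []" using n by (metis length_xr length_0_conv not_one_le_zero)
  then have "last (xr r) = 1" using n by (simp add: last_conv_nth xr_nth)
  then show ?thesis using ne by (metis append_butlast_last_id)
qed

lemma yr_nth: assumes "i < n" "2 \<le> r" shows "yr r ! i = of_bool (0 < i \<and> i mod r = 0)"
proof (cases i)
  case (Suc j)
  then have "yr r ! i = xr r ! j" using assms by (simp add: yr_def nth_butlast)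
  then show ?thesis using Suc assms by (auto simp: xr_nth mod_Suc)
qed (simp add: yr_def)

lemma yr_bits: "yr r \<in> bits n"
proof -
  have "butlast (xr r) @ [1] \<in> bits n" using xr_bits xr_snoc by metis
  then show ?thesis by (simp add: yr_def Cons_bits snoc_bits)
qed

text \<open>No cyclic run of zeros in a necklace is longer than the run at its beginning.\<close>

lemma neck_prefix_zeros:
  assumes "w \<in> bits n" "neck w" "a < n" "w ! a = 1" shows "\<exists>i\<le>a. w ! ((s + i) mod n) \<noteq> 0"
proof (rule ccontr)
  assume "\<not> ?thesis"
  then have "rotate s w ! i = 0" if "i \<le> a" for i
    using that assms(3) bitsD(1)[OF assms(1)] by (simp add: nth_rotate)
  then have "val (rotate s w) < val w"
    using val_less_leading_zeros[of "rotate s w" n w a] assms by simp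
  then show False using assms(2) unfolding neck_def by (metis not_le)
qed

text \<open>The windows touch only one join. If the ones of \<open>z\<close> were at a residue
  \<open>a < r - 1\<close>, the one at place \<open>a\<close> would be followed by at least
  \<open>a + 1\<close> zeros, more than there are in front of it. By
  \<open>2 * r \<le> n + 1\<close> these zeros fit into \<open>z\<close>, against
  minimality.\<close>

lemma neck_Q:
  assumes r: "r \<in> J" "2 \<le> r" and z: "neck (z @ [1])" "Q r (z @ [b])"
  shows "z @ [1] = xr r"
proof -
  have rn: "2 * r \<le> n + 1" "r < n" using J[OF r(1)] by auto
  obtain a where a: "a < r" "\<And>i. i < n \<Longrightarrow> (z @ [b]) ! i = of_bool (i mod r = a)"
    using Q_residue[OF z(2)] r(2) by auto
  have zb: "z \<in> bits (n - 1)" "length z = n - 1" using Q_bits[OF z(2)] by (auto simp: snoc_bits bitsD)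
  have z1: "z @ [1] \<in> bits n" using zb n by (simp add: snoc_bits)
  have nth: "(z @ [1]) ! i = of_bool (i mod r = a)" if "i < n - 1" for i
    using a(2)[of i] that zb by (simp add: nth_append)
  have "a = r - 1"
  proof (rule ccontr)
    assume "a \<noteq> r - 1"
    then have ar: "Suc a < r" using a(1) by simp
    have "(z @ [1]) ! a = 1" using nth[of a] a(1) rn by simp
    then obtain i where i: "i \<le> a" "(z @ [1]) ! ((Suc a + i) mod n) \<noteq> 0"
      using neck_prefix_zeros[OF z1 z(1), of a "Suc a"] a(1) rn by auto
    have lt: "Suc a + i < n - 1" using i(1) ar rn by linarith
    then have "(a + Suc i) mod r = a mod r" using i(2) nth[of "Suc a + i"] a(1) by (simp split: if_splits)
    then show False using add_mod_neq[of "Suc i" r a] i(1) ar by simp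
  qed
  show ?thesis
  proof (rule nth_equalityI)
    fix i assume "i < length (z @ [1])"
    then have "i < n" using zb n by simp
    then show "(z @ [1]) ! i = xr r ! i"
      using nth[of i] zb \<open>a = r - 1\<close> by (cases "i = n - 1") (auto simp: xr_nth nth_append)
  qed (use zb n in simp)
qed

lemma xr_inject:
  assumes "r \<in> J" "r' \<in> J" "2 \<le> r" "2 \<le> r'" "xr r = xr r'" shows "r = r'"
proof -
  have False if *: "r \<in> J" "r' \<in> J" "2 \<le> r" "2 \<le> r'" "xr r = xr r'" "r' < r" for r r'
  proof -
    have "r < n" using J[OF *(1)] by simp
    then have "xr r' ! (r' - 1) = 1" "xr r ! (r' - 1) = 0"
      using *(3,4,6) \<open>r < n\<close> by (auto simp: xr_nth)
    then show False using *(5) by simp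
  qed
  then show ?thesis using assms by (metis linorder_neqE_nat)
qed

context
  fixes r e :: nat
  assumes r: "r \<in> J" "2 \<le> r" and nd: "\<not> r dvd n" and e_def: "e = n mod r"
begin

lemma residue_bounds: "1 \<le> e" "e < r" "r < n" "r \<le> n - e" "(n - e) mod r = 0"
proof -
  show "1 \<le> e" "e < r" using nd r(2) by (auto simp: e_def mod_greater_zero_iff_not_dvd Suc_le_eq)
  show "r < n" using J[OF r(1)] by simp
  show *: "(n - e) mod r = 0" unfolding e_def by simp
  have "n - e \<noteq> 0" using \<open>r < n\<close> \<open>e < r\<close> by simp
  then show "r \<le> n - e" using * by (meson dvd_imp_le mod_0_imp_dvd not_gr_zero)
qed

text \<open>A rotation by a non-multiple of \<open>r\<close> has a one among its first
  \<open>r - 1\<close> letters, where \<open>xr r\<close> has zeros. A rotation by a positive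
  multiple agrees with \<open>xr r\<close> until the additional final one arrives, at a place where
  \<open>xr r\<close> has a zero because \<open>r\<close> does not divide \<open>n\<close>.\<close>

lemma neck_xr: "neck (xr r)"
  unfolding neck_def
proof
  fix k
  define s where "s = k mod n"
  have s: "s < n" using n by (simp add: s_def)
  have rot: "rotate k (xr r) = rotate s (xr r)" by (metis length_xr rotate_conv_mod s_def)
  have rb: "rotate s (xr r) \<in> bits n" using xr_bits by simp
  have nth: "rotate s (xr r) ! i = xr r ! ((s + i) mod n)" if "i < n" for i
    using that by (simp add: nth_rotate)
  show "val (xr r) \<le> val (rotate k (xr r))"
  proof (cases "s mod r = 0")
    case False
    obtain i where i: "i < r - 1" "rotate s (xr r) ! i = 1"
    proof (cases "s + (r - 1 - s mod r) < n")
      case True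
      have "s + (r - 1 - s mod r) = (s - s mod r) + (r - 1)"
        using r(2) mod_less_divisor[of r s] mod_less_eq_dividend[of s r] by linarith
      moreover have "(s - s mod r + (r - 1)) mod r = r - 1" using r(2)
        unfolding minus_mod_eq_mult_div mod_mult_self4 by simp
      ultimately show ?thesis using that[of "r - 1 - s mod r"] nth[of "r - 1 - s mod r"] True False r(2)
        by (auto simp: xr_nth)
    next
      case nt: False
      have "n - 1 - s < r - 1" using nt False s by simp
      then show ?thesis using that[of "n - 1 - s"] nth[of "n - 1 - s"] s by (auto simp: xr_nth)
    qed
    have "val (xr r) < val (rotate s (xr r))"
      by (rule val_less_leading_zeros[of _ n _ i]) (use i residue_bounds xr_bits in \<open>auto simp: xr_nth\<close>)
    then show ?thesis using rot by simp
  next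
    case True
    show ?thesis
    proof (cases "s = 0")
      case False
      have same: "(s + i) mod r = i mod r" for i using True by (metis add_0 mod_add_left_eq)
      have "val (xr r) < val (rotate s (xr r))"
      proof (rule val_less_first_diff[of _ n _ "n - 1 - s"])
        show "xr r ! i = rotate s (xr r) ! i" if "i < n - 1 - s" for i
          using that nth[of i] same[of i] False by (auto simp: xr_nth)
        have "(n - 1 - s) mod r = (n - 1) mod r" using same[of "n - 1 - s"] s by simp
        moreover have "(n - 1) mod r \<noteq> r - 1"
        proof
          assume "(n - 1) mod r = r - 1"
          then have "Suc (n - 1) mod r = 0" using r(2) by (simp add: mod_Suc)
          then show False using nd n by auto
        qed
        ultimately show "xr r ! (n - 1 - s) < rotate s (xr r) ! (n - 1 - s)"
          using nth[of "n - 1 - s"] s False by (auto simp: xr_nth)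
      qed (use xr_bits s in auto)
      then show ?thesis using rot by simp
    qed (use rot in simp)
  qed
qed

text \<open>Read from one of its last \<open>e\<close> places, the word consists of a suffix of the
  short block \<open>0\<dots>01\<close>, the \<open>q\<close> full blocks and fewer than
  \<open>e\<close> zeros, so it has period \<open>r\<close> throughout.\<close>

lemma rotate_xr_Q:
  assumes j: "n - e \<le> j" "j < n" and l: "l < n"
  shows "rotate j (xr r) ! l = of_bool (l mod r = n - 1 - j)"
proof (cases "j + l < n")
  case True
  have "(j + l) mod r = (j + l - (n - e)) mod r"
    using j residue_bounds(5) by (metis add_0 le_add_diff_inverse mod_add_left_eq trans_le_add1)
  also have "\<dots> = j + l - (n - e)" using True residue_bounds by simp
  finally have "(j + l) mod r \<noteq> r - 1" using True residue_bounds by linarith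
  moreover have "l mod r = l" using True j residue_bounds by simp
  ultimately show ?thesis using True l by (auto simp: nth_rotate xr_nth)
next
  case False
  then have "(j + l) mod n = j + l - n" using j l by (simp add: le_mod_geq)
  then have "rotate j (xr r) ! l = of_bool ((j + l - n) mod r = r - 1)"
    using j l False residue_bounds by (auto simp: nth_rotate xr_nth)
  also have "(j + l - n) mod r = r - 1 \<longleftrightarrow> l mod r = n - 1 - j"
  proof -
    define d where "d = n - 1 - j"
    have d: "d < r" "j = n - 1 - d" using j residue_bounds by (auto simp: d_def)
    have "l = Suc d + (j + l - n)" using j l False by (simp add: d_def)
    then have "l mod r = (d + Suc (j + l - n)) mod r" by simp
    moreover have "(j + l - n) mod r = r - 1 \<longleftrightarrow> Suc (j + l - n) mod r = 0"
      using r(2) by (auto simp: mod_Suc)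
    moreover have "Suc (j + l - n) mod r = 0 \<longleftrightarrow> (d + Suc (j + l - n)) mod r = d"
    proof
      assume "Suc (j + l - n) mod r = 0"
      then show "(d + Suc (j + l - n)) mod r = d" using d by (metis add.right_neutral mod_add_right_eq mod_less)
    next
      assume *: "(d + Suc (j + l - n)) mod r = d"
      then have "(d + Suc (j + l - n)) mod r = d mod r" using d by simp
      then have "r dvd (d + Suc (j + l - n)) - d" by (subst (asm) mod_eq_dvd_iff_nat) auto
      then show "Suc (j + l - n) mod r = 0" by simp
    qed
    ultimately show ?thesis by (simp add: d_def)
  qed
  finally show ?thesis .
qed

lemma xr_Q: assumes "n - e \<le> j" "j < n" shows "Q r (rotate j (xr r))"
  unfolding inQ_def using xr_bits rotate_xr_Q[OF assms] assms residue_bounds r(2)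
  by (auto intro!: exI[of _ "n - 1 - j"])

text \<open>The last two ones of \<open>xr r\<close>, at distance \<open>e\<close>, stay inside the
  earlier rotations, so such a rotation is a window for \<open>r'\<close> only if \<open>r'\<close>
  divides \<open>e\<close>. Then \<open>r' < r\<close>, and the conditions on two parts give
  \<open>e = n - r\<close> and \<open>r' < e\<close>. Period \<open>r'\<close> would now demand a
  one among the zeros between the two.\<close>

lemma xr_S: assumes "j < n - e" shows "rotate j (xr r) \<in> S"
proof -
  have "\<not> rem (rotate (n - e) (xr r))" using kept_Q[OF r(1)] xr_Q[of "n - e"] residue_bounds by simp
  then have "\<not> rem (xr r)" using rem_rotate[OF xr_bits] by simp
  then have 1: "\<not> rem (rotate j (xr r))" using rem_rotate[OF xr_bits] by simp
  have one: "rotate j (xr r) ! (n - e - 1 - j) = 1" "rotate j (xr r) ! (n - 1 - j) = 1"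
  proof -
    have "(n - e - 1) mod r = r - 1"
    proof -
      have "Suc (n - e - 1) = n - e" using residue_bounds by linarith
      then have "Suc (n - e - 1) mod r = 0" using residue_bounds(5) by simp
      then show ?thesis by (auto simp: mod_Suc split: if_splits)
    qed
    then show "rotate j (xr r) ! (n - e - 1 - j) = 1" using assms by (simp add: nth_rotate xr_nth)
    show "rotate j (xr r) ! (n - 1 - j) = 1" using assms by (simp add: nth_rotate xr_nth)
  qed
  have "\<not> Q r' (rotate j (xr r))" if r': "r' \<in> J" for r'
  proof
    assume q: "Q r' (rotate j (xr r))"
    have r'1: "r' \<noteq> 1" using q one(2) n by (auto simp: inQ_def)
    obtain a where a: "a < r'" "\<And>i. i < n \<Longrightarrow> rotate j (xr r) ! i = of_bool (i mod r' = a)"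
      using Q_residue[OF q r'1] by auto
    have am: "(n - e - 1 - j) mod r' = a" "(n - 1 - j) mod r' = a"
      using a(2)[of "n - e - 1 - j"] a(2)[of "n - 1 - j"] one assms by (auto split: if_splits)
    moreover have "n - 1 - j = (n - e - 1 - j) + e" using assms residue_bounds by simp
    ultimately have "((n - e - 1 - j) + e) mod r' = (n - e - 1 - j) mod r'" by simp
    then have "r' dvd e" by (simp add: mod_eq_dvd_iff_nat)
    then have r'e: "r' \<le> e" using residue_bounds by (simp add: dvd_imp_le)
    then have "r' < r" using residue_bounds by simp
    then have "r + r' < n" "n \<le> 2 * r" using J2[OF r(1) r'] by auto
    moreover have "n \<noteq> 2 * r" using nd by auto
    ultimately have "e = n - r" using residue_bounds unfolding e_def by (simp add: le_mod_geq)
    then have "r' < e" using \<open>r + r' < n\<close> by simp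
    have "(n - e - 1 - j + r') mod r' = a" unfolding mod_add_self2 by (rule am(1))
    moreover have "n - e - 1 - j + r' < n" using assms r'e residue_bounds by linarith
    ultimately have "rotate j (xr r) ! (n - e - 1 - j + r') = 1"
      using a(2)[of "n - e - 1 - j + r'"] by simp
    moreover have "rotate j (xr r) ! (n - e - 1 - j + r') = xr r ! (n - e - 1 + r')"
      using assms r'e residue_bounds by (simp add: nth_rotate)
    moreover have "(n - e - 1 + r') mod r = r' - 1"
    proof -
      have "n - e - 1 + r' = (n - e) + (r' - 1)" using residue_bounds a(1) by simp
      then have "(n - e - 1 + r') mod r = (r' - 1) mod r" using residue_bounds(5) by (metis add_0 mod_add_left_eq)
      then show ?thesis using \<open>r' < r\<close> by simp
    qed
    ultimately show False using \<open>r' < e\<close> \<open>r' < r\<close> a(1) residue_bounds by (auto simp: xr_nth split: if_splits)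
  qed
  then show ?thesis using 1 xr_bits by (simp add: S_def)
qed

text \<open>The letters that wrap around come from the initial run of \<open>r\<close> zeros of
  \<open>yr r\<close>, so they add no ones.\<close>

lemma rotate_yr:
  assumes j: "1 \<le> j" "j \<le> Suc (r - e)" and l: "l < n"
  shows "rotate j (yr r) ! l = of_bool (l + j < n \<and> (l + j) mod r = 0)"
proof (cases "l + j < n")
  case True
  then show ?thesis using j l r(2) yr_bits bitsD(1)[OF yr_bits] by (auto simp: nth_rotate yr_nth add.commute)
next
  case False
  have jn: "j < n" using j residue_bounds by simp
  then have "(j + l) mod n = l + j - n" using False l by (simp add: le_mod_geq add.commute)
  moreover have "l + j - n < r" using l j residue_bounds by simp
  ultimately show ?thesis using False l bitsD(1)[OF yr_bits] r(2) jn by (auto simp: nth_rotate yr_nth)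
qed

text \<open>The only possible defect is a one missing behind the seam, at a multiple of
  \<open>r\<close> not below \<open>n\<close>. The least such multiple is
  \<open>n + (r - e)\<close>, which is out of reach for \<open>j \<le> r - e\<close>.\<close>

lemma yr_Q: assumes "1 \<le> j" "j \<le> r - e" shows "Q r (rotate j (yr r))"
proof -
  have "rotate j (yr r) ! l = of_bool (l mod r = r - j)" if l: "l < n" for l
  proof -
    have a: "(l + j) mod r = 0 \<longleftrightarrow> l mod r = r - j"
    proof
      assume "(l + j) mod r = 0"
      then have "(l mod r + j) mod r = 0" by (simp add: mod_add_left_eq)
      then have "r dvd l mod r + j" by auto
      then obtain k where k: "l mod r + j = r * k" by blast
      have "l mod r < r" using r(2) by simp
      then have "r * k < r * 2" "0 < r * k" using k assms residue_bounds by linarith+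
      then have "k = 1" by (simp add: less_2_cases_iff)
      then show "l mod r = r - j" using k by simp
    next
      assume "l mod r = r - j"
      then have "(l mod r + j) mod r = 0" using assms residue_bounds by simp
      then show "(l + j) mod r = 0" by (simp add: mod_add_left_eq)
    qed
    have "l + j < n" if "(l + j) mod r = 0"
    proof (rule ccontr)
      assume ge: "\<not> l + j < n"
      define d where "d = l + j - n"
      have d: "d < r - e" using l assms(2) ge by (auto simp: d_def)
      have "l + j = (n - e) + (e + d)" using ge residue_bounds by (simp add: d_def)
      then have "(l + j) mod r = (e + d) mod r" using residue_bounds(5) by (metis add_0 mod_add_left_eq)
      also have "\<dots> = e + d" using d by simp
      finally show False using that residue_bounds by simp
    qed
    then show ?thesis using rotate_yr[of j l] assms l a by auto
  qed
  then show ?thesis unfolding inQ_def using yr_bits assms residue_bounds r(2)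
    by (auto intro!: exI[of _ "r - j"])
qed

text \<open>The second place where the two classes touch: the rotation of \<open>yr r\<close> just
  behind its windows and the first window in the class of \<open>xr r\<close> differ only in the
  last letter.\<close>

lemma rotate_yr_last: "rotate (Suc (r - e)) (yr r) = butlast (rotate (n - e) (xr r)) @ [0]"
proof (rule nth_equalityI)
  have len: "length (yr r) = n" using bitsD(1)[OF yr_bits] .
  show "length (rotate (Suc (r - e)) (yr r)) = length (butlast (rotate (n - e) (xr r)) @ [0])"
    using len n by simp
  fix l assume "l < length (rotate (Suc (r - e)) (yr r))"
  then have l: "l < n" using len by simp
  have nth: "rotate (Suc (r - e)) (yr r) ! l = of_bool (l + Suc (r - e) < n \<and> (l + Suc (r - e)) mod r = 0)"
    using rotate_yr[of "Suc (r - e)" l] l by simp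
  show "rotate (Suc (r - e)) (yr r) ! l = (butlast (rotate (n - e) (xr r)) @ [0]) ! l"
  proof (cases "l = n - 1")
    case True
    then show ?thesis using nth n residue_bounds by (simp add: nth_append)
  next
    case False
    then have ln: "l < n - 1" using l by simp
    have "(butlast (rotate (n - e) (xr r)) @ [0]) ! l = rotate (n - e) (xr r) ! l"
      using ln by (simp add: nth_append nth_butlast)
    also have "\<dots> = of_bool (l mod r = e - 1)"
      using rotate_xr_Q[of "n - e" l] l residue_bounds by (simp add: diff_right_commute)
    finally have R: "(butlast (rotate (n - e) (xr r)) @ [0]) ! l = of_bool (l mod r = e - 1)" .
    have a: "(l + Suc (r - e)) mod r = 0 \<longleftrightarrow> l mod r = e - 1"
    proof
      assume "(l + Suc (r - e)) mod r = 0"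
      then have "(l mod r + Suc (r - e)) mod r = 0" by (metis mod_add_left_eq)
      then have "r dvd l mod r + Suc (r - e)" by blast
      then obtain k where k: "l mod r + Suc (r - e) = r * k" by blast
      have "l mod r < r" using r(2) by simp
      then have "r * k < r * 2" "0 < r * k" using k residue_bounds by linarith+
      then have "k = 1" by (simp add: less_2_cases_iff)
      then show "l mod r = e - 1" using k residue_bounds by simp
    next
      assume "l mod r = e - 1"
      then have "(l mod r + Suc (r - e)) mod r = 0" using residue_bounds by simp
      then show "(l + Suc (r - e)) mod r = 0" by (metis mod_add_left_eq)
    qed
    have "l + Suc (r - e) < n" if *: "(l + Suc (r - e)) mod r = 0"
    proof (rule ccontr)
      assume ge: "\<not> l + Suc (r - e) < n"
      define d where "d = l + Suc (r - e) - n"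
      have d: "d < r - e" using ln ge by (auto simp: d_def)
      have "l + Suc (r - e) = (n - e) + (e + d)" using ge residue_bounds by (simp add: d_def)
      then have "(l + Suc (r - e)) mod r = (e + d) mod r" using residue_bounds(5) by (metis add_0 mod_add_left_eq)
      also have "\<dots> = e + d" using d by simp
      finally show False using * residue_bounds by simp
    qed
    then show ?thesis using nth R a by auto
  qed
qed

text \<open>If \<open>yr r\<close> were a window for \<open>r'\<close>, then \<open>neck_Q\<close>
  would identify \<open>r'\<close> with \<open>r\<close>. But \<open>yr r\<close> starts with a zero
  and has a one at place \<open>r\<close>.\<close>

lemma yr_S: "yr r \<in> S"
proof -
  have "\<not> rem (rotate 1 (yr r))" using kept_Q[OF r(1)] yr_Q[of 1] residue_bounds by simp
  then have 1: "\<not> rem (yr r)" using rem_rotate[OF yr_bits] by metis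
  have "\<not> Q r' (yr r)" if r': "r' \<in> J" for r'
  proof
    assume q: "Q r' (yr r)"
    have yr_one: "yr r ! r = 1" using yr_nth[of r r] residue_bounds r(2) by simp
    have r'1: "2 \<le> r'" using J[OF r'] q yr_one residue_bounds by (cases "r' = 1") (auto simp: inQ_def)
    have "0 < r'" using r'1 by simp
    then obtain b where "Q r' (butlast (xr r) @ [b])" using Q_succ q unfolding yr_def by blast
    then have "xr r = xr r'" using neck_Q[OF r' r'1, of "butlast (xr r)"] neck_xr xr_snoc by metis
    then have "r' = r" using xr_inject r r' r'1 by metis
    then have "yr r ! (0 + r) = yr r ! 0" using Q_periodic[OF q, of 0] residue_bounds by simp
    then show False using yr_one by (simp add: yr_def)
  qed
  then show ?thesis using 1 yr_bits by (simp add: S_def)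
qed

lemma step_yr: "step (yr r) = xr r"
proof -
  have x: "butlast (xr r) @ [1] = xr r" using xr_snoc by metis
  have "xr r \<in> S" using xr_S[of 0] residue_bounds by simp
  then have "\<not> bef (xr r) N" "\<forall>r'\<in>J. \<not> Q r' (xr r)"
    using nk_neck[OF xr_bits neck_xr] by (auto simp: S_def)
  then show ?thesis using neck_xr x by (simp add: stp_def Let_def yr_def nextb_def)
qed

text \<open>Rotation would enter the first window. The flip skips the remaining \<open>e\<close>
  rotations of \<open>xr r\<close> together with the \<open>r - e\<close> windows of the parent
  class.\<close>

lemma step_xr_last: "step (rotate (n - e - 1) (xr r)) = rotate (Suc (r - e)) (yr r)"
proof -
  define v where "v = rotate (n - e - 1) (xr r)"
  have len: "length v = n" by (simp add: v_def)
  then obtain c z where cz: "v = c # z" using n by (cases v) auto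
  have "hd v = 1"
  proof -
    have "v ! 0 = xr r ! (n - e - 1)" using residue_bounds by (simp add: v_def nth_rotate)
    moreover have "(n - e - 1) mod r = r - 1"
    proof -
      have "Suc (n - e - 1) = n - e" using residue_bounds by linarith
      then have "Suc (n - e - 1) mod r = 0" using residue_bounds(5) by simp
      then show ?thesis by (auto simp: mod_Suc split: if_splits)
    qed
    ultimately show ?thesis using cz residue_bounds by (simp add: xr_nth)
  qed
  then have c: "c = 1" using cz by simp
  have rot: "rotate (n - e) (xr r) = z @ [1]"
  proof -
    have "rotate (n - e) (xr r) = rotate1 v" unfolding v_def using residue_bounds
      by (metis Suc_diff_1 Suc_diff_Suc diff_0_eq_0 diff_Suc_1 less_le_trans n not_less_zero rotate_Suc zero_less_diff le_0_eq neq0_conv)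
    then show ?thesis using cz c by simp
  qed
  have q: "Q r (z @ [1])" using xr_Q[of "n - e"] rot residue_bounds by simp
  \<comment> \<open>No join is located at this \<open>z\<close>: the string \<open>z1\<close> is a
    rotation of \<open>xr r\<close> other than the necklace itself.\<close>
  have "\<not> neck (z @ [1])"
  proof
    assume nk: "neck (z @ [1])"
    then have eq: "z @ [1] = xr r" using neck_unique[OF xr_bits neck_xr] rot by metis
    have "(z @ [1]) ! (e - 1) = 1" using rotate_xr_Q[of "n - e" "e - 1"] residue_bounds rot by simp
    moreover have "xr r ! (e - 1) = 0" using residue_bounds by (simp add: xr_nth)
    ultimately show False using eq by simp
  qed
  then have "step v = z @ [0]" using q r(1) c cz by (auto simp: stp_def Let_def nextb_def)
  then show ?thesis using rotate_yr_last rot unfolding v_def by simp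
qed

end


section \<open>All strings of \<open>S\<close> lie on a single cycle\<close>

text \<open>
  Rotating by one letter stays on the truncated cycle, except where the cycle leaves a class towards
  its parent. A detour through a child class is handled by descending induction on the weight.
\<close>

definition star :: "nat list \<Rightarrow> bool" where
  "star v \<longleftrightarrow> (v \<in> S \<and> rotate1 v \<in> S \<and> \<not> (hd v = 1 \<and> neck (tl v @ [1])) \<longrightarrow> orb step v (rotate1 v))"

lemma S_Cons: assumes "v \<in> S" obtains c z where "v = c # z" "c = 0 \<or> c = 1" "z \<in> bits (n - 1)" "length z = n - 1"
  using S_bits[OF assms] n by (cases v) (auto simp: Cons_bits bits_def)

text \<open>The exit that \<open>star\<close> excludes rotates to a necklace, and within the class
  of \<open>y\<close> this can only be \<open>y\<close> itself.\<close>

lemma star_rotate: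
  assumes v: "star v" "v \<in> S" "rotate1 v \<in> S" and y: "y \<in> bits n" "neck y" "rotate1 v = rotate k y"
  shows "rotate1 v = y \<or> orb step v (rotate1 v)"
proof (cases "hd v = 1 \<and> neck (tl v @ [1])")
  case True
  obtain c z where "v = c # z" using S_Cons[OF v(2)] by metis
  then have "neck (rotate1 v)" using True by simp
  then show ?thesis using neck_unique[OF y(1,2)] y(3) by metis
next
  case False
  then show ?thesis using v by (simp add: star_def)
qed

lemma wt_xr: "wt (xr r) = Suc (wt (yr r))"
proof -
  have "wt (xr r) = wt (butlast (xr r) @ [1])" using xr_snoc by metis
  then show ?thesis by (simp add: yr_def)
qed

lemma chain_xr:
  assumes r: "r \<in> J" "2 \<le> r" "\<not> r dvd n" and star: "\<And>v. wt v = wt (xr r) \<Longrightarrow> star v"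
    and j: "j < n - n mod r"
  shows "orb step (xr r) (rotate j (xr r))"
  using j
proof (induction j)
  case (Suc j)
  define v where "v = rotate j (xr r)"
  have vS: "v \<in> S" "rotate1 v \<in> S"
    using xr_S[OF r refl, of j] xr_S[OF r refl, of "Suc j"] Suc.prems by (auto simp: v_def)
  have "rotate1 v = xr r \<or> orb step v (rotate1 v)"
    by (rule star_rotate[OF _ vS xr_bits neck_xr[OF r refl], of "Suc j"]) (auto simp: v_def star)
  then show ?case using Suc by (auto simp: v_def intro: orb_trans)
qed simp

text \<open>How the cut segment of the lighter class is bypassed: up to \<open>xr r\<close>, along
  its class to the last string before the windows, and back through the second exchange.\<close>

lemma chain_yr:
  assumes r: "r \<in> J" "2 \<le> r" "\<not> r dvd n" and star: "\<And>v. wt v = wt (xr r) \<Longrightarrow> star v"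
  shows "orb step (yr r) (rotate (Suc (r - n mod r)) (yr r))"
    and "rotate (Suc (r - n mod r)) (yr r) \<in> S"
proof -
  note re = residue_bounds[OF r refl]
  have lt: "n - n mod r - 1 < n - n mod r" using re by linarith
  have "orb step (yr r) (xr r)" using orb_step step_yr[OF r refl] by metis
  also have "orb step (xr r) (rotate (n - n mod r - 1) (xr r))"
    using chain_xr[OF r star lt] by simp
  also have "orb step (rotate (n - n mod r - 1) (xr r)) (rotate (Suc (r - n mod r)) (yr r))"
    using orb_step step_xr_last[OF r refl] by metis
  finally show "orb step (yr r) (rotate (Suc (r - n mod r)) (yr r))" .
  show "rotate (Suc (r - n mod r)) (yr r) \<in> S"
    using step_S[OF xr_S[OF r refl lt]] step_xr_last[OF r refl] by simp
qed

text \<open>Where a plain rotation would enter the windows. The window before \<open>z c\<close> is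
  \<open>(1 - c) # z\<close>; its period relates the letter at place \<open>r\<close> to its first
  letter, which fixes the residue of the ones. For \<open>c = 0\<close> this leads to
  \<open>yr r\<close>, for \<open>c = 1\<close> to the rotation of \<open>xr r\<close> by
  \<open>n - e\<close>. If \<open>r\<close> divides \<open>n\<close> or \<open>r = 1\<close>, no
  entry exists.\<close>

lemma enter_Q:
  assumes v: "v \<in> S" and r: "r \<in> J" and q: "Q r (rotate1 v)"
  shows "2 \<le> r \<and> \<not> r dvd n \<and> (v = yr r \<or> nk v = xr r)"
proof -
  obtain c z where cz: "v = c # z" "c = 0 \<or> c = 1" "z \<in> bits (n - 1)" "length z = n - 1"
    using S_Cons[OF v] by metis
  have rn: "1 \<le> r" "r < n" using J[OF r] by auto
  have rn1: "r - 1 < n - 1" using rn by linarith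
  have qz: "Q r (z @ [c])" using q cz by simp
  have qc: "Q r ((1 - c) # z)" using not_flagged_both(2)[of c z r c] v cz r qz by simp
  have r2: "2 \<le> r"
  proof (rule ccontr)
    assume "\<not> 2 \<le> r"
    then have r1: "r = 1" using rn by simp
    have "(z @ [c]) ! i = 0" if "i < n" for i using qz r1 that by (auto simp: inQ_def)
    then have "c = 0" "\<And>i. i < n - 1 \<Longrightarrow> z ! i = 0" using cz(4) n by (metis diff_less less_one less_le_trans nth_append_length)
      (metis cz(4) less_imp_diff_less nth_append not_less_eq Suc_diff_1 less_le_trans less_Suc_eq n zero_less_one \<open>\<And>i. i < n \<Longrightarrow> (z @ [c]) ! i = 0\<close>)
    then have "v ! i = 0" if "i < n" for i using that cz by (cases i) auto
    then have "Q r v" using r1 S_bits[OF v] by (simp add: inQ_def)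
    then show False using v r by (simp add: S_def)
  qed
  obtain a where a: "a < r" "\<And>i. i < n \<Longrightarrow> (z @ [c]) ! i = of_bool (i mod r = a)"
    using Q_residue[OF qz] r2 by auto
  have per: "((1 - c) # z) ! r = 1 - c" using Q_periodic[OF qc, of 0] rn by simp
  show ?thesis
  proof (cases "c = 0")
    case True
    have "z ! (r - 1) = 1" using per r2 True by (simp add: nth_Cons')
    then have "(r - 1) mod r = a" using a(2)[of "r - 1"] rn rn1 cz(4) by (simp add: nth_append)
    then have ar: "a = r - 1" using r2 by simp
    have "(n - 1) mod r \<noteq> r - 1" using a(2)[of "n - 1"] cz(4) n True ar by (auto simp: nth_append)
    then have "Suc (n - 1) mod r \<noteq> 0" by (auto simp: mod_Suc)
    then have nd: "\<not> r dvd n" using n by (auto simp: dvd_eq_mod_eq_0)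
    have "v = yr r"
    proof (rule nth_equalityI)
      show "length v = length (yr r)" using bitsD(1)[OF yr_bits] cz n by simp
      fix i assume "i < length v"
      then have i: "i < n" using cz n by simp
      show "v ! i = yr r ! i"
      proof (cases i)
        case 0 then show ?thesis using cz True by (simp add: yr_def)
      next
        case (Suc k)
        then have "v ! i = (z @ [c]) ! k" using cz i by (simp add: nth_append less_diff_conv)
        also have "\<dots> = of_bool (k mod r = r - 1)" using a(2)[of k] ar Suc i by simp
        finally show ?thesis using yr_nth[OF i r2] Suc r2 by (auto simp: mod_Suc)
      qed
    qed
    then show ?thesis using r2 nd by simp
  next
    case False
    then have c1: "c = 1" using cz by simp
    have a': "a = (n - 1) mod r" using a(2)[of "n - 1"] cz(4) n c1 by (auto simp: nth_append split: if_splits)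
    have "z ! (r - 1) = 0" using per r2 c1 by (simp add: nth_Cons')
    then have "(r - 1) mod r \<noteq> a" using a(2)[of "r - 1"] rn rn1 cz(4) by (simp add: nth_append)
    then have "(n - 1) mod r \<noteq> r - 1" using a' r2 by auto
    then have nm: "Suc (n - 1) mod r = Suc ((n - 1) mod r)" by (auto simp: mod_Suc)
    then have nd: "\<not> r dvd n" using n by (auto simp: dvd_eq_mod_eq_0)
    have ae: "a = n mod r - 1" using nm a' n by simp
    note re = residue_bounds[OF r r2 nd refl]
    have "z @ [c] = rotate (n - n mod r) (xr r)"
    proof (rule nth_equalityI)
      show "length (z @ [c]) = length (rotate (n - n mod r) (xr r))" using cz n by simp
      fix i assume "i < length (z @ [c])"
      then have i: "i < n" using cz n by simp
      have "n - 1 - (n - n mod r) = n mod r - 1" using re by linarith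
      then show "(z @ [c]) ! i = rotate (n - n mod r) (xr r) ! i"
        using rotate_xr_Q[OF r r2 nd refl _ _ i, of "n - n mod r"] a(2)[OF i] ae re by simp
    qed
    then have "nk (rotate1 v) = nk (xr r)" using cz nk_rotate[OF xr_bits] by simp
    moreover have "nk (rotate1 v) = nk v" using nk_rotate[OF S_bits[OF v], of 1] by simp
    ultimately show ?thesis using nk_neck[OF xr_bits neck_xr[OF r r2 nd refl]] r2 nd by simp
  qed
qed

text \<open>Along the class, the current rotation either has been reached (\<open>?A\<close>) or
  belongs to a segment of windows of which only the preceding \<open>yr r\<close> has been reached
  (\<open>?B\<close>). Behind the segment \<open>chain_yr\<close> takes over. Its detour runs
  through a class that is heavier by one, hence the assumption on \<open>star\<close> for two
  weights.\<close>

lemma class_chain: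
  assumes y: "y \<in> S" "neck y" and nx: "\<And>r. r \<in> J \<Longrightarrow> 2 \<le> r \<Longrightarrow> y \<noteq> xr r"
    and star: "\<And>v. wt v = wt y \<or> wt v = Suc (wt y) \<Longrightarrow> star v" and k: "rotate k y \<in> S"
  shows "orb step y (rotate k y)"
proof -
  note yb = S_bits[OF y(1)]
  have "(rotate k y \<in> S \<and> orb step y (rotate k y)) \<or>
     (\<exists>r j. r \<in> J \<and> 2 \<le> r \<and> \<not> r dvd n \<and> 1 \<le> j \<and> j \<le> r - n mod r \<and> rotate k y = rotate j (yr r)
        \<and> orb step y (yr r) \<and> wt (yr r) = wt y)" (is "?A k \<or> ?B k")
  proof (induction k)
    case 0 then show ?case using y by simp
  next
    case (Suc k)
    define v where "v = rotate k y"
    have v': "rotate (Suc k) y = rotate1 v" by (simp add: v_def)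
    show ?case
    proof (cases "?A k")
      case A: True
      then have vS: "v \<in> S" "orb step y v" by (auto simp: v_def)
      show ?thesis
      proof (cases "rotate1 v \<in> S")
        case True
        have "rotate1 v = y \<or> orb step v (rotate1 v)"
          by (rule star_rotate[OF _ vS(1) True yb y(2) v'[symmetric]]) (auto simp: v_def star)
        then have "orb step y (rotate1 v)" using vS(2) orb_trans orb_refl by metis
        then show ?thesis using True v' by simp
      next
        case False
        have "rotate1 v \<in> bits n" "\<not> rem (rotate1 v)"
          using S_bits[OF vS(1)] vS(1) rem_rotate1[OF S_bits[OF vS(1)]] rotate_bits[of 1 v n] by (auto simp: S_def)
        then obtain r where r: "r \<in> J" "Q r (rotate1 v)" using False by (auto simp: S_def)
        have *: "2 \<le> r" "\<not> r dvd n" "v = yr r \<or> nk v = xr r" using enter_Q[OF vS(1) r] by auto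
        have "nk v = y" using nk_rotate[OF yb] nk_neck[OF yb y(2)] by (simp add: v_def)
        then have "v = yr r" using * nx[OF r(1)] by auto
        moreover have "wt v = wt y" by (simp add: v_def)
        moreover have "1 \<le> r - n mod r" using residue_bounds(2)[OF r(1) *(1,2) refl] by linarith
        ultimately have "r \<in> J \<and> 2 \<le> r \<and> \<not> r dvd n \<and> 1 \<le> (1::nat) \<and> 1 \<le> r - n mod r \<and>
            rotate (Suc k) y = rotate 1 (yr r) \<and> orb step y (yr r) \<and> wt (yr r) = wt y"
          using r(1) * vS(2) v' by simp
        then show ?thesis by blast
      qed
    next
      case False
      then have "?B k" using Suc.IH by blast
      then obtain r j where r: "r \<in> J" "2 \<le> r" "\<not> r dvd n" and j: "1 \<le> j" "j \<le> r - n mod r"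
        and eq: "rotate k y = rotate j (yr r)" and o: "orb step y (yr r)" and wt: "wt (yr r) = wt y"
        by blast
      have eq': "rotate (Suc k) y = rotate (Suc j) (yr r)" using eq by simp
      show ?thesis
      proof (cases "Suc j \<le> r - n mod r")
        case True
        then have "?B (Suc k)" using r o wt eq' by (metis le_add1 plus_1_eq_Suc)
        then show ?thesis ..
      next
        case False
        then have "j = r - n mod r" using j by simp
        have st: "star v" if "wt v = wt (xr r)" for v using star that wt_xr[of r] wt by simp
        have "orb step y (rotate (Suc k) y)" "rotate (Suc k) y \<in> S"
          using chain_yr[OF r st] o unfolding eq' \<open>j = r - n mod r\<close> by (auto intro: orb_trans)
        then show ?thesis by blast
      qed
    qed
  qed
  moreover have "\<not> ?B k"
  proof
    assume "?B k"
    then obtain r j where r: "r \<in> J" "2 \<le> r" "\<not> r dvd n" and j: "1 \<le> j" "j \<le> r - n mod r"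
      and eq: "rotate k y = rotate j (yr r)" by blast
    then have "Q r (rotate k y)" using yr_Q[OF r refl j] by simp
    then show False using k r(1) by (simp add: S_def)
  qed
  ultimately show ?thesis by blast
qed

text \<open>\<open>1z\<close> is the last rotation before the necklace comes round again, so it is
  where the class is left towards \<open>z0\<close>. It could be a window only if the necklace were
  some \<open>xr r\<close>.\<close>

lemma exit_S:
  assumes y: "z @ [1] \<in> S" "neck (z @ [1])" and nx: "\<And>r. r \<in> J \<Longrightarrow> 2 \<le> r \<Longrightarrow> z @ [1] \<noteq> xr r"
    and star: "\<And>v. wt v = wt (z @ [1]) \<or> wt v = Suc (wt (z @ [1])) \<Longrightarrow> star v"
  shows "1 # z \<in> S" "orb step (z @ [1]) (1 # z)"
proof -
  note yb = S_bits[OF y(1)]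
  have len: "length (z @ [1]) = n" using bitsD(1)[OF yb] .
  have rot: "rotate (n - 1) (z @ [1]) = 1 # z"
  proof -
    have "rotate (length z) (z @ [1]) = 1 # z" by (simp only: rotate_append) simp
    moreover have "length z = n - 1" using len by simp
    ultimately show ?thesis by simp
  qed
  have "\<not> Q r (1 # z)" if r: "r \<in> J" for r
  proof
    assume q: "Q r (1 # z)"
    have "r \<noteq> 1"
    proof
      assume "r = 1"
      then have "(1 # z) ! 0 = 0" using q n unfolding inQ_def by (metis less_le_trans less_one)
      then show False by simp
    qed
    then have r2: "2 \<le> r" using J[OF r] by simp
    then have "0 < r" by simp
    then obtain b where "Q r (z @ [b])" using Q_succ[OF q] by blast
    then show False using neck_Q[OF r r2 y(2)] nx[OF r r2] by simp
  qed
  moreover have "\<not> rem (1 # z)" using y(1) rem_rotate[OF yb, of "n - 1"] rot by (simp add: S_def)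
  moreover have "1 # z \<in> bits n" using yb by (simp add: snoc_bits Cons_bits)
  ultimately show *: "1 # z \<in> S" by (simp add: S_def)
  show "orb step (z @ [1]) (1 # z)" using class_chain[OF y nx star, of "n - 1"] * rot by simp
qed

lemma xr_Q_dvd: assumes "r \<in> J" "2 \<le> r" "r dvd n" shows "Q r (xr r)"
proof -
  have "Suc (n - 1) mod r = 0" using assms n by simp
  then have "(n - 1) mod r = r - 1" by (auto simp: mod_Suc split: if_splits)
  then show ?thesis using assms xr_bits by (auto simp: inQ_def xr_nth intro!: exI[of _ "r - 1"])
qed

lemma step_exit:
  assumes "neck (z @ [1])" "\<not> bef (z @ [1]) N" "\<And>r. r \<in> J \<Longrightarrow> \<not> Q r (z @ [0])"
  shows "step (1 # z) = z @ [0]"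
  using assms by (simp add: stp_def Let_def nextb_def)

lemma star_all: "star v"
proof (induction "n - wt v" arbitrary: v rule: less_induct)
  case less
  show ?case unfolding star_def
  proof
    assume A: "v \<in> S \<and> rotate1 v \<in> S \<and> \<not> (hd v = 1 \<and> neck (tl v @ [1]))"
    obtain c z where cz: "v = c # z" "c = 0 \<or> c = 1" "z \<in> bits (n - 1)" "length z = n - 1"
      using S_Cons A by metis
    have r1: "rotate1 v = z @ [c]" using cz by simp
    have nQ: "\<And>r. r \<in> J \<Longrightarrow> \<not> Q r (z @ [c])" using A r1 by (simp add: S_def)
    show "orb step v (rotate1 v)"
    proof (cases "step v = rotate1 v")
      case True then show ?thesis using orb_step by metis
    next
      case False
      have nb: "nextb N z c \<noteq> c"
      proof
        assume "nextb N z c = c"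
        then have "step v = z @ [c]" using nQ cz by (simp add: stp_def Let_def)
        then show False using False r1 by simp
      qed
      then have nz: "neck (z @ [1])" "\<not> bef (z @ [1]) N" by (auto simp: nextb_def split: if_splits)
      then have c0: "c = 0" using A cz by auto
      then have nb1: "nextb N z c = 1" using nz by (simp add: nextb_def)
      have nQ1: "\<not> Q r (z @ [1])" if "r \<in> J" for r
      proof
        assume "Q r (z @ [1])"
        then have "step v = z @ [0]" using nb1 cz that by (auto simp: stp_def Let_def)
        then show False using False r1 c0 by simp
      qed
      have z1b: "z @ [1] \<in> bits n" using cz(3) n by (simp add: snoc_bits)
      have z1S: "z @ [1] \<in> S" using nQ1 nz nk_neck[OF z1b nz(1)] z1b by (simp add: S_def)
      \<comment> \<open>Otherwise \<open>z1\<close> is a window, if \<open>r\<close> divides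
        \<open>n\<close>, or \<open>z0\<close> is the first window among the rotations of
        \<open>yr r\<close>. Both have been excluded.\<close>
      have nx: "z @ [1] \<noteq> xr r" if r: "r \<in> J" "2 \<le> r" for r
      proof
        assume eq: "z @ [1] = xr r"
        have nd: "\<not> r dvd n" using xr_Q_dvd[OF r] nQ1[OF r(1)] eq by auto
        have "butlast (xr r) = z" using eq by (metis butlast_snoc)
        then have "rotate 1 (yr r) = z @ [0]" by (simp add: yr_def)
        then have "Q r (z @ [0])" using yr_Q[OF r nd refl, of 1] residue_bounds(2)[OF r nd refl] by simp
        then show False using nQ r c0 by simp
      qed
      have st: "star w" if w: "wt w = wt (z @ [1]) \<or> wt w = Suc (wt (z @ [1]))" for w
      proof (cases "w \<in> bits n")
        case True
        have "wt w > wt v" using w cz c0 by auto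
        \<comment> \<open>This makes the truncated difference \<open>n - wt w\<close> strictly
          smaller.\<close>
        moreover have "wt w \<le> n" using wt_le[OF True] .
        ultimately show ?thesis using less by simp
      next
        case False then show ?thesis using S_bits by (auto simp: star_def)
      qed
      have "step v = z @ [1]" using nb1 nQ1 cz by (auto simp: stp_def Let_def)
      then have "orb step v (z @ [1])" using orb_step by metis
      also have "orb step (z @ [1]) (1 # z)" using exit_S[OF z1S nz(1) nx st] by blast
      also have "orb step (1 # z) (rotate1 v)"
        using step_exit[OF nz] nQ c0 r1 orb_step by metis
      finally show ?thesis .
    qed
  qed
qed

text \<open>The zero string is unsuitable, as it is cut out for \<open>r = 1\<close>. This string
  always lies in \<open>S\<close>, and a program recognises it by its weight and its last
  letter.\<close>

definition start :: "nat list" where "start = replicate (n - 1) 0 @ [1]"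

lemma neck_last: assumes "y \<in> bits n" "neck y" "0 < wt y" obtains z where "y = z @ [1]" "z \<in> bits (n - 1)"
proof -
  have "y \<noteq> []" using assms by auto
  then obtain z b where zb: "y = z @ [b]" by (metis append_butlast_last_id)
  then have z: "b = 0 \<or> b = 1" "z \<in> bits (n - 1)" using assms(1) by (auto simp: snoc_bits)
  have "b \<noteq> 0"
  proof
    assume b: "b = 0"
    have "rotate (length z) y = 0 # z" unfolding zb b by (simp only: rotate_append) simp
    then have "val y \<le> val (0 # z)" using assms(2) unfolding neck_def by metis
    then have "val z = 0" unfolding zb b val_append by simp
    then have "z = replicate (n - 1) 0"
      using val_inj[OF z(2) replicate_bits] by simp
    then show False using assms(3) zb b by simp
  qed
  then show ?thesis using that z zb by auto
qed

lemma start_snoc: "replicate (n - Suc 0) 0 @ [Suc 0] = start" by (simp add: start_def)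

lemma start_bits: "start \<in> bits n" using n by (auto simp: start_def bits_def)

lemma val_start: "val start = 1" by (simp add: start_def val_append)

lemma neck_start: "neck start"
  unfolding neck_def
proof
  fix k
  have "val (rotate k start) \<noteq> 0"
  proof
    assume "val (rotate k start) = 0"
    then have "rotate k start = replicate n 0"
      using val_inj[of "rotate k start" n "replicate n 0"] start_bits replicate_bits by simp
    then have "wt (rotate k start) = 0" by simp
    then show False by (simp add: start_def)
  qed
  then show "val start \<le> val (rotate k start)" using val_start by simp
qed

lemma start_S: "start \<in> S"
proof -
  have "\<not> bef start N"
  proof
    assume b: "bef start N"
    have wt1: "wt start = 1" by (simp add: start_def)
    obtain u where u: "u \<in> bits n" "\<not> rem u" "n \<le> 2 * wt u" by (rule kept_heavy)
    have wtu: "wt u = 1" "wt N = 1" "val N \<le> val (nk u)" using b u wt1 n by (auto simp: bef_def)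
    obtain z where z: "nk u = z @ [1]" "z \<in> bits (n - 1)"
      using neck_last[of "nk u"] u(1) neck_nk wtu(1) by auto
    have "wt (z @ [1]) = 1" using wtu(1) z(1) by (metis wt_nk)
    then have "z = replicate (n - 1) 0" using wt_zero[OF z(2)] by simp
    then have "nk u = start" using z by (simp add: start_def)
    then show False using b wtu wt1 by (auto simp: bef_def)
  qed
  then have "\<not> rem start" using nk_neck[OF start_bits neck_start] by simp
  moreover have "\<not> Q r start" if r: "r \<in> J" for r
  proof
    assume q: "Q r start"
    have rn: "1 \<le> r" "r < n" using J[OF r] by auto
    have "start ! (n - 1 - r + r) = start ! (n - 1 - r)" using Q_periodic[OF q, of "n - 1 - r"] rn by simp
    moreover have "n - 1 - r + r = n - 1" "n - 1 - r < n - 1" using rn by auto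
    ultimately show False by (simp add: start_def nth_append)
  qed
  ultimately show ?thesis using start_bits by (simp add: S_def)
qed

text \<open>If \<open>r\<close> divides \<open>n\<close>, the seam respects the period too, so the
  windows are closed under rotation.\<close>

lemma Q_rotate1: assumes "r \<in> J" "2 \<le> r" "r dvd n" "Q r w" shows "Q r (rotate1 w)"
proof -
  have rn: "r < n" using J[OF assms(1)] by simp
  obtain c z where cz: "w = c # z" "length z = n - 1"
    using Q_bits[OF assms(4)] n by (cases w) (auto simp: bits_def)
  have "0 < r" using assms(2) by simp
  then obtain b where b: "Q r (z @ [b])" using Q_succ assms(4) cz by metis
  obtain a where a: "\<And>i. i < n \<Longrightarrow> w ! i = of_bool (i mod r = a)"
    using Q_residue[OF assms(4)] assms(2) by auto
  have eq: "n - 1 - r + r = n - 1" "Suc (n - 1 - r) = n - r" "n - 1 - r < n - 1" using rn \<open>0 < r\<close> by auto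
  have "b = z ! (n - 1 - r)"
    using Q_periodic[OF b, of "n - 1 - r"] eq cz by (simp add: nth_append)
  also have "\<dots> = w ! (n - r)" using cz eq by (metis nth_Cons_Suc)
  also have "\<dots> = w ! 0" using a[of "n - r"] a[of 0] rn \<open>0 < r\<close> assms(3) by (simp add: dvd_imp_mod_0)
  finally show ?thesis using b cz by simp
qed

lemma Q_rotate: assumes "r \<in> J" "2 \<le> r" "r dvd n" "Q r w" shows "Q r (rotate k w)"
  using assms by (induction k) (auto intro: Q_rotate1)

text \<open>Induction on the weight, towards the root. From \<open>v\<close> the necklace
  \<open>z1\<close> of its class is reached by reversing \<open>class_chain\<close>, then
  \<open>1z\<close>, and from there the join leads to the lighter string \<open>z0\<close>. If the
  necklace is \<open>xr r\<close>, that exit has been cut off, and the class is left backwards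
  through \<open>yr r\<close>.\<close>

lemma reach_start: "v \<in> S \<Longrightarrow> orb step v start"
proof (induction "wt v" arbitrary: v rule: less_induct)
  case less
  note vb = S_bits[OF less.prems]
  show ?case
  proof (cases "wt v = 0")
    case True
    then have "v = 0 # replicate (n - 1) 0"
      using wt_zero[OF vb] n by (metis Suc_diff_1 less_le_trans less_one replicate_Suc)
    moreover have "\<not> bef start N" "\<And>r. r \<in> J \<Longrightarrow> \<not> Q r start"
      using start_S nk_neck[OF start_bits neck_start] by (auto simp: S_def)
    ultimately have "step v = start"
      using neck_start start_snoc by (simp add: stp_def Let_def nextb_def)
    then show ?thesis using orb_step by metis
  next
    case False
    define y where "y = nk v"
    have y: "y \<in> bits n" "neck y" "wt y = wt v" using vb neck_nk by (auto simp: y_def)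
    obtain k0 where "y = rotate k0 v" using nk_rotation by (auto simp: y_def)
    then obtain k1 where "v = rotate k1 y" using rotate_back[of v] by metis
    then obtain k where k: "v = rotate k y" "k < n"
      using bitsD(1)[OF y(1)] n by (metis less_le_trans less_one mod_less_divisor rotate_conv_mod)
    obtain z where z: "y = z @ [1]" "z \<in> bits (n - 1)"
      using neck_last[OF y(1,2)] y(3) False by auto
    have nrem: "\<not> rem y" using less.prems nk_neck[OF y(1,2)] by (simp add: S_def y_def)
    have st: "\<And>v. P v \<Longrightarrow> star v" for P by (rule star_all)
    have yS: "y \<in> S"
    proof -
      have "\<not> Q r y" if r: "r \<in> J" for r
      proof
        assume q: "Q r y"
        have "r \<noteq> 1"
        proof
          assume "r = 1"
          then have "y ! (n - 1) = 0" using q n by (simp add: inQ_def)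
          then show False using z n bitsD(1)[OF z(2)] by (simp add: nth_append)
        qed
        then have r2: "2 \<le> r" using J[OF r] by simp
        have yx: "y = xr r" using neck_Q[OF r r2, of z 1] y(2) q z by simp
        show False
        proof (cases "r dvd n")
          case True
          then show False using Q_rotate[OF r r2 True q, of k] k less.prems r by (simp add: S_def)
        next
          case nd: False
          have "0 < n - n mod r" using residue_bounds(4)[OF r r2 nd refl] r2 by simp
          then have "y \<in> S" using xr_S[OF r r2 nd refl, of 0] yx by simp
          then show False using q r by (simp add: S_def)
        qed
      qed
      then show ?thesis using y nrem by (simp add: S_def)
    qed
    show ?thesis
    proof (cases "\<exists>r\<in>J. 2 \<le> r \<and> y = xr r")
      case True
      then obtain r where r: "r \<in> J" "2 \<le> r" and yx: "y = xr r" by blast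
      have nd: "\<not> r dvd n" using xr_Q_dvd[OF r] yS r(1) yx by (auto simp: S_def)
      have "k < n - n mod r"
        using xr_Q[OF r nd refl, of k] k yx less.prems r(1) unfolding S_def
        by (metis (mono_tags, lifting) mem_Collect_eq not_less)
      then have "orb step y v" using chain_xr[OF r nd star_all] k yx by simp
      moreover have "orb step (yr r) y" using orb_step step_yr[OF r nd refl] yx by metis
      ultimately have "orb step (yr r) v" by (metis orb_trans)
      then have "orb step v (yr r)" using orb_symS[OF yr_S[OF r nd refl]] by simp
      moreover have "orb step (yr r) start"
        using less.hyps[of "yr r"] yr_S[OF r nd refl] wt_xr[of r] yx y(3) by simp
      ultimately show ?thesis by (metis orb_trans)
    next
      case nx: False
      then have nx': "\<And>r. r \<in> J \<Longrightarrow> 2 \<le> r \<Longrightarrow> z @ [1] \<noteq> xr r" using z by blast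
      have yv: "orb step v y"
        using orb_symS[OF yS] class_chain[OF yS y(2) _ star_all, of k] nx' z k less.prems by simp
      have ex: "orb step y (1 # z)"
        using exit_S(2)[of z] yS y(2) nx' star_all z by simp
      show ?thesis
      proof (cases "\<exists>r\<in>J. Q r (z @ [0])")
        case True
        then obtain r where r: "r \<in> J" "Q r (z @ [0])" by blast
        have "r = 1"
        proof (rule ccontr)
          assume "r \<noteq> 1"
          then have r2: "2 \<le> r" using J[OF r(1)] by simp
          then show False using neck_Q[OF r(1) r2 _ r(2)] nx'[OF r(1) r2] y(2) z by simp
        qed
        then have "z ! i = 0" if "i < n - 1" for i
          using r(2) that bitsD(1)[OF z(2)] by (auto simp: inQ_def nth_append dest: spec[of _ i])
        then have "z = replicate (n - 1) 0" using bitsD(1)[OF z(2)] by (intro nth_equalityI) auto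
        then show ?thesis using yv z by (simp add: start_def)
      next
        case False
        have "\<not> bef (z @ [1]) N" using nrem nk_neck[OF y(1,2)] z by simp
        then have s0: "step (1 # z) = z @ [0]" using step_exit[of z] y(2) z False by blast
        have "1 # z \<in> S" using exit_S(1)[of z] yS y(2) nx' star_all z by simp
        then have "z @ [0] \<in> S" using step_S s0 by metis
        moreover have "wt (z @ [0]) < wt v" using z y(3) by simp
        ultimately have "orb step (z @ [0]) start" using less.hyps by blast
        moreover have "orb step (1 # z) (z @ [0])" using orb_step s0 by metis
        ultimately show ?thesis using yv ex orb_trans by metis
      qed
    qed
  qed
qed

lemma card_Q: assumes r: "r \<in> J" shows "finite {w. Q r w}" "card {w. Q r w} = r"
proof -
  have rn: "1 \<le> r" "r < n" using J[OF r] by auto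
  show "finite {w. Q r w}" by (rule finite_subset[OF _ finite_bits[of n]]) (auto simp: inQ_def)
  show "card {w. Q r w} = r"
  proof (cases "r = 1")
    case True
    have "{w. Q r w} = {replicate n 0}"
      using True by (auto simp: inQ_def bits_def intro: nth_equalityI)
    then show ?thesis using True by simp
  next
    case False
    define g where "g a = map (\<lambda>i. of_bool (i mod r = a) :: nat) [0..<n]" for a
    have "{w. Q r w} = g ` {..<r}"
    proof (intro set_eqI iffI)
      fix w assume "w \<in> {w. Q r w}"
      then have q: "Q r w" by simp
      then obtain a where a: "a < r" "\<And>i. i < n \<Longrightarrow> w ! i = of_bool (i mod r = a)"
        using Q_residue[OF q False] by blast
      then have "w = g a" using bitsD(1)[OF Q_bits[OF q]] by (intro nth_equalityI) (auto simp: g_def)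
      then show "w \<in> g ` {..<r}" using a by simp
    next
      fix w assume "w \<in> g ` {..<r}"
      then obtain a where a: "a < r" "w = g a" by auto
      have "w \<in> bits n" using a by (intro bitsI) (auto simp: g_def)
      then show "w \<in> {w. Q r w}" using a False by (auto simp: inQ_def g_def)
    qed
    moreover have "inj_on g {..<r}"
    proof (rule inj_onI)
      fix a b assume ab: "a \<in> {..<r}" "b \<in> {..<r}" "g a = g b"
      then have "g a ! a = g b ! a" by simp
      then show "a = b" using ab rn by (simp add: g_def)
    qed
    ultimately show ?thesis by (simp add: card_image)
  qed
qed

lemma finite_J: "finite J"
  by (rule finite_subset[of _ "{..<n}"]) (use J in auto)

text \<open>By \<open>kept_Q\<close> no window is in a discarded class and by
  \<open>Q_disjoint\<close> none belongs to two lengths, so nothing is subtracted twice.\<close>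

lemma card_S: "card S + \<Sum>J = 2 ^ n - card (remset n N)"
proof -
  have disj: "card (\<Union>r\<in>J. {w. Q r w}) = (\<Sum>r\<in>J. card {w. Q r w})"
    by (rule card_UN_disjoint) (use finite_J card_Q Q_disjoint in auto)
  have U: "(\<Union>r\<in>J. {w. Q r w}) \<subseteq> bits n - remset n N"
    using kept_Q Q_bits by (auto simp: remset_def)
  have "S = (bits n - remset n N) - (\<Union>r\<in>J. {w. Q r w})"
    by (auto simp: S_def remset_def)
  moreover have "card ((bits n - remset n N) - (\<Union>r\<in>J. {w. Q r w})) + card (\<Union>r\<in>J. {w. Q r w})
      = card (bits n - remset n N)"
    using U by (metis card_Diff_subset card_mono finite_Diff finite_bits finite_subset le_add_diff_inverse2)
  moreover have "card (bits n - remset n N) = 2 ^ n - card (remset n N)"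
    by (subst card_Diff_subset) (auto simp: card_bits remset_def)
  ultimately show ?thesis using disj card_Q by simp
qed

definition state :: "nat \<Rightarrow> nat list" where "state k = (step ^^ k) start"

lemma state_bij: "bij_betw state {..<card S} S" and state_period: "state (card S) = start"
proof -
  have maps: "step ` S \<subseteq> S" using step_S by blast
  have "\<And>y. y \<in> S \<Longrightarrow> orb step start y" using reach_start orb_symS by blast
  from single_orbit[OF finite_S maps inj_step start_S this]
  show "bij_betw state {..<card S} S" "state (card S) = start" unfolding state_def by simp_all
qed

lemma state_S: "state k \<in> S"
  unfolding state_def by (rule funpow_in) (use step_S start_S in auto)

lemma state_mod: "state (k mod card S) = state k"
  using state_period unfolding state_def by (metis funpow_mod_eq)

text \<open>For \<open>j = n\<close> nothing of the old string is left: the windows of the output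
  are the states, which are distinct during one turn.\<close>

lemma state_window:
  "j \<le> n \<Longrightarrow> state (i + j) = drop j (state i) @ map (\<lambda>k. last (state (Suc (i + k)))) [0..<j]"
proof (induction j)
  case (Suc j)
  have len: "length (state i) = n" for i using bitsD(1)[OF S_bits[OF state_S]] .
  have "state (i + Suc j) = step (state (i + j))" by (simp add: state_def)
  then obtain b where b: "state (i + Suc j) = tl (state (i + j)) @ [b]" by (simp add: stp_def Let_def)
  then have lb: "b = last (state (Suc (i + j)))" by simp
  have "drop j (state i) \<noteq> []" using len Suc.prems by simp
  then have "tl (state (i + j)) = drop (Suc j) (state i) @ map (\<lambda>k. last (state (Suc (i + k)))) [0..<j]"
    using Suc by (simp add: drop_Suc tl_drop)
  then show ?case using b lb by simp
qed simp

theorem state_output: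
  "cut_down_de_bruijn n (card S) (map (\<lambda>k. last (state (Suc k))) [0..<card S])"
proof -
  define L where "L = card S"
  define w where "w = map (\<lambda>k. last (state (Suc k))) [0..<L]"
  have L0: "0 < L" unfolding L_def using start_S finite_S card_gt_0_iff by blast
  have w_nth: "w ! (k mod L) = last (state (Suc k))" for k
  proof -
    have "w ! (k mod L) = last (step (state (k mod L)))" using L0 by (simp add: w_def state_def)
    also have "state (k mod L) = state k" unfolding L_def by (rule state_mod)
    finally show ?thesis by (simp add: state_def)
  qed
  have len: "length (state i) = n" for i using bitsD(1)[OF S_bits[OF state_S]] .
  have cyc: "cyclic_substring w n i = state (i + n)" for i
  proof -
    have "length w = L" by (simp add: w_def)
    then have "cyclic_substring w n i = map (\<lambda>k. last (state (Suc (i + k)))) [0..<n]"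
      unfolding cyclic_substring_def using w_nth by simp
    also have "\<dots> = state (i + n)" using state_window[of n i] len by simp
    finally show ?thesis .
  qed
  have inj: "i = j" if ij: "i < L" "j < L" "state (i + n) = state (j + n)" for i j
  proof -
    have "state ((i + n) mod L) = state ((j + n) mod L)" using ij state_mod unfolding L_def by metis
    then have "(i + n) mod L = (j + n) mod L"
      using state_bij L0 unfolding bij_betw_def inj_on_def L_def by (meson lessThan_iff mod_less_divisor)
    moreover have "(a + n) mod L \<noteq> (b + n) mod L" if "a < b" "b < L" for a b
    proof -
      have "a + n + (b - a) = b + n" "0 < b - a" "b - a < L" using that by auto
      then show ?thesis using add_mod_neq[of "b - a" L "a + n"] by metis
    qed
    ultimately show ?thesis using ij(1,2) by (metis linorder_neqE_nat)
  qed
  have "card {i. i < L \<and> cyclic_substring w n i = u} \<le> 1" for u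
  proof -
    have "\<forall>i\<in>{i. i < L \<and> cyclic_substring w n i = u}. \<forall>j\<in>{i. i < L \<and> cyclic_substring w n i = u}. i = j"
      using inj cyc by auto
    then show ?thesis using card_le_Suc0_iff_eq[of "{i. i < L \<and> cyclic_substring w n i = u}"] by simp
  qed
  moreover have "set w \<subseteq> {0, 1}"
  proof -
    have "last (state k) \<in> {0, 1}" for k
    proof -
      have "state k \<noteq> []" using len[of k] n by auto
      then have "last (state k) \<in> set (state k)" by (rule last_in_set)
      then show ?thesis using S_bits[OF state_S[of k]] unfolding bits_def by blast
    qed
    then show ?thesis unfolding w_def set_map by (intro image_subsetI)
  qed
  ultimately show ?thesis unfolding cut_down_de_bruijn_def L_def[symmetric] w_def[symmetric]
    by (simp add: w_def)
qed

end

section \<open>Total correctness with resource bounds\<close>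

text \<open>
  Registers of the program: \<open>0\<close> is \<open>n\<close>, \<open>1\<close> the loop index, \<open>2\<close> the period found by Duval's test (\<open>0\<close> if
  the string is not a necklace), \<open>3\<close> the excess \<open>r\<close>, \<open>5\<close> tells whether \<open>N\<close> has been found, \<open>6\<close> is the
  weight of \<open>N\<close>, \<open>7\<close> and \<open>8\<close> are the two parts of \<open>r\<close>, \<open>9\<close> is the next symbol, \<open>12\<close> counts hits of
  cut out windows, \<open>14\<close> tells whether the output loop continues. Array \<open>0\<close> is the counter that starts at
  \<open>L\<close>, array \<open>1\<close> holds the enumerated string and later \<open>N\<close>, array \<open>2\<close> the current string, both from
  index \<open>1\<close>; their cells \<open>0\<close> are a sentinel and the symbol shifted out.
\<close>

definition bnd :: "nat \<Rightarrow> nat" where "bnd n = (n + 1) ^ 3"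

fun okloc :: "nat \<Rightarrow> loc \<Rightarrow> bool" where
  "okloc n (Scalar x) = (x < 16)"
| "okloc n (Cell a i) = (a < 3 \<and> i \<le> n + 1)"

fun quiet :: "nat \<Rightarrow> event \<Rightarrow> bool" where
  "quiet n (Compute v) = (v \<le> bnd n)"
| "quiet n (Load l v) = (okloc n l \<and> v \<le> bnd n)"
| "quiet n (Store l v) = (okloc n l \<and> v \<le> bnd n)"
| "quiet n Branch = True"
| "quiet n (Emit v) = False"

text \<open>Only sums and products can grow; each other operation stays below its first operand or
  yields at most \<open>1\<close>. The limit \<open>2 * n + 2\<close> leaves room for
  \<open>n + 1\<close> and for doubled lengths.\<close>

fun okE :: "nat \<Rightarrow> expr \<Rightarrow> store \<Rightarrow> bool" where
  "okE n (Const c) s = (c \<le> 2)"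
| "okE n (Var x) s = (x < 16)"
| "okE n (Elem a e) s = (okE n e s \<and> a < 3 \<and> eval e s \<le> n + 1)"
| "okE n (Op f e1 e2) s = (okE n e1 s \<and> okE n e2 s \<and>
     (f = Add \<or> f = Mul \<longrightarrow> apply_op f (eval e1 s) (eval e2 s) \<le> 2 * n + 2))"

fun cost :: "expr \<Rightarrow> nat" where
  "cost (Const c) = 1"
| "cost (Var x) = 1"
| "cost (Elem a e) = cost e + 1"
| "cost (Op f e1 e2) = cost e1 + cost e2 + 1"

definition bd :: "nat \<Rightarrow> store \<Rightarrow> bool" where "bd n s \<longleftrightarrow> (\<forall>l. s l \<le> bnd n)"

lemma bnd_ge: "1 \<le> n \<Longrightarrow> 2 * n + 2 \<le> bnd n" "1 \<le> n \<Longrightarrow> 4 \<le> bnd n"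
proof -
  assume n: "1 \<le> n"
  have "2 ^ 2 \<le> (n + 1) ^ 2" using n by (intro power_mono) auto
  then have "(n + 1) * 4 \<le> (n + 1) * (n + 1) ^ 2" by (intro mult_left_mono) auto
  then have "(n + 1) * 4 \<le> bnd n" by (simp add: bnd_def power3_eq_cube power2_eq_square algebra_simps)
  then show "2 * n + 2 \<le> bnd n" "4 \<le> bnd n" using n by auto
qed

lemma length_eval_trace: "length (eval_trace e s) = cost e"
  by (induction e) auto

lemma eval_trace_quiet:
  assumes "1 \<le> n" "bd n s" "okE n e s"
  shows "(\<forall>ev\<in>set (eval_trace e s). quiet n ev) \<and> eval e s \<le> bnd n"
  using assms(3)
proof (induction e)
  case (Const c) then show ?case using bnd_ge[OF assms(1)] by auto
next
  case (Var x) then show ?case using assms(2) by (auto simp: bd_def)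
next
  case (Elem a e) then show ?case using assms(2) by (auto simp: bd_def)
next
  case (Op f e1 e2)
  have "apply_op f (eval e1 s) (eval e2 s) \<le> bnd n"
  proof (cases "f = Add \<or> f = Mul")
    case True then show ?thesis using Op bnd_ge(1)[OF assms(1)] by force
  next
    case False
    have b1: "eval e1 s \<le> bnd n" and b2: "eval e2 s \<le> bnd n" using Op by auto
    have "eval e1 s - eval e2 s \<le> bnd n" "eval e1 s div eval e2 s \<le> bnd n" "eval e1 s mod eval e2 s \<le> bnd n"
      using b1 div_le_dividend[of "eval e1 s" "eval e2 s"] mod_less_eq_dividend[of "eval e1 s" "eval e2 s"] by linarith+
    then show ?thesis using False bnd_ge(2)[OF assms(1)] by (cases f) auto
  qed
  then show ?case using Op by auto
qed

text \<open>Total correctness for silent programs: the run exists, takes at most \<open>T\<close>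
  events, stays within words and cells and emits nothing. The precondition is a concrete store, so
  assignments can be evaluated by simplification.\<close>

definition H :: "nat \<Rightarrow> com \<Rightarrow> store \<Rightarrow> nat \<Rightarrow> (store \<Rightarrow> bool) \<Rightarrow> bool" where
  "H n c s T R \<longleftrightarrow> (1 \<le> n \<longrightarrow> bd n s \<longrightarrow>
     (\<exists>t s'. exec c s t s' \<and> length t \<le> T \<and> (\<forall>ev\<in>set t. quiet n ev) \<and> bd n s' \<and> R s'))"

lemma H_conseq: "H n c s T R \<Longrightarrow> T \<le> T' \<Longrightarrow> (\<And>s'. R s' \<Longrightarrow> R' s') \<Longrightarrow> H n c s T' R'"
  unfolding H_def by (meson le_trans)

lemma H_Skip: "R s \<Longrightarrow> H n Skip s T R"
  unfolding H_def by (intro impI exI[of _ "[]"] exI[of _ s]) (auto intro: exec.Skip)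

lemma H_Assign:
  assumes "okE n e s" "x < 16" "cost e + 1 \<le> T" "R (s(Scalar x := eval e s))"
  shows "H n (Assign x e) s T R"
  unfolding H_def
proof (intro impI)
  assume n: "1 \<le> n" and b: "bd n s"
  note q = eval_trace_quiet[OF n b assms(1)]
  show "\<exists>t s'. exec (Assign x e) s t s' \<and> length t \<le> T \<and> (\<forall>ev\<in>set t. quiet n ev) \<and> bd n s' \<and> R s'"
    using exec.Assign[of x e s] q assms b
    by (intro exI[of _ "eval_trace e s @ [Store (Scalar x) (eval e s)]"] exI[of _ "s(Scalar x := eval e s)"])
       (auto simp: length_eval_trace bd_def)
qed

lemma H_Update:
  assumes "okE n i s" "okE n e s" "a < 3" "eval i s \<le> n + 1" "cost i + cost e + 1 \<le> T"
    "R (s(Cell a (eval i s) := eval e s))"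
  shows "H n (Update a i e) s T R"
  unfolding H_def
proof (intro impI)
  assume n: "1 \<le> n" and b: "bd n s"
  note q = eval_trace_quiet[OF n b assms(1)] eval_trace_quiet[OF n b assms(2)]
  show "\<exists>t s'. exec (Update a i e) s t s' \<and> length t \<le> T \<and> (\<forall>ev\<in>set t. quiet n ev) \<and> bd n s' \<and> R s'"
    using exec.Update[of a i e s] q assms b
    by (intro exI[of _ "eval_trace i s @ eval_trace e s @ [Store (Cell a (eval i s)) (eval e s)]"]
        exI[of _ "s(Cell a (eval i s) := eval e s)"])
       (auto simp: length_eval_trace bd_def)
qed

lemma H_Seq:
  assumes "H n c1 s T1 (\<lambda>s1. H n c2 s1 T2 R)" "T1 + T2 \<le> T"
  shows "H n (Seq c1 c2) s T R"
  unfolding H_def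
proof (intro impI)
  assume n: "1 \<le> n" and b: "bd n s"
  obtain t1 s1 where 1: "exec c1 s t1 s1" "length t1 \<le> T1" "\<forall>ev\<in>set t1. quiet n ev" "bd n s1"
    "H n c2 s1 T2 R" using assms(1) n b unfolding H_def by blast
  then obtain t2 s2 where 2: "exec c2 s1 t2 s2" "length t2 \<le> T2" "\<forall>ev\<in>set t2. quiet n ev" "bd n s2" "R s2"
    using n unfolding H_def by blast
  show "\<exists>t s'. exec (Seq c1 c2) s t s' \<and> length t \<le> T \<and> (\<forall>ev\<in>set t. quiet n ev) \<and> bd n s' \<and> R s'"
    using exec.Seq[OF 1(1) 2(1)] 1 2 assms(2) by (intro exI[of _ "t1 @ t2"] exI[of _ s2]) auto
qed

lemma H_Cond:
  assumes "okE n e s" "eval e s \<noteq> 0 \<Longrightarrow> H n c1 s T' R" "eval e s = 0 \<Longrightarrow> H n c2 s T' R"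
    "cost e + 1 + T' \<le> T"
  shows "H n (Cond e c1 c2) s T R"
  unfolding H_def
proof (intro impI)
  assume n: "1 \<le> n" and b: "bd n s"
  note q = eval_trace_quiet[OF n b assms(1)]
  show "\<exists>t s'. exec (Cond e c1 c2) s t s' \<and> length t \<le> T \<and> (\<forall>ev\<in>set t. quiet n ev) \<and> bd n s' \<and> R s'"
  proof (cases "eval e s = 0")
    case True
    then obtain t s' where 1: "exec c2 s t s'" "length t \<le> T'" "\<forall>ev\<in>set t. quiet n ev" "bd n s'" "R s'"
      using assms(3) n b unfolding H_def by blast
    then show ?thesis using exec.CondFalse[OF True 1(1), of c1] assms(4) q
      by (intro exI[of _ "eval_trace e s @ Branch # t"] exI[of _ s']) (auto simp: length_eval_trace)
  next
    case False
    then obtain t s' where 1: "exec c1 s t s'" "length t \<le> T'" "\<forall>ev\<in>set t. quiet n ev" "bd n s'" "R s'"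
      using assms(2) n b unfolding H_def by blast
    then show ?thesis using exec.CondTrue[OF False 1(1), of c2] assms(4) q
      by (intro exI[of _ "eval_trace e s @ Branch # t"] exI[of _ s']) (auto simp: length_eval_trace)
  qed
qed

text \<open>The potential \<open>\<phi>\<close> bounds the remaining time, so that the cost of the iterations can be amortised.\<close>

lemma H_While:
  assumes ok: "\<And>\<phi> s. I \<phi> s \<Longrightarrow> okE n e s"
    and exit: "\<And>\<phi> s. I \<phi> s \<Longrightarrow> eval e s = 0 \<Longrightarrow> R s"
    and body: "\<And>\<phi> s. I \<phi> s \<Longrightarrow> eval e s \<noteq> 0 \<Longrightarrow>
      \<exists>Tb. H n c s Tb (\<lambda>s'. \<exists>\<phi>'. I \<phi>' s' \<and> Tb + cost e + 1 + \<phi>' \<le> \<phi>)"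
    and init: "I \<phi> s" and T: "\<phi> + cost e + 1 \<le> T"
  shows "H n (While e c) s T R"
  unfolding H_def
proof (intro impI)
  assume n: "1 \<le> n" and b: "bd n s"
  have "\<exists>t s'. exec (While e c) s t s' \<and> length t \<le> \<phi> + cost e + 1 \<and> (\<forall>ev\<in>set t. quiet n ev) \<and> bd n s' \<and> R s'"
    using init b
  proof (induction \<phi> arbitrary: s rule: less_induct)
    case (less \<phi>)
    note q = eval_trace_quiet[OF n less.prems(2) ok[OF less.prems(1)]]
    show ?case
    proof (cases "eval e s = 0")
      case True
      then show ?thesis using exec.WhileFalse[OF True, of c] q less.prems exit[OF less.prems(1) True]
        by (intro exI[of _ "eval_trace e s @ [Branch]"] exI[of _ s]) (auto simp: length_eval_trace)
    next
      case False
      obtain Tb where "H n c s Tb (\<lambda>s'. \<exists>\<phi>'. I \<phi>' s' \<and> Tb + cost e + 1 + \<phi>' \<le> \<phi>)"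
        using body[OF less.prems(1) False] by blast
      then obtain t1 s1 \<phi>' where 1: "exec c s t1 s1" "length t1 \<le> Tb" "\<forall>ev\<in>set t1. quiet n ev" "bd n s1"
        "I \<phi>' s1" "Tb + cost e + 1 + \<phi>' \<le> \<phi>" using n less.prems(2) unfolding H_def by blast
      have "\<phi>' < \<phi>" using 1(6) by simp
      from less.IH[OF this 1(5,4)] obtain t2 s2 where 2: "exec (While e c) s1 t2 s2"
        "length t2 \<le> \<phi>' + cost e + 1" "\<forall>ev\<in>set t2. quiet n ev" "bd n s2" "R s2" by blast
      show ?thesis using exec.WhileTrue[OF False 1(1) 2(1)] 1 2 q
        by (intro exI[of _ "eval_trace e s @ Branch # t1 @ t2"] exI[of _ s2]) (auto simp: length_eval_trace)
    qed
  qed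
  then show "\<exists>t s'. exec (While e c) s t s' \<and> length t \<le> T \<and> (\<forall>ev\<in>set t. quiet n ev) \<and> bd n s' \<and> R s'"
    using T by (meson le_trans)
qed

text \<open>The potential is the measure \<open>f\<close> times the cost of one iteration.\<close>

lemma H_For:
  assumes ok: "\<And>s. I s \<Longrightarrow> okE n e s"
    and exit: "\<And>s. I s \<Longrightarrow> eval e s = 0 \<Longrightarrow> R s"
    and body: "\<And>s. I s \<Longrightarrow> eval e s \<noteq> 0 \<Longrightarrow> H n c s C (\<lambda>s'. I s' \<and> f s' < f s)"
    and init: "I s" and f: "f s \<le> F" and T: "F * (C + cost e + 1) + cost e + 1 \<le> T"
  shows "H n (While e c) s T R"
proof (rule H_While[where I = "\<lambda>\<phi> s. I s \<and> \<phi> = f s * (C + cost e + 1)" and \<phi> = "f s * (C + cost e + 1)"])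
  show "f s * (C + cost e + 1) + cost e + 1 \<le> T"
    using f T by (meson add_le_mono1 le_trans mult_le_mono1)
  fix \<phi> s assume "I s \<and> \<phi> = f s * (C + cost e + 1)" and g: "eval e s \<noteq> 0"
  then have Is: "I s" and \<phi>: "\<phi> = f s * (C + cost e + 1)" by auto
  show "\<exists>Tb. H n c s Tb (\<lambda>s'. \<exists>\<phi>'. (I s' \<and> \<phi>' = f s' * (C + cost e + 1)) \<and> Tb + cost e + 1 + \<phi>' \<le> \<phi>)"
  proof (rule exI[of _ C], rule H_conseq[OF body[OF Is g] le_refl])
    fix s' assume s': "I s' \<and> f s' < f s"
    then have "Suc (f s') * (C + cost e + 1) \<le> f s * (C + cost e + 1)" by (intro mult_le_mono1) simp
    then show "\<exists>\<phi>'. (I s' \<and> \<phi>' = f s' * (C + cost e + 1)) \<and> C + cost e + 1 + \<phi>' \<le> \<phi>"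
      using s' \<phi> by simp
  qed
qed (use ok exit init in auto)

definition arr :: "nat \<Rightarrow> store \<Rightarrow> nat \<Rightarrow> nat list" where
  "arr n s a = map (\<lambda>i. s (Cell a (Suc i))) [0..<n]"

lemma length_arr[simp]: "length (arr n s a) = n" by (simp add: arr_def)

lemma arr_nth: "i < n \<Longrightarrow> arr n s a ! i = s (Cell a (Suc i))" by (simp add: arr_def)

lemma arr_cong: "(\<And>i. 1 \<le> i \<Longrightarrow> i \<le> n \<Longrightarrow> s' (Cell a i) = s (Cell a i)) \<Longrightarrow> arr n s' a = arr n s a"
  by (simp add: arr_def)

definition same :: "loc set \<Rightarrow> store \<Rightarrow> store \<Rightarrow> bool" where
  "same W s s' \<longleftrightarrow> (\<forall>l. l \<notin> W \<longrightarrow> s' l = s l)"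

lemma sameD: "same W s s' \<Longrightarrow> l \<notin> W \<Longrightarrow> s' l = s l" by (simp add: same_def)

abbreviation "addE e1 e2 \<equiv> Op Add e1 e2"
abbreviation "subE e1 e2 \<equiv> Op Sub e1 e2"
abbreviation "inc x \<equiv> Assign x (addE (Var x) (Const 1))"
abbreviation "dec x \<equiv> Assign x (subE (Var x) (Const 1))"
abbreviation "in_range \<equiv> Op Lt (Var 1) (addE (Var 0) (Const 1))"
abbreviation "up_to_n c \<equiv> While in_range (Seq c (inc 1))"

lemma H_SA:
  assumes "okE n e s" "x < 16" "H n c2 (s(Scalar x := eval e s)) T2 R" "cost e + 1 + T2 \<le> T"
  shows "H n (Seq (Assign x e) c2) s T R"
  by (rule H_Seq[OF H_Assign[OF assms(1,2) le_refl] assms(4)]) (rule assms(3))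

lemma H_SU:
  assumes "okE n i s" "okE n e s" "a < 3" "eval i s \<le> n + 1"
    "H n c2 (s(Cell a (eval i s) := eval e s)) T2 R" "cost i + cost e + 1 + T2 \<le> T"
  shows "H n (Seq (Update a i e) c2) s T R"
  by (rule H_Seq[OF H_Update[OF assms(1-4) le_refl] assms(6)]) (rule assms(5))

lemma H_SS:
  assumes "H n c1 s T1 R1" "\<And>s'. R1 s' \<Longrightarrow> H n c2 s' T2 R" "T1 + T2 \<le> T"
  shows "H n (Seq c1 c2) s T R"
  by (rule H_Seq[OF H_conseq[OF assms(1) le_refl assms(2)] assms(3)])

section \<open>The programs\<close>

abbreviation "duval_step a \<equiv>
  Cond (Op Lt (Elem a (Var 1)) (Elem a (subE (Var 1) (Var 2))))
    (Seq (Assign 2 (Const 0)) (Assign 1 (Var 0)))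
    (Cond (Op Lt (Elem a (subE (Var 1) (Var 2))) (Elem a (Var 1))) (Assign 2 (Var 1)) Skip)"

definition neck_com :: "nat \<Rightarrow> com" where
  "neck_com a = Seq (Assign 2 (Const 1)) (Seq (Assign 1 (Const 2)) (Seq
     (up_to_n
       (duval_step a))
     (Cond (Op Rem (Var 0) (Var 2)) (Assign 2 (Const 0)) Skip)))"

text \<open>Register \<open>1\<close> is the cell to be read, so \<open>i - 1\<close> letters have
  been processed. A failure sets \<open>p\<close> to \<open>0\<close> and register \<open>1\<close>
  to \<open>n\<close>, which the increment turns into the end of the loop. As
  \<open>n mod 0 = n\<close> is positive, the final divisibility test then rejects just as it does
  for an incomplete last period.\<close>

lemma neck_com:
  assumes s0: "s (Scalar 0) = n" and n: "1 \<le> n" and a: "a < 3" and x: "arr n s a = x" "x \<in> bits n"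
  shows "H n (neck_com a) s (50 * n)
    (\<lambda>s'. same {Scalar 1, Scalar 2} s s' \<and>
      (if neck x then 0 < s' (Scalar 2) \<and> s' (Scalar 2) \<le> n \<and> card {v. \<exists>k. v = rotate k x} = s' (Scalar 2)
       else s' (Scalar 2) = 0))"
proof -
  define I where "I s' \<longleftrightarrow> same {Scalar 1, Scalar 2} s s' \<and>
     ((s' (Scalar 2) = 0 \<and> \<not> neck x \<and> s' (Scalar 1) = n + 1) \<or>
      (duval_inv x (s' (Scalar 1) - 1) (s' (Scalar 2)) \<and> 2 \<le> s' (Scalar 1) \<and> s' (Scalar 1) \<le> n + 1))" for s'
  have I0: "s' (Scalar 0) = n" "s' (Cell a i) = s (Cell a i)" if "I s'" for s' i
    using that s0 by (auto simp: I_def same_def)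
  have loop: "H n (up_to_n
       (duval_step a))
      (s(Scalar 2 := 1, Scalar 1 := 2)) (28 * n + 6) (\<lambda>s'. I s' \<and> s' (Scalar 1) = n + 1)"
  proof (rule H_For[where I = I and C = 22 and f = "\<lambda>s'. n + 1 - s' (Scalar 1)" and F = n])
    show "I (s(Scalar 2 := 1, Scalar 1 := 2))"
      using n duval_inv_init by (simp add: I_def same_def)
  next
    fix s' assume "I s'"
    then show "okE n in_range s'" using I0 n by simp
  next
    fix s' assume "I s'" "eval in_range s' = 0"
    then show "I s' \<and> s' (Scalar 1) = n + 1" using I0[of s'] by (auto simp: I_def split: if_splits)
  next
    fix s' assume Is: "I s'" and g: "eval in_range s' \<noteq> 0"
    define i p where "i = s' (Scalar 1)" and "p = s' (Scalar 2)"
    have ip: "duval_inv x (i - 1) p" "2 \<le> i" "i \<le> n" "s' (Scalar 0) = n" "same {Scalar 1, Scalar 2} s s'"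
      using Is g I0[OF Is] by (auto simp: I_def i_def p_def split: if_splits)
    then have p: "0 < p" "p \<le> i - 1" by (auto simp: duval_inv_def)
    have xi: "x ! (i - 1) = s' (Cell a i)"
      using x(1) ip I0(2)[OF Is] arr_nth[of "i - 1" n s a] by simp
    have xip: "x ! (i - 1 - p) = s' (Cell a (i - p))"
    proof -
      have "i - 1 - p < n" "Suc (i - 1 - p) = i - p" using ip p by auto
      then show ?thesis using x(1) I0(2)[OF Is] arr_nth[of "i - 1 - p" n s a] by simp
    qed
    show "H n (Seq (duval_step a) (inc 1)) s' 22
         (\<lambda>s''. I s'' \<and> n + 1 - s'' (Scalar 1) < n + 1 - s' (Scalar 1))"
    proof (rule H_SS[where ?T1.0 = 18 and ?T2.0 = 4 and ?R1.0 =
        "\<lambda>s''. s'' (Scalar 1) \<le> n \<and> s'' (Scalar 0) = n \<and> I (s''(Scalar 1 := s'' (Scalar 1) + 1)) \<and> i \<le> s'' (Scalar 1)"], rule H_Cond[where T' = 10])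
      assume "eval (Op Lt (Elem a (Var 1)) (Elem a (subE (Var 1) (Var 2)))) s' \<noteq> 0"
      then have "x ! (i - 1) < x ! (i - 1 - p)" using xi xip by (simp add: i_def p_def split: if_splits)
      then have "\<not> neck x" using duval_fail[OF x(2) ip(1)] ip by simp
      then show "H n (Seq (Assign 2 (Const 0)) (Assign 1 (Var 0))) s' 10
        (\<lambda>s''. s'' (Scalar 1) \<le> n \<and> s'' (Scalar 0) = n \<and> I (s''(Scalar 1 := s'' (Scalar 1) + 1)) \<and> i \<le> s'' (Scalar 1))"
        using ip by (intro H_SA[where ?T2.0 = 2] H_Assign) (auto simp: I_def same_def)
    next
      assume "eval (Op Lt (Elem a (Var 1)) (Elem a (subE (Var 1) (Var 2)))) s' = 0"
      then have ge: "x ! (i - 1 - p) \<le> x ! (i - 1)" using xi xip by (simp add: i_def p_def split: if_splits)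
      show "H n (Cond (Op Lt (Elem a (subE (Var 1) (Var 2))) (Elem a (Var 1))) (Assign 2 (Var 1)) Skip) s' 10
        (\<lambda>s''. s'' (Scalar 1) \<le> n \<and> s'' (Scalar 0) = n \<and> I (s''(Scalar 1 := s'' (Scalar 1) + 1)) \<and> i \<le> s'' (Scalar 1))"
      proof (rule H_Cond[where T' = 2])
        assume "eval (Op Lt (Elem a (subE (Var 1) (Var 2))) (Elem a (Var 1))) s' \<noteq> 0"
        then have "x ! (i - 1 - p) < x ! (i - 1)" using xi xip by (simp add: i_def p_def split: if_splits)
        then have "duval_inv x i i" using duval_inv_jump[OF ip(1)] ip(2) by simp
        then show "H n (Assign 2 (Var 1)) s' 2
          (\<lambda>s''. s'' (Scalar 1) \<le> n \<and> s'' (Scalar 0) = n \<and> I (s''(Scalar 1 := s'' (Scalar 1) + 1)) \<and> i \<le> s'' (Scalar 1))"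
          using ip by (intro H_Assign) (auto simp: I_def same_def i_def)
      next
        assume "eval (Op Lt (Elem a (subE (Var 1) (Var 2))) (Elem a (Var 1))) s' = 0"
        then have "x ! (i - 1) = x ! (i - 1 - p)" using ge xi xip by (simp add: i_def p_def split: if_splits)
        then have "duval_inv x i p" using duval_inv_keep[OF ip(1)] ip(2) by simp
        then show "H n Skip s' 2
          (\<lambda>s''. s'' (Scalar 1) \<le> n \<and> s'' (Scalar 0) = n \<and> I (s''(Scalar 1 := s'' (Scalar 1) + 1)) \<and> i \<le> s'' (Scalar 1))"
          using ip by (intro H_Skip) (auto simp: I_def same_def i_def p_def)
      qed (use a ip in \<open>auto simp: i_def\<close>)
    next
      fix s'' assume "s'' (Scalar 1) \<le> n \<and> s'' (Scalar 0) = n \<and> I (s''(Scalar 1 := s'' (Scalar 1) + 1)) \<and> i \<le> s'' (Scalar 1)"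
      then show "H n (inc 1) s'' 4 (\<lambda>s''. I s'' \<and> n + 1 - s'' (Scalar 1) < n + 1 - s' (Scalar 1))"
        by (intro H_Assign) (auto simp: i_def)
    qed (use a ip in \<open>auto simp: i_def\<close>)
  qed (use n in auto)
  show ?thesis unfolding neck_com_def
  proof (rule H_SA[where ?T2.0 = "28 * n + 14"], simp, simp, rule H_SA[where ?T2.0 = "28 * n + 12"], simp, simp)
    have fin: "if neck x then s' (Scalar 2) dvd n \<and> 0 < s' (Scalar 2) \<and> s' (Scalar 2) \<le> n \<and> card {v. \<exists>k. v = rotate k x} = s' (Scalar 2)
        else \<not> s' (Scalar 2) dvd n" if "I s' \<and> s' (Scalar 1) = n + 1" for s'
    proof -
      consider "s' (Scalar 2) = 0" "\<not> neck x" | "duval_inv x n (s' (Scalar 2))"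
        using \<open>I s' \<and> s' (Scalar 1) = n + 1\<close> by (auto simp: I_def)
      then show ?thesis
      proof cases
        case 1 then show ?thesis using n by simp
      next
        case 2
        then have "0 < s' (Scalar 2)" "s' (Scalar 2) \<le> n" by (auto simp: duval_inv_def)
        then show ?thesis using duval_final_dvd[OF x(2) 2] duval_final_not_dvd[OF x(2) 2] by auto
      qed
    qed
    show "H n (Seq (up_to_n
       (duval_step a))
       (Cond (Op Rem (Var 0) (Var 2)) (Assign 2 (Const 0)) Skip))
       (s(Scalar 2 := eval (Const 1) s, Scalar 1 := eval (Const 2) (s(Scalar 2 := eval (Const 1) s)))) (28 * n + 12)
       (\<lambda>s'. same {Scalar 1, Scalar 2} s s' \<and>
      (if neck x then 0 < s' (Scalar 2) \<and> s' (Scalar 2) \<le> n \<and> card {v. \<exists>k. v = rotate k x} = s' (Scalar 2)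
       else s' (Scalar 2) = 0))"
    proof (rule H_SS[where ?T1.0 = "28 * n + 6" and ?T2.0 = 6 and ?R1.0 = "\<lambda>s'. I s' \<and> s' (Scalar 1) = n + 1"], use loop in simp)
      fix s' assume Is: "I s' \<and> s' (Scalar 1) = n + 1"
      then have "s' (Scalar 0) = n" "same {Scalar 1, Scalar 2} s s'" using I0[of s'] by (auto simp: I_def)
      then show "H n (Cond (Op Rem (Var 0) (Var 2)) (Assign 2 (Const 0)) Skip) s' 6
        (\<lambda>s'. same {Scalar 1, Scalar 2} s s' \<and>
          (if neck x then 0 < s' (Scalar 2) \<and> s' (Scalar 2) \<le> n \<and> card {v. \<exists>k. v = rotate k x} = s' (Scalar 2)
           else s' (Scalar 2) = 0))"
        using fin[OF Is] by (intro H_Cond[where T' = 2] H_Assign H_Skip) (auto simp: same_def split: if_splits)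
    qed simp
  qed (use n in auto)
qed

section \<open>The binary counter\<close>

definition ctr :: "nat \<Rightarrow> store \<Rightarrow> nat \<Rightarrow> bool" where
  "ctr n s c \<longleftrightarrow> (\<forall>i\<le>n. s (Cell 0 i) = c div 2 ^ i mod 2)"

definition inc_com :: com where
  "inc_com = Seq (Assign 1 (Const 0)) (Seq
     (While (Elem 0 (Var 1)) (Seq (Update 0 (Var 1) (Const 0)) (inc 1)))
     (Update 0 (Var 1) (Const 1)))"

text \<open>The carry erases the trailing ones and stops at the first zero; halving \<open>c\<close>
  removes one of them.\<close>

lemma binary_carry:
  assumes "\<And>j. j < i \<Longrightarrow> c div 2 ^ j mod 2 = 1" "c div 2 ^ i mod 2 = (0::nat)"
  shows "Suc c div 2 ^ j mod 2 = (if j < i then 0 else if j = i then 1 else c div 2 ^ j mod 2)"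
  using assms
proof (induction i arbitrary: c j)
  case 0
  then have even: "c mod 2 = 0" by simp
  show ?case
  proof (cases j)
    case 0 then show ?thesis using even by (simp add: mod_Suc)
  next
    case (Suc j')
    have "Suc c div 2 = c div 2" using even by presburger
    then show ?thesis using Suc by (simp add: div_mult2_eq)
  qed
next
  case (Suc i)
  have odd: "c mod 2 = 1" using Suc.prems(1)[of 0] by simp
  have e: "Suc c div 2 = Suc (c div 2)" using odd by presburger
  have p1: "c div 2 div 2 ^ j mod 2 = 1" if "j < i" for j
    using Suc.prems(1)[of "Suc j"] that by (simp add: div_mult2_eq)
  have p2: "c div 2 div 2 ^ i mod 2 = 0" using Suc.prems(2) by (simp add: div_mult2_eq)
  show ?case
  proof (cases j)
    case 0 then show ?thesis using odd by (simp add: mod_Suc)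
  next
    case (Suc j')
    have "Suc c div 2 ^ j mod 2 = Suc (c div 2) div 2 ^ j' mod 2" using Suc e by (simp add: div_mult2_eq)
    also have "\<dots> = (if j' < i then 0 else if j' = i then 1 else c div 2 div 2 ^ j' mod 2)"
      by (rule Suc.IH[OF p1 p2])
    finally show ?thesis using Suc by (simp add: div_mult2_eq)
  qed
qed

lemma inc_com:
  assumes c: "ctr n s c" "c < 2 ^ n" and n: "1 \<le> n"
  shows "H n inc_com s (20 * n) (\<lambda>s'. ctr n s' (Suc c) \<and> same ({Scalar 1} \<union> {Cell 0 j | j. j \<le> n}) s s')"
proof -
  define I where "I s' \<longleftrightarrow> same ({Scalar 1} \<union> {Cell 0 j | j. j \<le> n}) s s' \<and> s' (Scalar 1) \<le> n \<and>
     (\<forall>j<s' (Scalar 1). c div 2 ^ j mod 2 = 1 \<and> s' (Cell 0 j) = 0) \<and>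
     (\<forall>j. s' (Scalar 1) \<le> j \<and> j \<le> n \<longrightarrow> s' (Cell 0 j) = c div 2 ^ j mod 2)" for s'
  have loop: "H n (While (Elem 0 (Var 1)) (Seq (Update 0 (Var 1) (Const 0)) (inc 1))) (s(Scalar 1 := 0))
     (10 * n + 3) (\<lambda>s'. I s' \<and> s' (Cell 0 (s' (Scalar 1))) = 0)"
  proof (rule H_For[where I = I and C = 7 and f = "\<lambda>s'. n - s' (Scalar 1)" and F = n])
    show "I (s(Scalar 1 := 0))" using c by (auto simp: I_def same_def ctr_def)
  next
    fix s' assume Is: "I s'" and g: "eval (Elem 0 (Var 1)) s' \<noteq> 0"
    define i where "i = s' (Scalar 1)"
    have i: "i \<le> n" "s' (Cell 0 i) = c div 2 ^ i mod 2" using Is by (auto simp: I_def i_def)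
    then have bit: "c div 2 ^ i mod 2 = 1" using g by (auto simp: i_def)
    \<comment> \<open>The carry cannot pass cell \<open>n\<close>, whose bit is zero as long as
      \<open>c < 2 ^ n\<close>.\<close>
    have "i \<noteq> n" using bit c(2) by auto
    then have lt: "i < n" using i by simp
    show "H n (Seq (Update 0 (Var 1) (Const 0)) (inc 1)) s' 7 (\<lambda>s''. I s'' \<and> n - s'' (Scalar 1) < n - s' (Scalar 1))"
      using Is bit lt
      by (intro H_SU[where ?T2.0 = 4] H_Assign) (auto simp: I_def same_def i_def less_Suc_eq)
  qed (auto simp: I_def)
  show ?thesis unfolding inc_com_def
  proof (rule H_SA[where ?T2.0 = "10 * n + 6"], simp, simp, rule H_SS[where ?T1.0 = "10 * n + 3" and ?T2.0 = 3])
    show "H n (While (Elem 0 (Var 1)) (Seq (Update 0 (Var 1) (Const 0)) (inc 1))) (s(Scalar 1 := eval (Const 0) s))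
     (10 * n + 3) (\<lambda>s'. I s' \<and> s' (Cell 0 (s' (Scalar 1))) = 0)" using loop by simp
  next
    fix s' assume Is: "I s' \<and> s' (Cell 0 (s' (Scalar 1))) = 0"
    define i where "i = s' (Scalar 1)"
    have i: "i \<le> n" "c div 2 ^ i mod 2 = 0" using Is by (auto simp: I_def i_def)
    have bits: "Suc c div 2 ^ j mod 2 = (if j < i then 0 else if j = i then 1 else c div 2 ^ j mod 2)" for j
      by (rule binary_carry) (use Is i in \<open>auto simp: I_def i_def\<close>)
    have "ctr n (s'(Cell 0 i := 1)) (Suc c)" unfolding ctr_def bits using Is by (auto simp: I_def i_def)
    moreover have "same ({Scalar 1} \<union> {Cell 0 j | j. j \<le> n}) s (s'(Cell 0 i := 1))"
      using Is i by (auto simp: I_def same_def)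
    ultimately show "H n (Update 0 (Var 1) (Const 1)) s' 3
       (\<lambda>s'. ctr n s' (Suc c) \<and> same ({Scalar 1} \<union> {Cell 0 j | j. j \<le> n}) s s')"
      using i by (intro H_Update) (auto simp: i_def)
  qed (use n in auto)
qed

section \<open>The next string in the order of discarding\<close>

abbreviation "refill_com \<equiv> While (Op Lt (Var 1) (Var 9)) (Seq
  (Cond (Op Lt (Const 1) (Var 4)) (Seq (Update 1 (Var 9) (Const 1)) (dec 4)) (Update 1 (Var 9) (Const 0)))
  (dec 9))"

text \<open>
  The sentinel \<open>0\<close> in front of the string makes the step to the next lower weight an instance of the
  step within a weight.
\<close>

definition next_com :: com where
  "next_com = Seq (Assign 1 (Var 0)) (Seq (Assign 4 (Const 0)) (Seq
     (While (Op Eq (Elem 1 (Var 1)) (Const 0)) (dec 1)) (Seq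
     (While (Elem 1 (Var 1)) (Seq (dec 1) (inc 4))) (Seq
     (Update 1 (Var 1) (Const 1)) (Seq (Assign 9 (Var 0)) (Seq
     refill_com
     (Update 1 (Const 0) (Const 0))))))))"

text \<open>Cell \<open>i\<close> is the zero in front of the last block of \<open>k\<close> ones.
  If it is the sentinel, the one written there is lost to the string, which leaves the smallest
  string of the next lower weight.\<close>

lemma next_list:
  assumes x: "arr n s 1 = x" "x \<in> bits n" and i: "i + k \<le> n" "1 \<le> k"
    and X: "s (Cell 1 i) = 0" "\<And>j. i < j \<Longrightarrow> j \<le> i + k \<Longrightarrow> s (Cell 1 j) = 1"
      "\<And>j. i + k < j \<Longrightarrow> j \<le> n \<Longrightarrow> s (Cell 1 j) = 0"
    and Y: "\<And>j. 1 \<le> j \<Longrightarrow> j < i \<Longrightarrow> s' (Cell 1 j) = s (Cell 1 j)" "1 \<le> i \<Longrightarrow> s' (Cell 1 i) = 1"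
      "\<And>j. i < j \<Longrightarrow> j \<le> n \<Longrightarrow> s' (Cell 1 j) = (if n - (k - 1) < j then 1 else 0)"
  shows "arr n s' 1 \<in> bits n" "next_in_order n x (arr n s' 1)"
proof -
  define m where "m = n - i - k"
  have *: "arr n s' 1 \<in> bits n \<and> next_in_order n x (arr n s' 1)"
  proof (cases "i = 0")
    case True
    have "x = replicate (Suc (k - 1)) 1 @ replicate m 0" unfolding x(1)[symmetric]
      by (rule nth_equalityI) (use i X True in \<open>auto simp: arr_nth nth_append m_def\<close>)
    moreover have "arr n s' 1 = replicate (Suc m) 0 @ replicate (k - 1) 1"
      by (rule nth_equalityI) (use i Y True in \<open>auto simp: arr_nth nth_append nth_Cons' m_def\<close>)
    moreover have "arr n s' 1 \<in> bits n"
      by (intro bitsI) (use Y(3) True in \<open>auto simp: arr_nth\<close>)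
    ultimately show ?thesis using next_lower_weight x(2) by metis
  next
    case False
    define \<alpha> where "\<alpha> = map (\<lambda>j. s (Cell 1 (Suc j))) [0..<i - 1]"
    have la: "length \<alpha> = i - 1" by (simp add: \<alpha>_def)
    have "x = \<alpha> @ 0 # replicate (Suc (k - 1)) 1 @ replicate m 0" unfolding x(1)[symmetric]
    proof (rule nth_equalityI)
      show "length (arr n s 1) = length (\<alpha> @ 0 # replicate (Suc (k - 1)) 1 @ replicate m 0)"
        using i False by (simp add: \<alpha>_def m_def)
      fix l assume "l < length (arr n s 1)"
      then have l: "l < n" by simp
      consider "Suc l < i" | "Suc l = i" | "i < Suc l" "Suc l \<le> i + k" | "i + k < Suc l" by linarith
      then show "arr n s 1 ! l = (\<alpha> @ 0 # replicate (Suc (k - 1)) 1 @ replicate m 0) ! l"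
      proof cases
        case 1
        then have "l < i - 1" by simp
        then show ?thesis using l by (simp add: arr_nth nth_append \<alpha>_def)
      next
        case 2 then show ?thesis using l X(1) la by (auto simp: arr_nth nth_append)
      next
        case 3
        then have "l - (i - 1) = Suc (l - i)" "l - i < k" using False by auto
        then show ?thesis using l X(2)[of "Suc l"] la i 3 by (auto simp: arr_nth nth_append nth_Cons')
      next
        case 4
        then have "l - (i - 1) = Suc (l - i)" "\<not> l - i < k" "l - i - k < m" using False l by (auto simp: m_def)
        then show ?thesis using l X(3)[of "Suc l"] la i 4 by (auto simp: arr_nth nth_append nth_Cons')
      qed
    qed
    moreover have "arr n s' 1 = \<alpha> @ 1 # replicate (Suc m) 0 @ replicate (k - 1) 1"
    proof (rule nth_equalityI)
      show "length (arr n s' 1) = length (\<alpha> @ 1 # replicate (Suc m) 0 @ replicate (k - 1) 1)"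
        using i False by (simp add: \<alpha>_def m_def)
      fix l assume "l < length (arr n s' 1)"
      then have l: "l < n" by simp
      consider "Suc l < i" | "Suc l = i" | "i < Suc l" "Suc l \<le> n - (k - 1)" | "i < Suc l" "n - (k - 1) < Suc l" by linarith
      then show "arr n s' 1 ! l = (\<alpha> @ 1 # replicate (Suc m) 0 @ replicate (k - 1) 1) ! l"
      proof cases
        case 1
        then have "l < i - 1" by simp
        then show ?thesis using l 1 Y(1)[of "Suc l"] by (simp add: arr_nth nth_append \<alpha>_def)
      next
        case 2 then show ?thesis using l Y(2) la by (auto simp: arr_nth nth_append)
      next
        case 3
        then have "l - (i - 1) = Suc (l - i)" "l - i < Suc m" using False i by (auto simp: m_def)
        then show ?thesis using l Y(3)[of "Suc l"] la i 3 by (auto simp: arr_nth nth_append nth_Cons')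
      next
        case 4
        then have "l - (i - 1) = Suc (l - i)" "\<not> l - i < Suc m" "l - i - Suc m < k - 1"
          using False l i by (auto simp: m_def)
        then show ?thesis using l Y(3)[of "Suc l"] la i 4 by (auto simp: arr_nth nth_append nth_Cons')
      qed
    qed
    moreover have "arr n s' 1 \<in> bits n"
    proof (rule bitsI)
      fix l assume l: "l < n"
      consider "Suc l < i" | "Suc l = i" | "i < Suc l" by linarith
      then show "arr n s' 1 ! l = 0 \<or> arr n s' 1 ! l = 1"
      proof cases
        case 1
        then show ?thesis using l Y(1)[of "Suc l"] bitsD(2)[OF x(2) l] x(1) arr_nth[OF l, of s 1] arr_nth[OF l, of s' 1] by simp
      next
        case 2 then show ?thesis using l Y(2) by (auto simp: arr_nth)
      next
        case 3 then show ?thesis using l Y(3)[of "Suc l"] by (auto simp: arr_nth)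
      qed
    qed simp
    ultimately show ?thesis using next_same_weight[OF _ x(2)] by metis
  qed
  then show "arr n s' 1 \<in> bits n" "next_in_order n x (arr n s' 1)" by auto
qed

text \<open>\<open>1 \<le> wt x\<close> stops the scan over trailing zeros, and the sentinel stops
  the scan over ones.\<close>

lemma next_com:
  assumes s0: "s (Scalar 0) = n" and n: "1 \<le> n" and x: "arr n s 1 = x" "x \<in> bits n" "1 \<le> wt x"
    and c0: "s (Cell 1 0) = 0"
  shows "H n next_com s (70 * n) (\<lambda>s'. arr n s' 1 \<in> bits n \<and> next_in_order n x (arr n s' 1) \<and> s' (Cell 1 0) = 0 \<and>
     same ({Scalar 1, Scalar 4, Scalar 9} \<union> {Cell 1 j | j. j \<le> n}) s s')"
proof -
  let ?W = "{Scalar 1, Scalar 4, Scalar 9} \<union> {Cell 1 j | j. j \<le> n}"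
  let ?post = "\<lambda>s'. arr n s' 1 \<in> bits n \<and> next_in_order n x (arr n s' 1) \<and> s' (Cell 1 0) = 0 \<and> same ?W s s'"
  define X where "X j = s (Cell 1 j)" for j
  have Xbit: "X j = 0 \<or> X j = 1" if "j \<le> n" for j
    using that c0 bitsD(2)[OF x(2), of "j - 1"] x(1) arr_nth[of "j - 1" n s 1] by (cases j) (auto simp: X_def)
  obtain t where t: "1 \<le> t" "t \<le> n" "X t \<noteq> 0"
  proof -
    have "x \<noteq> replicate n 0" using x(3) by auto
    then obtain l where "l < n" "x ! l \<noteq> 0" using bitsD(1)[OF x(2)] by (metis length_replicate nth_equalityI nth_replicate)
    then show ?thesis using that[of "Suc l"] x(1) by (auto simp: X_def arr_nth)
  qed
  have loop1: "H n (While (Op Eq (Elem 1 (Var 1)) (Const 0)) (dec 1)) (s(Scalar 1 := n, Scalar 4 := 0)) (9 * n + 5)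
     (\<lambda>s'. \<exists>i. s' = s(Scalar 4 := 0, Scalar 1 := i) \<and> 1 \<le> i \<and> i \<le> n \<and> X i = 1 \<and> (\<forall>j. i < j \<and> j \<le> n \<longrightarrow> X j = 0))"
  proof (rule H_For[where C = 4 and f = "\<lambda>s'. s' (Scalar 1)" and F = n and
        I = "\<lambda>s'. \<exists>i. s' = s(Scalar 4 := 0, Scalar 1 := i) \<and> t \<le> i \<and> i \<le> n \<and> (\<forall>j. i < j \<and> j \<le> n \<longrightarrow> X j = 0)"])
    show "\<exists>i. s(Scalar 1 := n, Scalar 4 := 0) = s(Scalar 4 := 0, Scalar 1 := i) \<and> t \<le> i \<and> i \<le> n \<and> (\<forall>j. i < j \<and> j \<le> n \<longrightarrow> X j = 0)"
      using t by (intro exI[of _ n]) auto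
  next
    fix s' assume "\<exists>i. s' = s(Scalar 4 := 0, Scalar 1 := i) \<and> t \<le> i \<and> i \<le> n \<and> (\<forall>j. i < j \<and> j \<le> n \<longrightarrow> X j = 0)"
    then obtain i where i: "s' = s(Scalar 4 := 0, Scalar 1 := i)" "t \<le> i" "i \<le> n" "\<forall>j. i < j \<and> j \<le> n \<longrightarrow> X j = 0" by blast
    show "okE n (Op Eq (Elem 1 (Var 1)) (Const 0)) s'" using i by simp
    { assume "eval (Op Eq (Elem 1 (Var 1)) (Const 0)) s' = 0"
      then have "X i = 1" using i Xbit[of i] by (auto simp: X_def split: if_splits)
      then show "\<exists>i. s' = s(Scalar 4 := 0, Scalar 1 := i) \<and> 1 \<le> i \<and> i \<le> n \<and> X i = 1 \<and> (\<forall>j. i < j \<and> j \<le> n \<longrightarrow> X j = 0)"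
        using i t by (intro exI[of _ i]) auto }
    { assume "eval (Op Eq (Elem 1 (Var 1)) (Const 0)) s' \<noteq> 0"
      then have X0: "X i = 0" using i by (auto simp: X_def split: if_splits)
      then have ti: "t < i" using i t by (cases "t = i") auto
      have "\<forall>j. i - 1 < j \<and> j \<le> n \<longrightarrow> X j = 0"
      proof (intro allI impI)
        fix j assume "i - 1 < j \<and> j \<le> n"
        then show "X j = 0" using X0 i(4) by (cases "j = i") auto
      qed
      then show "H n (dec 1) s' 4 (\<lambda>s''. (\<exists>i. s'' = s(Scalar 4 := 0, Scalar 1 := i) \<and> t \<le> i \<and> i \<le> n \<and> (\<forall>j. i < j \<and> j \<le> n \<longrightarrow> X j = 0))
          \<and> s'' (Scalar 1) < s' (Scalar 1))"
        using i ti by (intro H_Assign) (auto intro!: exI[of _ "i - 1"]) }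
  qed auto
  have loop2: "H n (While (Elem 1 (Var 1)) (Seq (dec 1) (inc 4))) (s(Scalar 4 := 0, Scalar 1 := i0)) (11 * n + 3)
     (\<lambda>s'. \<exists>i k. s' = s(Scalar 4 := k, Scalar 1 := i) \<and> i + k = i0 \<and> 1 \<le> k \<and> X i = 0 \<and> (\<forall>j. i < j \<and> j \<le> i0 \<longrightarrow> X j = 1))"
    if i0: "i0 \<le> n" "X i0 = 1" for i0
  proof (rule H_For[where C = 8 and f = "\<lambda>s'. s' (Scalar 1)" and F = n and
        I = "\<lambda>s'. \<exists>i k. s' = s(Scalar 4 := k, Scalar 1 := i) \<and> i + k = i0 \<and> (\<forall>j. i < j \<and> j \<le> i0 \<longrightarrow> X j = 1)"])
    show "\<exists>i k. s(Scalar 4 := 0, Scalar 1 := i0) = s(Scalar 4 := k, Scalar 1 := i) \<and> i + k = i0 \<and> (\<forall>j. i < j \<and> j \<le> i0 \<longrightarrow> X j = 1)"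
      by (intro exI[of _ i0] exI[of _ 0]) auto
  next
    fix s' assume "\<exists>i k. s' = s(Scalar 4 := k, Scalar 1 := i) \<and> i + k = i0 \<and> (\<forall>j. i < j \<and> j \<le> i0 \<longrightarrow> X j = 1)"
    then obtain i k where i: "s' = s(Scalar 4 := k, Scalar 1 := i)" "i + k = i0" "\<forall>j. i < j \<and> j \<le> i0 \<longrightarrow> X j = 1" by blast
    show "okE n (Elem 1 (Var 1)) s'" using i i0 by simp
    { assume "eval (Elem 1 (Var 1)) s' = 0"
      then have "X i = 0" using i by (simp add: X_def)
      moreover from this have "k \<noteq> 0" using i(2) i0(2) by (cases k) auto
      ultimately show "\<exists>i k. s' = s(Scalar 4 := k, Scalar 1 := i) \<and> i + k = i0 \<and> 1 \<le> k \<and> X i = 0 \<and> (\<forall>j. i < j \<and> j \<le> i0 \<longrightarrow> X j = 1)"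
        using i by (intro exI[of _ i] exI[of _ k]) auto }
    { assume "eval (Elem 1 (Var 1)) s' \<noteq> 0"
      then have X1: "X i = 1" using i i0 Xbit[of i] by (auto simp: X_def)
      then have ti: "0 < i" using c0 by (cases i) (auto simp: X_def)
      have ones: "\<forall>j. i - 1 < j \<and> j \<le> i0 \<longrightarrow> X j = 1"
      proof (intro allI impI)
        fix j assume "i - 1 < j \<and> j \<le> i0"
        then show "X j = 1" using X1 i(3) by (cases "j = i") auto
      qed
      show "H n (Seq (dec 1) (inc 4)) s' 8 (\<lambda>s''. (\<exists>i k. s'' = s(Scalar 4 := k, Scalar 1 := i) \<and> i + k = i0 \<and> (\<forall>j. i < j \<and> j \<le> i0 \<longrightarrow> X j = 1))
          \<and> s'' (Scalar 1) < s' (Scalar 1))"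
      proof (intro H_SA[where ?T2.0 = 4] H_Assign)
        let ?s1 = "s'(Scalar 1 := eval (subE (Var 1) (Const 1)) s')"
        let ?s2 = "?s1(Scalar 4 := eval (addE (Var 4) (Const 1)) ?s1)"
        have s2: "?s2 = s(Scalar 4 := k + 1, Scalar 1 := i - 1)" using i by auto
        have sum: "i - 1 + (k + 1) = i0" using i ti by simp
        show "(\<exists>i k. ?s2 = s(Scalar 4 := k, Scalar 1 := i) \<and> i + k = i0 \<and> (\<forall>j. i < j \<and> j \<le> i0 \<longrightarrow> X j = 1))
           \<and> ?s2 (Scalar 1) < s' (Scalar 1)"
        proof
          show "\<exists>i k. ?s2 = s(Scalar 4 := k, Scalar 1 := i) \<and> i + k = i0 \<and> (\<forall>j. i < j \<and> j \<le> i0 \<longrightarrow> X j = 1)"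
            using s2 sum ones by blast
          show "?s2 (Scalar 1) < s' (Scalar 1)" unfolding s2 using i ti by simp
        qed
      qed (use i i0 in auto) }
  qed (use i0 in auto)
  have loop3: "H n refill_com (s(Scalar 4 := k, Scalar 1 := i, Cell 1 i := 1, Scalar 9 := n)) (19 * n + 4)
     (\<lambda>s'. same ?W s s' \<and> (\<forall>l\<le>n. s' (Cell 1 l) = (if l < i then X l else if l = i then 1 else if n - (k - 1) < l then 1 else 0)))"
    if ik: "i + k \<le> n" "1 \<le> k" for i k
  proof -
    \<comment> \<open>Register \<open>4\<close> holds one more than the number of ones still to be
      placed, because one of the \<open>k\<close> ones has moved to cell \<open>i\<close>; it rests
      at \<open>1\<close> afterwards.\<close>
    define I where "I s' \<longleftrightarrow> same ?W s s' \<and> s' (Scalar 1) = i \<and> i \<le> s' (Scalar 9) \<and> s' (Scalar 9) \<le> n \<and>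
       s' (Scalar 4) = max 1 (k - (n - s' (Scalar 9))) \<and>
       (\<forall>l\<le>n. s' (Cell 1 l) = (if s' (Scalar 9) < l then (if n - (k - 1) < l then 1 else 0) else if l = i then 1 else X l))" for s'
    show ?thesis
    proof (rule H_For[where I = I and C = 15 and f = "\<lambda>s'. s' (Scalar 9)" and F = n])
      show "I (s(Scalar 4 := k, Scalar 1 := i, Cell 1 i := 1, Scalar 9 := n))"
        using ik by (auto simp: I_def same_def X_def)
    next
      fix s' assume Is: "I s'"
      show "okE n (Op Lt (Var 1) (Var 9)) s'" by simp
      { assume "eval (Op Lt (Var 1) (Var 9)) s' = 0"
        then have "s' (Scalar 9) = i" using Is by (auto simp: I_def split: if_splits)
        then show "same ?W s s' \<and> (\<forall>l\<le>n. s' (Cell 1 l) = (if l < i then X l else if l = i then 1 else if n - (k - 1) < l then 1 else 0))"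
          using Is by (auto simp: I_def) }
      { assume "eval (Op Lt (Var 1) (Var 9)) s' \<noteq> 0"
        then have j: "i < s' (Scalar 9)" "s' (Scalar 9) \<le> n" using Is by (auto simp: I_def split: if_splits)
        define j where "j = s' (Scalar 9)"
        show "H n (Seq (Cond (Op Lt (Const 1) (Var 4)) (Seq (Update 1 (Var 9) (Const 1)) (dec 4)) (Update 1 (Var 9) (Const 0)))
          (dec 9)) s' 15 (\<lambda>s''. I s'' \<and> s'' (Scalar 9) < s' (Scalar 9))"
        proof (rule H_SS[where ?T1.0 = 11 and ?T2.0 = 4 and ?R1.0 = "\<lambda>s''. s'' (Scalar 9) = j \<and> I (s''(Scalar 9 := j - 1))"], rule H_Cond[where T' = 7])
          assume "eval (Op Lt (Const 1) (Var 4)) s' \<noteq> 0"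
          then have "n - j < k - 1" using Is by (auto simp: I_def j_def split: if_splits)
          then have "n - (k - 1) < j" "max 1 (k - (n - j)) - 1 = max 1 (k - (n - (j - 1)))" using ik j by (auto simp: j_def)
          then show "H n (Seq (Update 1 (Var 9) (Const 1)) (dec 4)) s' 7 (\<lambda>s''. s'' (Scalar 9) = j \<and> I (s''(Scalar 9 := j - 1)))"
            using Is j by (intro H_SU[where ?T2.0 = 4] H_Assign) (auto simp: I_def same_def j_def)
        next
          assume "eval (Op Lt (Const 1) (Var 4)) s' = 0"
          then have "\<not> n - j < k - 1" using Is by (auto simp: I_def j_def split: if_splits)
          then have "\<not> n - (k - 1) < j" "max 1 (k - (n - j)) = max 1 (k - (n - (j - 1)))" using ik j by (auto simp: j_def)
          then show "H n (Update 1 (Var 9) (Const 0)) s' 7 (\<lambda>s''. s'' (Scalar 9) = j \<and> I (s''(Scalar 9 := j - 1)))"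
            using Is j by (intro H_Update) (auto simp: I_def same_def j_def)
        next
          fix s'' assume "s'' (Scalar 9) = j \<and> I (s''(Scalar 9 := j - 1))"
          then show "H n (dec 9) s'' 4 (\<lambda>s''. I s'' \<and> s'' (Scalar 9) < s' (Scalar 9))"
            using j by (intro H_Assign) (auto simp: j_def)
        qed auto }
    qed (use ik in auto)
  qed
  show ?thesis unfolding next_com_def
  proof (rule H_SA[where ?T2.0 = "39 * n + 22"], simp, simp, rule H_SA[where ?T2.0 = "39 * n + 20"], simp, simp,
      rule H_SS[where ?T1.0 = "9 * n + 5" and ?T2.0 = "30 * n + 15"])
    show "H n (While (Op Eq (Elem 1 (Var 1)) (Const 0)) (dec 1))
     (s(Scalar 1 := eval (Var 0) s, Scalar 4 := eval (Const 0) (s(Scalar 1 := eval (Var 0) s)))) (9 * n + 5)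
     (\<lambda>s'. \<exists>i. s' = s(Scalar 4 := 0, Scalar 1 := i) \<and> 1 \<le> i \<and> i \<le> n \<and> X i = 1 \<and> (\<forall>j. i < j \<and> j \<le> n \<longrightarrow> X j = 0))"
      using loop1 s0 by simp
  next
    fix s' assume "\<exists>i. s' = s(Scalar 4 := 0, Scalar 1 := i) \<and> 1 \<le> i \<and> i \<le> n \<and> X i = 1 \<and> (\<forall>j. i < j \<and> j \<le> n \<longrightarrow> X j = 0)"
    then obtain i0 where i0: "s' = s(Scalar 4 := 0, Scalar 1 := i0)" "i0 \<le> n" "X i0 = 1" "\<forall>j. i0 < j \<and> j \<le> n \<longrightarrow> X j = 0" by blast
    show "H n (Seq (While (Elem 1 (Var 1)) (Seq (dec 1) (inc 4))) (Seq
     (Update 1 (Var 1) (Const 1)) (Seq (Assign 9 (Var 0)) (Seq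
     refill_com
     (Update 1 (Const 0) (Const 0)))))) s' (30 * n + 15) ?post"
    proof (rule H_SS[where ?T1.0 = "11 * n + 3" and ?T2.0 = "19 * n + 12"], unfold i0(1), rule loop2[OF i0(2,3)])
      fix s'' assume "\<exists>i k. s'' = s(Scalar 4 := k, Scalar 1 := i) \<and> i + k = i0 \<and> 1 \<le> k \<and> X i = 0 \<and> (\<forall>j. i < j \<and> j \<le> i0 \<longrightarrow> X j = 1)"
      then obtain i k where ik: "s'' = s(Scalar 4 := k, Scalar 1 := i)" "i + k = i0" "1 \<le> k" "X i = 0"
        "\<forall>j. i < j \<and> j \<le> i0 \<longrightarrow> X j = 1" by blast
      have ikn: "i + k \<le> n" using ik i0 by simp
      show "H n (Seq (Update 1 (Var 1) (Const 1)) (Seq (Assign 9 (Var 0)) (Seq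
         refill_com
         (Update 1 (Const 0) (Const 0))))) s'' (19 * n + 12) ?post"
      proof (rule H_SU[where ?T2.0 = "19 * n + 9"], simp, simp, simp, (use ik ikn in simp),
          rule H_SA[where ?T2.0 = "19 * n + 7"], simp, simp, rule H_SS[where ?T1.0 = "19 * n + 4" and ?T2.0 = 3])
        let ?s1 = "s''(Cell 1 (eval (Var 1) s'') := eval (Const 1) s'')"
        have "?s1(Scalar 9 := eval (Var 0) ?s1) = s(Scalar 4 := k, Scalar 1 := i, Cell 1 i := 1, Scalar 9 := n)"
          using ik s0 by simp
        then show "H n refill_com (?s1(Scalar 9 := eval (Var 0) ?s1)) (19 * n + 4)
           (\<lambda>s'. same ?W s s' \<and> (\<forall>l\<le>n. s' (Cell 1 l) = (if l < i then X l else if l = i then 1 else if n - (k - 1) < l then 1 else 0)))"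
          using loop3[OF ikn ik(3)] by simp
      next
        fix s3 assume s3: "same ?W s s3 \<and> (\<forall>l\<le>n. s3 (Cell 1 l) = (if l < i then X l else if l = i then 1 else if n - (k - 1) < l then 1 else 0))"
        \<comment> \<open>The sentinel is restored, since it has received the moved one if
          \<open>i = 0\<close>.\<close>
        define s4 where "s4 = s3(Cell 1 0 := 0)"
        have X1: "s (Cell 1 i) = 0" using ik(4) by (simp add: X_def)
        have X2: "s (Cell 1 j) = 1" if "i < j" "j \<le> i + k" for j
          using ik(2,5) that by (simp add: X_def)
        have X3: "s (Cell 1 j) = 0" if "i + k < j" "j \<le> n" for j
          using ik(2) i0(4) that by (simp add: X_def)
        have Y1: "s4 (Cell 1 j) = s (Cell 1 j)" if "1 \<le> j" "j < i" for j
          using s3 that ikn by (simp add: s4_def X_def)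
        have Y2: "s4 (Cell 1 i) = 1" if "1 \<le> i" using s3 that ikn by (simp add: s4_def)
        have Y3: "s4 (Cell 1 j) = (if n - (k - 1) < j then 1 else 0)" if "i < j" "j \<le> n" for j
          using s3 that ikn by (simp add: s4_def)
        note nl = next_list[OF x(1,2) ikn ik(3) X1 X2 X3 Y1 Y2 Y3]
        have "arr n s4 1 \<in> bits n \<and> next_in_order n x (arr n s4 1)"
          by (rule conjI; rule nl; assumption)
        moreover have "same ?W s s4" using s3 by (auto simp: same_def s4_def)
        ultimately show "H n (Update 1 (Const 0) (Const 0)) s3 3 ?post"
          by (intro H_Update) (auto simp: s4_def)
      qed auto
    qed auto
  qed (use n in auto)
qed

section \<open>Initialisation: the last class and the excess\<close>

definition fill_com :: com where
  "fill_com = Seq (Assign 1 (Const 1)) (up_to_n (Update 1 (Var 1) (Const 1)))"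

lemma fill_com:
  assumes s0: "s (Scalar 0) = n" and n: "1 \<le> n"
  shows "H n fill_com s (30 * n) (\<lambda>s'. arr n s' 1 = replicate n 1 \<and>
     same ({Scalar 1} \<union> {Cell 1 j | j. 1 \<le> j \<and> j \<le> n}) s s')"
proof -
  define I where "I s' \<longleftrightarrow> same ({Scalar 1} \<union> {Cell 1 j | j. 1 \<le> j \<and> j \<le> n}) s s' \<and>
     1 \<le> s' (Scalar 1) \<and> s' (Scalar 1) \<le> n + 1 \<and> (\<forall>j. 1 \<le> j \<and> j < s' (Scalar 1) \<longrightarrow> s' (Cell 1 j) = 1)" for s'
  have I0: "s' (Scalar 0) = n" if "I s'" for s' using that s0 by (auto simp: I_def same_def)
  show ?thesis unfolding fill_com_def
  proof (rule H_SA[where ?T2.0 = "13 * n + 6"], simp, simp,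
      rule H_For[where I = I and C = 7 and f = "\<lambda>s'. n + 1 - s' (Scalar 1)" and F = n])
    show "I (s(Scalar 1 := eval (Const 1) s))" using n by (auto simp: I_def same_def)
  next
    fix s' assume Is: "I s'"
    show "okE n in_range s'" using I0[OF Is] by simp
    { assume "eval in_range s' = 0"
      then have "s' (Scalar 1) = n + 1" using Is I0[OF Is] by (auto simp: I_def split: if_splits)
      then have "arr n s' 1 = replicate n 1" using Is by (intro nth_equalityI) (auto simp: I_def arr_nth)
      then show "arr n s' 1 = replicate n 1 \<and> same ({Scalar 1} \<union> {Cell 1 j | j. 1 \<le> j \<and> j \<le> n}) s s'"
        using Is by (simp add: I_def) }
    { assume "eval in_range s' \<noteq> 0"
      then have "s' (Scalar 1) \<le> n" using I0[OF Is] by (auto split: if_splits)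
      then show "H n (Seq (Update 1 (Var 1) (Const 1)) (inc 1)) s' 7
         (\<lambda>s''. I s'' \<and> n + 1 - s'' (Scalar 1) < n + 1 - s' (Scalar 1))"
        using Is by (intro H_SU[where ?T2.0 = 4] H_Assign) (auto simp: I_def same_def less_Suc_eq) }
  qed (use n in auto)
qed

text \<open>The product is a conjunction. Cell \<open>n\<close> is the bit of weight
  \<open>2 ^ n\<close>, which is set exactly when the counter has reached
  \<open>2 ^ n\<close>.\<close>

abbreviation "size_guard \<equiv> Op Mul (Op Lt (Var 3) (Var 2)) (Op Eq (Elem 0 (Var 0)) (Const 0))"

definition size_com :: com where
  "size_com = While size_guard (Seq inc_com (inc 3))"

text \<open>The class size is added by single increments, so that the loop can stop in the middle of
  a class. A count \<open>J < p\<close> then says that the class must be kept, and \<open>J\<close>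
  is the excess.\<close>

lemma size_com:
  assumes s0: "s (Scalar 0) = n" "s (Scalar 2) = p" "s (Scalar 3) = 0" and p: "p \<le> n" and n: "1 \<le> n"
    and c: "ctr n s c" "c \<le> 2 ^ n" and J: "J = min p (2 ^ n - c)"
  shows "H n size_com s (40 * n * J + 9) (\<lambda>s'. ctr n s' (c + J) \<and> s' (Scalar 3) = J \<and>
     same ({Scalar 1, Scalar 3} \<union> {Cell 0 j | j. j \<le> n}) s s')"
proof -
  define I where "I s' \<longleftrightarrow> same ({Scalar 1, Scalar 3} \<union> {Cell 0 j | j. j \<le> n}) s s' \<and>
     s' (Scalar 3) \<le> J \<and> ctr n s' (c + s' (Scalar 3))" for s'
  have I0: "s' (Scalar 0) = n" "s' (Scalar 2) = p" if "I s'" for s' using that s0 by (auto simp: I_def same_def)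
  have guard: "eval size_guard s' = of_bool (s' (Scalar 3) < J)"
    if "I s'" for s'
  proof -
    have le: "c + s' (Scalar 3) \<le> 2 ^ n" using that c J by (auto simp: I_def)
    have b: "s' (Cell 0 n) = (c + s' (Scalar 3)) div 2 ^ n mod 2" using that by (auto simp: I_def ctr_def)
    have "s' (Cell 0 n) = 0 \<longleftrightarrow> c + s' (Scalar 3) < 2 ^ n"
    proof (cases "c + s' (Scalar 3) = 2 ^ n")
      case True then show ?thesis using b by simp
    next
      case False then show ?thesis using b le by simp
    qed
    then show ?thesis using I0[OF that] c J le by auto
  qed
  show ?thesis unfolding size_com_def
  proof (rule H_For[where I = I and C = "20 * n + 4" and f = "\<lambda>s'. J - s' (Scalar 3)" and F = J])
    show "I s" using c s0 by (auto simp: I_def same_def)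
    have "20 * n + 13 \<le> 40 * n" using n by simp
    then have "J * (20 * n + 13) \<le> J * (40 * n)" by (rule mult_le_mono2)
    then show "J * (20 * n + 4 + cost size_guard + 1) +
      cost size_guard + 1 \<le> 40 * n * J + 9"
      by (simp add: algebra_simps)
  next
    fix s' assume Is: "I s'"
    show "okE n size_guard s'" using I0[OF Is] by simp
    { assume "eval size_guard s' = 0"
      then have "s' (Scalar 3) = J" using guard[OF Is] Is by (auto simp: I_def)
      then show "ctr n s' (c + J) \<and> s' (Scalar 3) = J \<and> same ({Scalar 1, Scalar 3} \<union> {Cell 0 j | j. j \<le> n}) s s'"
        using Is by (auto simp: I_def) }
    { assume "eval size_guard s' \<noteq> 0"
      then have lt: "s' (Scalar 3) < J" using guard[OF Is] by (metis of_bool_eq(1))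
      then have cl: "c + s' (Scalar 3) < 2 ^ n" using J by linarith
      have ct: "ctr n s' (c + s' (Scalar 3))" using Is by (simp add: I_def)
      show "H n (Seq inc_com (inc 3)) s' (20 * n + 4) (\<lambda>s''. I s'' \<and> J - s'' (Scalar 3) < J - s' (Scalar 3))"
      proof (rule H_SS[OF inc_com[OF ct cl n], where ?T2.0 = 4])
        fix s2 assume s2: "ctr n s2 (Suc (c + s' (Scalar 3))) \<and> same ({Scalar 1} \<union> {Cell 0 j | j. j \<le> n}) s' s2"
        then have e: "s2 (Scalar 3) = s' (Scalar 3)" by (simp add: same_def)
        have "s' (Scalar 3) + 1 \<le> 2 * n + 2" using lt J p by simp
        then show "H n (inc 3) s2 4 (\<lambda>s''. I s'' \<and> J - s'' (Scalar 3) < J - s' (Scalar 3))"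
          using s2 Is lt e by (intro H_Assign) (auto simp: I_def same_def ctr_def)
      qed simp }
  qed simp_all
qed

definition init_body :: com where
  "init_body = Seq (neck_com 1) (Seq (Assign 3 (Const 0)) (Seq size_com
     (Cond (Op Lt (Var 3) (Var 2)) (Assign 5 (Const 1)) next_com)))"

definition init_com :: com where
  "init_com = Seq fill_com (Seq (Assign 5 (Const 0)) (While (Op Eq (Var 5) (Const 0)) init_body))"

text \<open>When the enumeration arrives at the zero string, only one string is left, too few for
  \<open>2 \<le> L\<close>. So it never has to move on from a string of weight zero.\<close>

lemma remset_zero: assumes "x \<in> bits n" "wt x = 0" shows "2 ^ n - 1 \<le> card (remset n x)"
proof -
  have "bits n - {replicate n 0} \<subseteq> remset n x"
  proof
    fix v assume v: "v \<in> bits n - {replicate n 0}"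
    then have "wt v \<noteq> 0" using wt_zero[of v n] by auto
    then show "v \<in> remset n x" using v assms by (simp add: remset_def bef_def)
  qed
  then have "card (bits n - {replicate n 0}) \<le> card (remset n x)" by (intro card_mono) auto
  moreover have "card (bits n) - 1 \<le> card (bits n - {replicate n 0})"
    using card_Diff1_le[of "bits n" "replicate n 0"] by (simp add: card_Diff_singleton_if)
  ultimately show ?thesis using card_bits[of n] by simp
qed

abbreviation init_W :: "nat \<Rightarrow> loc set" where
  "init_W n \<equiv> {Scalar 1, Scalar 2, Scalar 3, Scalar 4, Scalar 5, Scalar 9} \<union> {Cell 0 j | j. j \<le> n} \<union> {Cell 1 j | j. j \<le> n}"

definition init_inv :: "nat \<Rightarrow> nat \<Rightarrow> store \<Rightarrow> store \<Rightarrow> bool" where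
  "init_inv n L s s' \<longleftrightarrow> same (init_W n) s s' \<and> s' (Cell 1 0) = 0 \<and> arr n s' 1 \<in> bits n"

definition init_run :: "nat \<Rightarrow> nat \<Rightarrow> store \<Rightarrow> bool" where
  "init_run n L s' \<longleftrightarrow> s' (Scalar 5) = 0 \<and> ctr n s' (L + card (remset n (arr n s' 1))) \<and>
     L + card (remset n (arr n s' 1)) \<le> 2 ^ n"

text \<open>The kept strings number \<open>2 ^ n - card (remset n N)\<close>, so register
  \<open>3\<close> is the number of strings still to be cut out.\<close>

definition init_done :: "nat \<Rightarrow> nat \<Rightarrow> store \<Rightarrow> bool" where
  "init_done n L s' \<longleftrightarrow> s' (Scalar 5) = 1 \<and> s' (Scalar 3) < n \<and>
     L + card (remset n (arr n s' 1)) + s' (Scalar 3) = 2 ^ n"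

text \<open>Each string not yet passed pays for its test and for finding the next one, each
  remaining increment pays for itself. The increments need not be distributed evenly over the
  strings, but all of them together are fewer than \<open>2 ^ n\<close>.\<close>

definition init_pot :: "nat \<Rightarrow> nat \<Rightarrow> store \<Rightarrow> nat" where
  "init_pot n L s' = 150 * n * card {y \<in> bits n. \<not> bef y (arr n s' 1)} + 40 * n * (2 ^ n - (L + card (remset n (arr n s' 1))))"

lemma init_body:
  assumes s0: "s (Scalar 0) = n" and n: "1 \<le> n" and L: "2 ^ (n - 1) < L"
    and inv: "init_inv n L s s'" "init_run n L s'"
  shows "\<exists>Tb. H n init_body s' Tb (\<lambda>s''. \<exists>\<phi>. (init_inv n L s s'' \<and>
     (init_done n L s'' \<or> init_run n L s'' \<and> \<phi> = init_pot n L s'')) \<and> Tb + 4 + \<phi> \<le> init_pot n L s')"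
proof -
  define x where "x = arr n s' 1"
  define c where "c = L + card (remset n x)"
  have x: "x \<in> bits n" and same: "same (init_W n) s s'" and c10: "s' (Cell 1 0) = 0" and sn: "s' (Scalar 0) = n"
    using inv(1) s0 by (auto simp: init_inv_def x_def same_def)
  have c: "ctr n s' c" "c \<le> 2 ^ n" and s5: "s' (Scalar 5) = 0" using inv(2) by (auto simp: init_run_def c_def x_def)
  have wtx: "1 \<le> wt x"
  proof (rule ccontr)
    assume "\<not> 1 \<le> wt x"
    then have "2 ^ n - 1 \<le> card (remset n x)" using remset_zero[OF x] by simp
    moreover have "2 \<le> L"
    proof -
      have "(1::nat) \<le> 2 ^ (n - 1)" by simp
      then show ?thesis using L by linarith
    qed
    moreover have "(1::nat) \<le> 2 ^ n" by simp
    ultimately show False using c(2) unfolding c_def by linarith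
  qed
  define p where "p = (if neck x then card {v. \<exists>k. v = rotate k x} else 0)"
  define J where "J = min p (2 ^ n - c)"
  define K where "K = card {y \<in> bits n. \<not> bef y x}"
  have fin: "finite {y \<in> bits n. \<not> bef y x}" by simp
  have xK: "x \<in> {y \<in> bits n. \<not> bef y x}" using x by (simp add: bef_def)
  then have K1: "1 \<le> K" unfolding K_def using fin by (metis One_nat_def Suc_leI card_gt_0_iff empty_iff)
  \<comment> \<open>The term with \<open>J\<close> is paid by the increments, the other one by
    passing \<open>x\<close>; the slack up to \<open>150 * n\<close> covers the guard of the
    loop.\<close>
  let ?Tb = "140 * n + 40 * n * J"
  let ?R = "\<lambda>s''. \<exists>\<phi>. (init_inv n L s s'' \<and> (init_done n L s'' \<or> init_run n L s'' \<and> \<phi> = init_pot n L s''))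
     \<and> ?Tb + 4 + \<phi> \<le> init_pot n L s'"
  have pot: "init_pot n L s' = 150 * n * K + 40 * n * (2 ^ n - c)" by (simp add: init_pot_def K_def c_def x_def)
  have n150: "150 * n \<le> 150 * n * K" using K1 by (metis mult.right_neutral mult_le_mono2)
  have "H n init_body s' ?Tb ?R"
    unfolding init_body_def
  proof (rule H_SS[OF neck_com[OF sn n _ x_def[symmetric] x], where ?T2.0 = "90 * n + 40 * n * J"], simp)
    fix s1 assume "same {Scalar 1, Scalar 2} s' s1 \<and> (if neck x then 0 < s1 (Scalar 2) \<and> s1 (Scalar 2) \<le> n
        \<and> card {v. \<exists>k. v = rotate k x} = s1 (Scalar 2) else s1 (Scalar 2) = 0)"
    then have s1: "same {Scalar 1, Scalar 2} s' s1" "s1 (Scalar 2) = p" "p \<le> n" "neck x \<Longrightarrow> 0 < p"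
      by (auto simp: p_def split: if_splits)
    define s2 where "s2 = s1(Scalar 3 := 0)"
    have s2: "s2 (Scalar 0) = n" "s2 (Scalar 2) = p" "s2 (Scalar 3) = 0" "ctr n s2 c"
      using s1 sn c by (auto simp: s2_def same_def ctr_def)
    show "H n (Seq (Assign 3 (Const 0)) (Seq size_com (Cond (Op Lt (Var 3) (Var 2)) (Assign 5 (Const 1)) next_com))) s1
       (90 * n + 40 * n * J) ?R"
    proof (rule H_SA[where ?T2.0 = "90 * n + 40 * n * J - 2"], simp, simp)
      show "H n (Seq size_com (Cond (Op Lt (Var 3) (Var 2)) (Assign 5 (Const 1)) next_com)) (s1(Scalar 3 := eval (Const 0) s1))
         (90 * n + 40 * n * J - 2) ?R"
        unfolding eval.simps s2_def[symmetric]
      proof (rule H_SS[OF size_com[OF s2(1-3) s1(3) n s2(4) c(2) J_def], where ?T2.0 = "90 * n - 11"])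
        fix s3 assume s3: "ctr n s3 (c + J) \<and> s3 (Scalar 3) = J \<and> same ({Scalar 1, Scalar 3} \<union> {Cell 0 j | j. j \<le> n}) s2 s3"
        have a3: "arr n s3 1 = x" unfolding x_def
          by (rule arr_cong) (use s3 s1 in \<open>auto simp: same_def s2_def\<close>)
        have f3: "s3 (Scalar 0) = n" "s3 (Scalar 2) = p" "s3 (Cell 1 0) = 0" "s3 (Scalar 5) = 0"
          using s3 s2 s1 c10 s5 by (auto simp: same_def s2_def)
        have same3: "same (init_W n) s s3" using same s1(1) s3 by (auto simp: same_def s2_def)
        show "H n (Cond (Op Lt (Var 3) (Var 2)) (Assign 5 (Const 1)) next_com) s3 (90 * n - 11) ?R"
        proof (rule H_Cond[where T' = "70 * n"])
          assume "eval (Op Lt (Var 3) (Var 2)) s3 \<noteq> 0"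
          \<comment> \<open>The counter was full before the class was exhausted; since a class has
            at most \<open>n\<close> members, the excess is below \<open>n\<close>.\<close>
          then have "J < p" using s3 f3 by (auto split: if_splits)
          then have J: "J = 2 ^ n - c" "J < n" using s1(3) by (auto simp: J_def)
          define s4 where "s4 = s3(Scalar 5 := 1)"
          have a4: "arr n s4 1 = x" using a3 by (simp add: arr_def s4_def)
          have "init_inv n L s s4" using same3 f3 x a4 by (auto simp: init_inv_def same_def s4_def)
          moreover have "init_done n L s4" using J s3 a4 c(2) unfolding init_done_def c_def by (simp add: s4_def)
          moreover have "?Tb + 4 + 0 \<le> init_pot n L s'" unfolding pot J(1)[symmetric] using n150 n by linarith
          ultimately have R4: "?R s4" by blast
          show "H n (Assign 5 (Const 1)) s3 (70 * n) ?R"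
          proof (rule H_Assign)
            show "?R (s3(Scalar 5 := eval (Const 1) s3))" using R4 unfolding s4_def eval.simps .
          qed (use n in simp_all)
        next
          assume "eval (Op Lt (Var 3) (Var 2)) s3 = 0"
          then have "J = p" using s3 f3 by (auto simp: J_def split: if_splits)
          then have cp: "c + p \<le> 2 ^ n" using c(2) by (simp add: J_def)
          show "H n next_com s3 (70 * n) ?R"
          proof (rule H_conseq[OF next_com[OF f3(1) n a3 x wtx f3(3)] le_refl])
            fix s4 assume s4: "arr n s4 1 \<in> bits n \<and> next_in_order n x (arr n s4 1) \<and> s4 (Cell 1 0) = 0 \<and>
              same ({Scalar 1, Scalar 4, Scalar 9} \<union> {Cell 1 j | j. j \<le> n}) s3 s4"
            define x' where "x' = arr n s4 1"
            have nx: "next_in_order n x x'" using s4 by (simp add: x'_def)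
            have "card (remset n x') = card (remset n x) + card {v \<in> bits n. nk v = x}"
              unfolding remset_next(1)[OF x nx] by (rule card_Un_disjoint) (use remset_next(2)[OF x nx] in auto)
            also have "card {v \<in> bits n. nk v = x} = p" unfolding nk_class[OF x] by (simp add: p_def)
            finally have cr: "L + card (remset n x') = c + p" by (simp add: c_def)
            have "{y \<in> bits n. \<not> bef y x'} = {y \<in> bits n. \<not> bef y x} - {x}"
              using nx unfolding next_in_order_def by blast
            then have K': "card {y \<in> bits n. \<not> bef y x'} = K - 1"
              using card_Diff_singleton[OF xK] by (simp add: K_def)
            have i: "init_inv n L s s4" using same3 s4 by (auto simp: init_inv_def same_def)
            moreover have "init_run n L s4" unfolding init_run_def x'_def[symmetric] cr
              using s4 s3 f3 cp \<open>J = p\<close> by (auto simp: same_def ctr_def)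
            moreover have "?Tb + 4 + init_pot n L s4 \<le> init_pot n L s'"
            proof -
              have p4: "init_pot n L s4 = 150 * n * (K - 1) + 40 * n * (2 ^ n - (c + p))"
                unfolding init_pot_def x'_def[symmetric] cr K' ..
              have "150 * n * (K - 1) + 150 * n = 150 * n * K" using K1 by (cases K) auto
              moreover have "40 * n * (2 ^ n - (c + p)) + 40 * n * p = 40 * n * (2 ^ n - c)"
                using cp by (simp add: distrib_left[symmetric])
              ultimately show ?thesis unfolding pot p4 \<open>J = p\<close> using n by linarith
            qed
            ultimately show "?R s4" by blast
          qed
        qed (use n in auto)
      qed (use n in auto)
    qed (use n in auto)
  qed (use n in auto)
  then show ?thesis by blast
qed

lemma init_com:
  assumes s0: "s (Scalar 0) = n" and n: "1 \<le> n" and L: "2 ^ (n - 1) < L" "L \<le> 2 ^ n"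
    and c: "ctr n s L" and c10: "s (Cell 1 0) = 0"
  shows "H n init_com s (240 * n * 2 ^ n) (\<lambda>s'. same (init_W n) s s' \<and> arr n s' 1 \<in> bits n \<and> init_done n L s')"
  unfolding init_com_def
proof (rule H_SS[OF fill_com[of s n, OF s0 n], where ?T2.0 = "200 * n * 2 ^ n"])
  fix s1 assume s1: "arr n s1 1 = replicate n 1 \<and> same ({Scalar 1} \<union> {Cell 1 j | j. 1 \<le> j \<and> j \<le> n}) s s1"
  define s2 where "s2 = s1(Scalar 5 := 0)"
  have a2: "arr n s2 1 = replicate n 1" using s1 by (simp add: arr_def s2_def)
  have p1: "(1::nat) \<le> 2 ^ n" by simp
  have "n \<le> n * 2 ^ n" using p1 by (metis mult.right_neutral mult_le_mono2)
  then have np: "1 \<le> n * 2 ^ n" using n by linarith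
  have i2: "init_inv n L s s2"
    using s1 c10 a2 replicate_bits[of 1 n] by (auto simp: init_inv_def same_def s2_def)
  have r2: "init_run n L s2"
    unfolding init_run_def a2 remset_replicate1 using s1 c L by (auto simp: same_def s2_def ctr_def)
  have pot: "init_pot n L s2 \<le> 190 * n * 2 ^ n"
  proof -
    have "card {y \<in> bits n. \<not> bef y (arr n s2 1)} \<le> 2 ^ n"
      unfolding card_bits[symmetric] by (rule card_mono) auto
    then have "150 * n * card {y \<in> bits n. \<not> bef y (arr n s2 1)} \<le> 150 * n * 2 ^ n" by (rule mult_le_mono2)
    moreover have "40 * n * (2 ^ n - (L + card (remset n (arr n s2 1)))) \<le> 40 * n * 2 ^ n" by (rule mult_le_mono2) simp
    ultimately show ?thesis unfolding init_pot_def by linarith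
  qed
  show "H n (Seq (Assign 5 (Const 0)) (While (Op Eq (Var 5) (Const 0)) init_body)) s1 (200 * n * 2 ^ n)
    (\<lambda>s'. same (init_W n) s s' \<and> arr n s' 1 \<in> bits n \<and> init_done n L s')"
  proof (rule H_SA[where ?T2.0 = "190 * n * 2 ^ n + 4"], simp, simp,
      rule H_While[where \<phi> = "init_pot n L s2" and
        I = "\<lambda>\<phi> s'. init_inv n L s s' \<and> (init_done n L s' \<or> init_run n L s' \<and> \<phi> = init_pot n L s')"])
    show "init_inv n L s (s1(Scalar 5 := eval (Const 0) s1)) \<and> (init_done n L (s1(Scalar 5 := eval (Const 0) s1)) \<or>
       init_run n L (s1(Scalar 5 := eval (Const 0) s1)) \<and> init_pot n L s2 = init_pot n L (s1(Scalar 5 := eval (Const 0) s1)))"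
      using i2 r2 by (simp add: s2_def)
  next
    fix \<phi> s' assume A: "init_inv n L s s' \<and> (init_done n L s' \<or> init_run n L s' \<and> \<phi> = init_pot n L s')"
      and "eval (Op Eq (Var 5) (Const 0)) s' = 0"
    then show "same (init_W n) s s' \<and> arr n s' 1 \<in> bits n \<and> init_done n L s'"
      by (auto simp: init_inv_def init_run_def split: if_splits)
  next
    fix \<phi> s' assume A: "init_inv n L s s' \<and> (init_done n L s' \<or> init_run n L s' \<and> \<phi> = init_pot n L s')"
      and "eval (Op Eq (Var 5) (Const 0)) s' \<noteq> 0"
    then have "init_inv n L s s'" "init_run n L s'" "\<phi> = init_pot n L s'"
      by (auto simp: init_done_def split: if_splits)
    then show "\<exists>Tb. H n init_body s' Tb (\<lambda>s''. \<exists>\<phi>'. (init_inv n L s s'' \<and> (init_done n L s'' \<or> init_run n L s'' \<and> \<phi>' = init_pot n L s''))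
       \<and> Tb + cost (Op Eq (Var 5) (Const 0)) + 1 + \<phi>' \<le> \<phi>)"
    proof -
      assume b: "init_inv n L s s'" "init_run n L s'" and \<phi>: "\<phi> = init_pot n L s'"
      have "Tb + cost (Op Eq (Var 5) (Const 0)) + 1 = Tb + 4" for Tb by simp
      then show ?thesis using init_body[of s n L s', OF s0 n L(1) b] \<phi> by presburger
    qed
  next
    show "init_pot n L s2 + cost (Op Eq (Var 5) (Const 0)) + 1 \<le> 190 * n * 2 ^ n + 4" using pot by simp
    show "cost (Const 0) + 1 + (190 * n * 2 ^ n + 4) \<le> 200 * n * 2 ^ n"
    proof -
      have "190 * n * 2 ^ n = 190 * (n * 2 ^ n)" "200 * n * 2 ^ n = 200 * (n * 2 ^ n)" by simp_all
      then show ?thesis using np unfolding cost.simps by linarith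
    qed
  qed simp
next
  show "30 * n + 200 * n * 2 ^ n \<le> 240 * n * 2 ^ n"
  proof -
    have "n * 1 \<le> n * 2 ^ n" by (rule mult_le_mono2) simp
    moreover have "240 * n * 2 ^ n = 240 * (n * 2 ^ n)" "200 * n * 2 ^ n = 200 * (n * 2 ^ n)" by simp_all
    ultimately show ?thesis by linarith
  qed
qed

section \<open>Weights, comparison with \<open>N\<close>, and the window test\<close>

lemma take_bits: "x \<in> bits n \<Longrightarrow> k \<le> n \<Longrightarrow> take k x \<in> bits k"
  unfolding bits_def using set_take_subset[of k x] by (simp add: subset_trans)

definition sum_com :: "nat \<Rightarrow> nat \<Rightarrow> com" where
  "sum_com a d = Seq (Assign d (Const 0)) (Seq (Assign 1 (Const 1))
     (up_to_n (Assign d (addE (Var d) (Elem a (Var 1))))))"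

lemma sum_com:
  assumes s0: "s (Scalar 0) = n" and n: "1 \<le> n" and a: "a < 3" and d: "d < 16" "d \<noteq> 0" "d \<noteq> 1"
    and x: "arr n s a = x" "x \<in> bits n"
  shows "H n (sum_com a d) s (30 * n) (\<lambda>s'. s' (Scalar d) = wt x \<and> same {Scalar 1, Scalar d} s s')"
proof -
  define I where "I s' \<longleftrightarrow> same {Scalar 1, Scalar d} s s' \<and> 1 \<le> s' (Scalar 1) \<and> s' (Scalar 1) \<le> n + 1 \<and>
     s' (Scalar d) = wt (take (s' (Scalar 1) - 1) x)" for s'
  have I0: "s' (Scalar 0) = n" "s' (Cell a i) = s (Cell a i)" if "I s'" for s' i
    using that s0 d by (auto simp: I_def same_def)
  show ?thesis unfolding sum_com_def
  proof (rule H_SA[where ?T2.0 = "15 * n + 8"], simp, rule d(1), rule H_SA[where ?T2.0 = "15 * n + 6"], simp, simp,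
      rule H_For[where I = I and C = 9 and f = "\<lambda>s'. n + 1 - s' (Scalar 1)" and F = n])
    show "I (s(Scalar d := eval (Const 0) s, Scalar 1 := eval (Const 1) (s(Scalar d := eval (Const 0) s))))"
      using n d by (auto simp: I_def same_def)
  next
    fix s' assume Is: "I s'"
    show "okE n in_range s'" using I0[OF Is] by simp
    { assume "eval in_range s' = 0"
      then have "s' (Scalar 1) = n + 1" using Is I0[OF Is] by (auto simp: I_def split: if_splits)
      then show "s' (Scalar d) = wt x \<and> same {Scalar 1, Scalar d} s s'"
        using Is bitsD(1)[OF x(2)] by (simp add: I_def) }
    { assume "eval in_range s' \<noteq> 0"
      then have i: "1 \<le> s' (Scalar 1)" "s' (Scalar 1) \<le> n" using I0[OF Is] Is by (auto simp: I_def split: if_splits)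
      define i where "i = s' (Scalar 1)"
      have xi: "x ! (i - 1) = s' (Cell a i)"
        using x(1) i I0(2)[OF Is] arr_nth[of "i - 1" n s a] by (simp add: i_def)
      have "take i x = take (i - 1) x @ [x ! (i - 1)]"
        using take_Suc_conv_app_nth[of "i - 1" x] bitsD(1)[OF x(2)] i by (simp add: i_def)
      then have w: "wt (take i x) = s' (Scalar d) + s' (Cell a i)" using xi Is by (simp add: I_def i_def)
      have "wt (take i x) \<le> i" using wt_le[OF take_bits[OF x(2)]] i by (simp add: i_def)
      then show "H n (Seq (Assign d (addE (Var d) (Elem a (Var 1)))) (inc 1)) s' 9
         (\<lambda>s''. I s'' \<and> n + 1 - s'' (Scalar 1) < n + 1 - s' (Scalar 1))"
        using Is i w d a by (intro H_SA[where ?T2.0 = 4] H_Assign) (auto simp: I_def same_def i_def) }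
  qed (use n in auto)
qed

abbreviation "compare_step \<equiv>
  Cond (Op Lt (Elem 2 (Var 1)) (Elem 1 (Var 1))) (Assign 11 (Const 1))
    (Cond (Op Lt (Elem 1 (Var 1)) (Elem 2 (Var 1))) (Assign 11 (Const 0)) Skip)"

text \<open>The scan runs from the least to the most significant letter and overwrites its verdict
  at every difference, so the most significant difference decides.\<close>

definition less_com :: com where
  "less_com = Seq (Assign 11 (Const 0)) (Seq (Assign 1 (Var 0)) (While (Var 1) (Seq
     compare_step
     (dec 1))))"

lemma val_Cons_less:
  assumes "t \<in> bits k" "t' \<in> bits k" "b = 0 \<or> b = 1" "b' = 0 \<or> b' = 1"
  shows "val (b # t) < val (b' # t') \<longleftrightarrow> b < b' \<or> (b = b' \<and> val t < val t')"
  using assms val_less[of t] val_less[of t'] by (auto simp: bits_def)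

lemma less_com:
  assumes s0: "s (Scalar 0) = n" and n: "1 \<le> n"
    and x: "arr n s 2 = x" "x \<in> bits n" and N: "arr n s 1 = N" "N \<in> bits n"
  shows "H n less_com s (30 * n) (\<lambda>s'. s' (Scalar 11) = of_bool (val x < val N) \<and> same {Scalar 1, Scalar 11} s s')"
proof -
  define I where "I s' \<longleftrightarrow> same {Scalar 1, Scalar 11} s s' \<and> s' (Scalar 1) \<le> n \<and>
     s' (Scalar 11) = of_bool (val (drop (s' (Scalar 1)) x) < val (drop (s' (Scalar 1)) N))" for s'
  have len: "length x = n" "length N = n" using x N bitsD(1) by auto
  show ?thesis unfolding less_com_def
  proof (rule H_SA[where ?T2.0 = "20 * n + 4"], simp, simp, rule H_SA[where ?T2.0 = "20 * n + 2"], simp, simp,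
      rule H_For[where I = I and C = 18 and f = "\<lambda>s'. s' (Scalar 1)" and F = n])
    show "I (s(Scalar 11 := eval (Const 0) s, Scalar 1 := eval (Var 0) (s(Scalar 11 := eval (Const 0) s))))"
      using s0 len by (auto simp: I_def same_def)
  next
    fix s' assume Is: "I s'"
    show "okE n (Var 1) s'" by simp
    { assume "eval (Var 1) s' = 0"
      then show "s' (Scalar 11) = of_bool (val x < val N) \<and> same {Scalar 1, Scalar 11} s s'"
        using Is by (simp add: I_def) }
    { assume "eval (Var 1) s' \<noteq> 0"
      then have i: "0 < s' (Scalar 1)" "s' (Scalar 1) \<le> n" using Is by (auto simp: I_def)
      define i where "i = s' (Scalar 1)"
      have c: "s' (Cell a j) = s (Cell a j)" for a j using Is by (simp add: I_def same_def)
      have xi: "x ! (i - 1) = s' (Cell 2 i)" "N ! (i - 1) = s' (Cell 1 i)"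
        using x(1) N(1) i c arr_nth[of "i - 1" n s 2] arr_nth[of "i - 1" n s 1] by (auto simp: i_def)
      have dr: "drop (i - 1) x = x ! (i - 1) # drop i x" "drop (i - 1) N = N ! (i - 1) # drop i N"
        using Cons_nth_drop_Suc[of "i - 1" x] Cons_nth_drop_Suc[of "i - 1" N] i len by (auto simp: i_def)
      have db: "drop i x \<in> bits (n - i)" "drop i N \<in> bits (n - i)"
        using x(2) N(2) by (auto simp: bits_def dest: in_set_dropD)
      have "val (drop (i - 1) x) < val (drop (i - 1) N) \<longleftrightarrow> s' (Cell 2 i) < s' (Cell 1 i) \<or>
          (s' (Cell 2 i) = s' (Cell 1 i) \<and> val (drop i x) < val (drop i N))"
        unfolding dr xi[symmetric]
        by (rule val_Cons_less[OF db]) (use bitsD(2)[OF x(2), of "i - 1"] bitsD(2)[OF N(2), of "i - 1"] i in \<open>auto simp: i_def\<close>)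
      then have key: "of_bool (val (drop (i - 1) x) < val (drop (i - 1) N)) = (if s' (Cell 2 i) < s' (Cell 1 i) then 1
          else if s' (Cell 1 i) < s' (Cell 2 i) then 0 else s' (Scalar 11))"
        using Is by (auto simp: I_def i_def)
      show "H n (Seq compare_step (dec 1)) s' 18
         (\<lambda>s''. I s'' \<and> s'' (Scalar 1) < s' (Scalar 1))"
      proof (rule H_SS[where ?T1.0 = 14 and ?T2.0 = 4 and ?R1.0 = "\<lambda>s''. s'' (Scalar 1) = i \<and> same {Scalar 1, Scalar 11} s s'' \<and>
           s'' (Scalar 11) = of_bool (val (drop (i - 1) x) < val (drop (i - 1) N))"])
        show "H n compare_step s' 14
         (\<lambda>s''. s'' (Scalar 1) = i \<and> same {Scalar 1, Scalar 11} s s'' \<and>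
           s'' (Scalar 11) = of_bool (val (drop (i - 1) x) < val (drop (i - 1) N)))"
          unfolding key using i Is
          by (intro H_Cond[where T' = 8] H_Cond[where T' = 2] H_Assign H_Skip)
             (auto simp: I_def same_def i_def split: if_splits)
      next
        fix s'' assume "s'' (Scalar 1) = i \<and> same {Scalar 1, Scalar 11} s s'' \<and>
           s'' (Scalar 11) = of_bool (val (drop (i - 1) x) < val (drop (i - 1) N))"
        then show "H n (dec 1) s'' 4 (\<lambda>s''. I s'' \<and> s'' (Scalar 1) < s' (Scalar 1))"
          using i by (intro H_Assign) (auto simp: I_def same_def i_def)
      qed simp }
  qed (use n s0 in auto)
qed

text \<open>A form that one scan can check: period \<open>r\<close>, and one \<open>1\<close> among
  the first \<open>r\<close> letters, or none for \<open>r = 1\<close>. For \<open>r = 0\<close>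
  both sides are false, so \<open>0\<close> can stand for an absent length.\<close>

lemma inQ_iff:
  assumes w: "w \<in> bits n" and r: "r < n"
  shows "inQ n r w \<longleftrightarrow> 0 < r \<and> (\<forall>l. r \<le> l \<and> l < n \<longrightarrow> w ! l = w ! (l - r)) \<and> wt (take r w) = of_bool (1 < r)"
proof -
  have tb: "take r w \<in> bits r" using take_bits[OF w] r by simp
  have len: "length w = n" using bitsD(1)[OF w] .
  consider "r = 0" | "r = 1" | "2 \<le> r" by linarith
  then show ?thesis
  proof cases
    case 1 then show ?thesis by (simp add: inQ_def)
  next
    case 2
    have t: "take 1 w = [w ! 0]" using len r by (metis less_nat_zero_code list.size(3) neq0_conv not_less_zero take_0 One_nat_def take_Suc_conv_app_nth append_Nil)
    have "(\<forall>i<n. w ! i = 0) \<longleftrightarrow> (\<forall>l. 1 \<le> l \<and> l < n \<longrightarrow> w ! l = w ! (l - 1)) \<and> w ! 0 = 0"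
    proof (intro iffI conjI allI impI)
      fix i assume A: "(\<forall>l. 1 \<le> l \<and> l < n \<longrightarrow> w ! l = w ! (l - 1)) \<and> w ! 0 = 0" and "i < n"
      then show "w ! i = 0" by (induction i) auto
    qed (use r in auto)
    then show ?thesis using 2 w t by (simp add: inQ_def)
  next
    case 3
    show ?thesis
    proof
      assume q: "inQ n r w"
      then obtain a where a: "a < r" "\<And>i. i < n \<Longrightarrow> w ! i = of_bool (i mod r = a)"
        using 3 by (auto simp: inQ_def)
      have "w ! l = w ! (l - r)" if "r \<le> l" "l < n" for l
        using a(2)[of l] a(2)[of "l - r"] that by (simp add: le_mod_geq)
      moreover have "{i. i < r \<and> take r w ! i = 1} = {a}" using a r by auto
      then have "wt (take r w) = 1" using wt_card[OF tb] by simp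
      ultimately show "0 < r \<and> (\<forall>l. r \<le> l \<and> l < n \<longrightarrow> w ! l = w ! (l - r)) \<and> wt (take r w) = of_bool (1 < r)"
        using 3 by simp
    next
      assume A: "0 < r \<and> (\<forall>l. r \<le> l \<and> l < n \<longrightarrow> w ! l = w ! (l - r)) \<and> wt (take r w) = of_bool (1 < r)"
      then have "card {i. i < r \<and> take r w ! i = 1} = 1" using wt_card[OF tb] 3 by simp
      then obtain a where a: "{i. i < r \<and> take r w ! i = 1} = {a}" by (metis card_1_singletonE)
      have mod: "w ! i = w ! (i mod r)" if "i < n" for i
        using that
      proof (induction i rule: less_induct)
        case (less i)
        show ?case
        proof (cases "i < r")
          case False
          then have "w ! i = w ! (i - r)" using A less.prems by simp
          also have "\<dots> = w ! ((i - r) mod r)" using less False A by simp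
          finally show ?thesis using False by (simp add: le_mod_geq)
        qed simp
      qed
      have "w ! i = of_bool (i mod r = a)" if i: "i < n" for i
      proof -
        have "i mod r < r" using A by simp
        moreover have "i mod r \<in> {i. i < r \<and> take r w ! i = 1} \<longleftrightarrow> i mod r \<in> {a}" unfolding a ..
        ultimately have "w ! (i mod r) = 1 \<longleftrightarrow> i mod r = a" by simp
        then show ?thesis using mod[OF i] bitsD(2)[OF w i] by (cases "i mod r = a") simp_all
      qed
      moreover have "a < r"
      proof -
        have "a \<in> {i. i < r \<and> take r w ! i = 1}" unfolding a by simp
        then show ?thesis by simp
      qed
      ultimately show "inQ n r w" using w 3 unfolding inQ_def by auto
    qed
  qed
qed

abbreviation "window_value rv \<equiv>
  addE (Var 12) (Op Mul (Var 4) (Op Eq (Var 13) (Op Lt (Const 1) (Var rv))))"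

text \<open>Register \<open>4\<close> records whether period \<open>r\<close> has held so far,
  register \<open>13\<close> sums the first \<open>r\<close> letters. The result is added to
  register \<open>12\<close>, so that the tests for both lengths accumulate there.\<close>

definition window_com :: "nat \<Rightarrow> com" where
  "window_com rv = Seq (Assign 4 (Op Lt (Const 0) (Var rv))) (Seq (Assign 13 (Const 0)) (Seq (Assign 1 (Const 1)) (Seq
     (up_to_n (Cond (Op Lt (Var rv) (Var 1))
        (Cond (Op Eq (Elem 2 (Var 1)) (Elem 2 (subE (Var 1) (Var rv)))) Skip (Assign 4 (Const 0)))
        (Assign 13 (addE (Var 13) (Elem 2 (Var 1))))))
     (Assign 12 (window_value rv)))))"

lemma window_com:
  assumes s0: "s (Scalar 0) = n" and n: "1 \<le> n" and x: "arr n s 2 = x" "x \<in> bits n"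
    and rv: "rv < 16" "rv \<notin> {0, 1, 4, 12, 13}" and r: "s (Scalar rv) = r" "r < n" and s12: "s (Scalar 12) \<le> 1"
  shows "H n (window_com rv) s (50 * n) (\<lambda>s'. s' (Scalar 12) = s (Scalar 12) + of_bool (inQ n r x) \<and>
     same {Scalar 1, Scalar 4, Scalar 12, Scalar 13} s s')"
proof -
  let ?W = "{Scalar 1, Scalar 4, Scalar 12, Scalar 13}"
  define I where "I s' \<longleftrightarrow> same ?W s s' \<and> s' (Scalar 12) = s (Scalar 12) \<and> 1 \<le> s' (Scalar 1) \<and> s' (Scalar 1) \<le> n + 1 \<and>
     s' (Scalar 4) = of_bool (0 < r \<and> (\<forall>l. r \<le> l \<and> l < s' (Scalar 1) - 1 \<longrightarrow> x ! l = x ! (l - r))) \<and>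
     s' (Scalar 13) = wt (take (min r (s' (Scalar 1) - 1)) x)" for s'
  have I0: "s' (Scalar 0) = n" "s' (Scalar rv) = r" "s' (Cell a i) = s (Cell a i)" if "I s'" for s' a i
  proof -
    have "same ?W s s'" using that by (simp add: I_def)
    then show "s' (Scalar 0) = n" "s' (Scalar rv) = r" "s' (Cell a i) = s (Cell a i)"
      using s0 r(1) rv(2) by (simp_all add: same_def)
  qed
  let ?B = "Cond (Op Lt (Var rv) (Var 1))
        (Cond (Op Eq (Elem 2 (Var 1)) (Elem 2 (subE (Var 1) (Var rv)))) Skip (Assign 4 (Const 0)))
        (Assign 13 (addE (Var 13) (Elem 2 (Var 1))))"
  have init: "I (s(Scalar 4 := of_bool (0 < r), Scalar 13 := 0, Scalar 1 := 1))"
    using n by (auto simp: I_def same_def)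
  have loop: "H n (up_to_n ?B) (s(Scalar 4 := of_bool (0 < r), Scalar 13 := 0, Scalar 1 := 1)) (24 * n + 6)
     (\<lambda>s'. I s' \<and> s' (Scalar 1) = n + 1)"
  proof (rule H_For[where I = I and C = 18 and f = "\<lambda>s'. n + 1 - s' (Scalar 1)" and F = n, OF _ _ _ init])
    fix s' assume Is: "I s'"
    show "okE n in_range s'" using I0[OF Is] by simp
    { assume "eval in_range s' = 0"
      then show "I s' \<and> s' (Scalar 1) = n + 1" using Is I0[OF Is] by (auto simp: I_def split: if_splits) }
    { assume "eval in_range s' \<noteq> 0"
      then have i: "1 \<le> s' (Scalar 1)" "s' (Scalar 1) \<le> n" using I0[OF Is] Is by (auto simp: I_def split: if_splits)
      define i where "i = s' (Scalar 1)"
      have xi: "x ! (i - 1) = s' (Cell 2 i)"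
        using x(1) i I0(3)[OF Is] arr_nth[of "i - 1" n s 2] by (simp add: i_def)
      let ?R = "\<lambda>s''. s'' (Scalar 1) = i \<and> I (s''(Scalar 1 := Suc i))"
      show "H n (Seq ?B (inc 1)) s' 18 (\<lambda>s''. I s'' \<and> n + 1 - s'' (Scalar 1) < n + 1 - s' (Scalar 1))"
      proof (rule H_SS[where ?T1.0 = 14 and ?T2.0 = 4 and ?R1.0 = ?R], rule H_Cond[where T' = 10])
        assume "eval (Op Lt (Var rv) (Var 1)) s' \<noteq> 0"
        then have ri: "r < i" using I0[OF Is] by (auto simp: i_def split: if_splits)
        have xir: "x ! (i - 1 - r) = s' (Cell 2 (i - r))"
        proof -
          have "i - 1 - r < n" "Suc (i - 1 - r) = i - r" using i ri by (auto simp: i_def)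
          then show ?thesis using x(1) I0(3)[OF Is] arr_nth[of "i - 1 - r" n s 2] by simp
        qed
        have ext: "(\<forall>l. r \<le> l \<and> l < i \<longrightarrow> x ! l = x ! (l - r)) \<longleftrightarrow>
            (\<forall>l. r \<le> l \<and> l < i - 1 \<longrightarrow> x ! l = x ! (l - r)) \<and> s' (Cell 2 i) = s' (Cell 2 (i - r))" (is "?l \<longleftrightarrow> ?r1 \<and> ?r2")
        proof
          assume l: ?l
          have "r \<le> i - 1" "i - 1 < i" using ri i by (auto simp: i_def)
          then have "x ! (i - 1) = x ! (i - 1 - r)" using l by blast
          then show "?r1 \<and> ?r2" using l xi xir by auto
        next
          assume R: "?r1 \<and> ?r2"
          show ?l
          proof (intro allI impI)
            fix l assume l: "r \<le> l \<and> l < i"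
            show "x ! l = x ! (l - r)"
            proof (cases "l = i - 1")
              case True then show ?thesis using R xi xir by simp
            next
              case False
              then have "l < i - 1" using l by linarith
              then show ?thesis using R l by blast
            qed
          qed
        qed
        have mn: "min r i = r" "min r (i - 1) = r" using ri by auto
        show "H n (Cond (Op Eq (Elem 2 (Var 1)) (Elem 2 (subE (Var 1) (Var rv)))) Skip (Assign 4 (Const 0))) s' 10 ?R"
        proof (rule H_Cond[where T' = 2])
          assume "eval (Op Eq (Elem 2 (Var 1)) (Elem 2 (subE (Var 1) (Var rv)))) s' \<noteq> 0"
          then have "s' (Cell 2 i) = s' (Cell 2 (i - r))" using I0[OF Is] by (auto simp: i_def split: if_splits)
          then have "?R s'" using Is i ext mn by (auto simp: I_def same_def i_def)
          then show "H n Skip s' 2 ?R" by (rule H_Skip)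
        next
          assume "eval (Op Eq (Elem 2 (Var 1)) (Elem 2 (subE (Var 1) (Var rv)))) s' = 0"
          then have "s' (Cell 2 i) \<noteq> s' (Cell 2 (i - r))" using I0[OF Is] by (auto simp: i_def split: if_splits)
          then have "?R (s'(Scalar 4 := 0))" using Is i ext mn by (auto simp: I_def same_def i_def)
          then show "H n (Assign 4 (Const 0)) s' 2 ?R" by (intro H_Assign) simp_all
        qed (use i I0[OF Is] rv in auto)
      next
        assume "eval (Op Lt (Var rv) (Var 1)) s' = 0"
        then have ri: "i \<le> r" using I0[OF Is] by (auto simp: i_def split: if_splits)
        have "take i x = take (i - 1) x @ [x ! (i - 1)]"
          using take_Suc_conv_app_nth[of "i - 1" x] bitsD(1)[OF x(2)] i by (simp add: i_def)
        moreover have mn: "min r i = i" "min r (i - 1) = i - 1" using ri by auto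
        ultimately have w: "wt (take (min r i) x) = s' (Scalar 13) + s' (Cell 2 i)" using xi Is by (simp add: I_def i_def)
        have le: "s' (Scalar 13) + s' (Cell 2 i) \<le> 2 * n + 2" unfolding w[symmetric] mn
          using wt_le[OF take_bits[OF x(2)], of i] i by (simp add: i_def)
        have "?R (s'(Scalar 13 := s' (Scalar 13) + s' (Cell 2 i)))"
          using Is i w ri by (auto simp: I_def same_def i_def)
        then show "H n (Assign 13 (addE (Var 13) (Elem 2 (Var 1)))) s' 10 ?R"
          using i le by (intro H_Assign) (simp_all add: i_def)
      next
        fix s'' assume "?R s''"
        then show "H n (inc 1) s'' 4 (\<lambda>s''. I s'' \<and> n + 1 - s'' (Scalar 1) < n + 1 - s' (Scalar 1))"
          using i by (intro H_Assign) (auto simp: i_def)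
      qed (use rv in auto) }
  qed auto
  show ?thesis unfolding window_com_def
  proof (rule H_SA[where ?T2.0 = "24 * n + 20"], (use rv in simp), simp, rule H_SA[where ?T2.0 = "24 * n + 18"], simp, simp,
      rule H_SA[where ?T2.0 = "24 * n + 16"], simp, simp,
      rule H_SS[where ?T1.0 = "24 * n + 6" and ?T2.0 = 10 and ?R1.0 = "\<lambda>s'. I s' \<and> s' (Scalar 1) = n + 1"])
    let ?s1 = "s(Scalar 4 := eval (Op Lt (Const 0) (Var rv)) s)"
    let ?s2 = "?s1(Scalar 13 := eval (Const 0) ?s1)"
    have "?s2(Scalar 1 := eval (Const 1) ?s2) = s(Scalar 4 := of_bool (0 < r), Scalar 13 := 0, Scalar 1 := 1)"
      using r by auto
    then show "H n (up_to_n ?B) (?s2(Scalar 1 := eval (Const 1) ?s2)) (24 * n + 6) (\<lambda>s'. I s' \<and> s' (Scalar 1) = n + 1)"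
      using loop by simp
  next
    fix s' assume Is: "I s' \<and> s' (Scalar 1) = n + 1"
    have mn: "min r n = r" using r(2) by simp
    have "of_bool (inQ n r x) = s' (Scalar 4) * of_bool (s' (Scalar 13) = of_bool (1 < r))"
      unfolding inQ_iff[OF x(2) r(2)] using Is mn by (auto simp: I_def)
    then have e: "eval (window_value rv) s'
        = s (Scalar 12) + of_bool (inQ n r x)"
      using Is I0(2)[of s'] by (auto simp: I_def)
    have le: "s' (Scalar 4) \<le> 1" "s' (Scalar 12) \<le> 1" using Is s12 by (simp_all add: I_def)
    have sm: "same ?W s s'" using Is by (simp add: I_def)
    show "H n (Assign 12 (window_value rv)) s' 10
      (\<lambda>s'. s' (Scalar 12) = s (Scalar 12) + of_bool (inQ n r x) \<and> same ?W s s')"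
    proof (rule H_Assign)
      show "okE n (window_value rv) s'"
        using le rv(1) n by simp
      show "(s'(Scalar 12 := eval (window_value rv) s')) (Scalar 12)
          = s (Scalar 12) + of_bool (inQ n r x) \<and>
        same ?W s (s'(Scalar 12 := eval (window_value rv) s'))"
        unfolding e using sm by (simp add: same_def)
    qed simp_all
  qed (use n in auto)
qed

section \<open>One step on the truncated cycle\<close>

definition shift_com :: com where
  "shift_com = Seq (Assign 1 (Const 0)) (Seq
     (While (Op Lt (Var 1) (Var 0)) (Seq (Update 2 (Var 1) (Elem 2 (addE (Var 1) (Const 1)))) (inc 1)))
     (Update 2 (Var 0) (Const 1)))"

text \<open>The shifted-out letter stays available in cell \<open>0\<close>, and the provisional
  last letter \<open>1\<close> makes the array hold \<open>z1\<close>, ready for the necklace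
  test.\<close>

lemma shift_com:
  assumes s0: "s (Scalar 0) = n" and n: "1 \<le> n" and v: "arr n s 2 = c # z"
  shows "H n shift_com s (25 * n) (\<lambda>s'. s' (Cell 2 0) = c \<and> arr n s' 2 = z @ [1] \<and>
     same ({Scalar 1} \<union> {Cell 2 j | j. j \<le> n}) s s')"
proof -
  let ?W = "{Scalar 1} \<union> {Cell 2 j | j. j \<le> n}"
  define I where "I s' \<longleftrightarrow> same ?W s s' \<and> s' (Scalar 1) \<le> n \<and>
     (\<forall>j. j < s' (Scalar 1) \<longrightarrow> s' (Cell 2 j) = s (Cell 2 (Suc j))) \<and>
     (\<forall>j. s' (Scalar 1) \<le> j \<longrightarrow> s' (Cell 2 j) = s (Cell 2 j))" for s'
  have I0: "s' (Scalar 0) = n" if "I s'" for s' using that s0 by (auto simp: I_def same_def)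
  have lz: "length z = n - 1" using v by (metis length_arr length_Cons diff_Suc_1)
  have vn: "(c # z) ! j = s (Cell 2 (Suc j))" if "j < n" for j using arr_nth[OF that, of s 2] v by simp
  show ?thesis unfolding shift_com_def
  proof (rule H_SA[where ?T2.0 = "14 * n + 7"], simp, simp,
      rule H_SS[where ?T1.0 = "14 * n + 4" and ?T2.0 = 3 and ?R1.0 = "\<lambda>s'. I s' \<and> s' (Scalar 1) = n"],
      rule H_For[where I = I and C = 10 and f = "\<lambda>s'. n - s' (Scalar 1)" and F = n])
    show "I (s(Scalar 1 := eval (Const 0) s))" by (auto simp: I_def same_def)
  next
    fix s' assume Is: "I s'"
    show "okE n (Op Lt (Var 1) (Var 0)) s'" by simp
    { assume "eval (Op Lt (Var 1) (Var 0)) s' = 0"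
      then show "I s' \<and> s' (Scalar 1) = n" using Is I0[OF Is] by (auto simp: I_def split: if_splits) }
    { assume "eval (Op Lt (Var 1) (Var 0)) s' \<noteq> 0"
      then have "s' (Scalar 1) < n" using I0[OF Is] by (auto split: if_splits)
      then show "H n (Seq (Update 2 (Var 1) (Elem 2 (addE (Var 1) (Const 1)))) (inc 1)) s' 10
          (\<lambda>s''. I s'' \<and> n - s'' (Scalar 1) < n - s' (Scalar 1))"
        using Is by (intro H_SU[where ?T2.0 = 4] H_Assign) (auto simp: I_def same_def less_Suc_eq) }
  next
    fix s' assume Is: "I s' \<and> s' (Scalar 1) = n"
    define s2 where "s2 = s'(Cell 2 n := 1)"
    have "s2 (Cell 2 0) = c" using Is n vn[of 0] by (auto simp: I_def s2_def)
    moreover have "arr n s2 2 = z @ [1]"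
    proof (rule nth_equalityI)
      show "length (arr n s2 2) = length (z @ [1])" using lz n by simp
      fix i assume "i < length (arr n s2 2)"
      then have i: "i < n" by simp
      show "arr n s2 2 ! i = (z @ [1]) ! i"
      proof (cases "i = n - 1")
        case True then show ?thesis using i lz n by (simp add: arr_nth s2_def nth_append)
      next
        case False
        then have "Suc i < n" "i < n - 1" using i by auto
        then show ?thesis using i lz Is vn[of "Suc i"] by (simp add: arr_nth s2_def nth_append I_def)
      qed
    qed
    moreover have "same ?W s s2" using Is by (auto simp: I_def same_def s2_def)
    ultimately show "H n (Update 2 (Var 0) (Const 1)) s' 3
      (\<lambda>s'. s' (Cell 2 0) = c \<and> arr n s' 2 = z @ [1] \<and> same ?W s s')"
      using I0[of s'] Is by (intro H_Update) (simp_all add: s2_def)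
  qed (use n in auto)
qed

lemma arr_update_last:
  assumes "1 \<le> n" "arr n s a = z @ [b]" shows "arr n (s(Cell a n := b')) a = z @ [b']"
proof (rule nth_equalityI)
  have lz: "length z = n - 1" using assms by (metis length_arr length_append_singleton diff_Suc_1)
  then show "length (arr n (s(Cell a n := b')) a) = length (z @ [b'])" using assms(1) by simp
  fix i assume "i < length (arr n (s(Cell a n := b')) a)"
  then have i: "i < n" by simp
  have "(z @ [b]) ! i = s (Cell a (Suc i))" using arr_nth[OF i, of s a] assms(2) by simp
  then show "arr n (s(Cell a n := b')) a ! i = (z @ [b']) ! i"
    using i lz assms(1) by (cases "i = n - 1") (auto simp: arr_nth nth_append split: if_splits)
qed

text \<open>The negation of \<open>bef\<close> for \<open>z1\<close>, with sum as disjunction and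
  product as conjunction.\<close>

abbreviation "kept_test \<equiv>
  addE (Op Lt (Var 10) (Var 6)) (Op Mul (Op Eq (Var 10) (Var 6)) (subE (Const 1) (Var 11)))"

abbreviation "choose_com \<equiv> Cond (Var 2)
  (Seq (sum_com 2 10) (Seq less_com (Cond kept_test (Assign 9 (subE (Const 1) (Var 9))) Skip))) Skip"

abbreviation "flip_com \<equiv> Cond (Var 12) (Update 2 (Var 0) (subE (Const 1) (Elem 2 (Var 0)))) Skip"

definition step_com :: com where
  "step_com = Seq shift_com (Seq (neck_com 2) (Seq (Assign 9 (Elem 2 (Const 0))) (Seq
     choose_com (Seq
     (Update 2 (Var 0) (Var 9)) (Seq (Assign 12 (Const 0)) (Seq (window_com 7) (Seq (window_com 8)
     flip_com)))))))"

abbreviation step_W :: "nat \<Rightarrow> loc set" where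
  "step_W n \<equiv> {Scalar 1, Scalar 2, Scalar 4, Scalar 9, Scalar 10, Scalar 11, Scalar 12, Scalar 13} \<union> {Cell 2 j | j. j \<le> n}"

lemma choose_com:
  assumes s0: "s (Scalar 0) = n" and n: "1 \<le> n" and x: "arr n s 2 = z @ [1]" "z @ [1] \<in> bits n"
    and N: "arr n s 1 = N" "N \<in> bits n" "s (Scalar 6) = wt N"
    and c: "s (Scalar 9) = c" and p: "s (Scalar 2) \<noteq> 0 \<longleftrightarrow> neck (z @ [1])"
  shows "H n choose_com s (78 * n) (\<lambda>s'. s' (Scalar 9) = nextb N z c \<and> same {Scalar 1, Scalar 9, Scalar 10, Scalar 11} s s')"
proof (rule H_Cond[where T' = "76 * n"])
  assume "eval (Var 2) s \<noteq> 0"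
  then have nk: "neck (z @ [1])" using p by simp
  show "H n (Seq (sum_com 2 10) (Seq less_com
         (Cond kept_test
           (Assign 9 (subE (Const 1) (Var 9))) Skip))) s (76 * n)
        (\<lambda>s'. s' (Scalar 9) = nextb N z c \<and> same {Scalar 1, Scalar 9, Scalar 10, Scalar 11} s s')"
  proof (rule H_SS[OF sum_com[of s n 2 10, OF s0 n _ _ _ _ x], where ?T2.0 = "46 * n"], simp, simp, simp, simp)
    fix s1 assume s1: "s1 (Scalar 10) = wt (z @ [1]) \<and> same {Scalar 1, Scalar 10} s s1"
    have a1: "arr n s1 2 = z @ [1]" "arr n s1 1 = N" using s1 x N by (simp_all add: same_def arr_def)
    have s10: "s1 (Scalar 0) = n" using s1 s0 by (simp add: same_def)
    show "H n (Seq less_com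
         (Cond kept_test
           (Assign 9 (subE (Const 1) (Var 9))) Skip)) s1 (46 * n)
        (\<lambda>s'. s' (Scalar 9) = nextb N z c \<and> same {Scalar 1, Scalar 9, Scalar 10, Scalar 11} s s')"
    proof (rule H_SS[OF less_com[of s1 n, OF s10 n a1(1) x(2) a1(2) N(2)], where ?T2.0 = 16])
      fix s2 assume s2: "s2 (Scalar 11) = of_bool (val (z @ [1]) < val N) \<and> same {Scalar 1, Scalar 11} s1 s2"
      have v: "s2 (Scalar 10) = wt (z @ [1])" "s2 (Scalar 6) = wt N" "s2 (Scalar 9) = c"
        and sm: "same {Scalar 1, Scalar 9, Scalar 10, Scalar 11} s s2"
        using s1 s2 N c by (auto simp: same_def)
      have e: "eval kept_test s2 \<noteq> 0
          \<longleftrightarrow> \<not> bef (z @ [1]) N" using v s2 by (auto simp: bef_def)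
      show "H n (Cond kept_test
           (Assign 9 (subE (Const 1) (Var 9))) Skip) s2 16
        (\<lambda>s'. s' (Scalar 9) = nextb N z c \<and> same {Scalar 1, Scalar 9, Scalar 10, Scalar 11} s s')"
      proof (rule H_Cond[where T' = 4])
        assume "eval kept_test s2 \<noteq> 0"
        then have "\<not> bef (z @ [1]) N" using e by blast
        then have "nextb N z c = 1 - c" using nk by (simp add: nextb_def)
        then show "H n (Assign 9 (subE (Const 1) (Var 9))) s2 4
          (\<lambda>s'. s' (Scalar 9) = nextb N z c \<and> same {Scalar 1, Scalar 9, Scalar 10, Scalar 11} s s')"
          using v sm by (intro H_Assign) (auto simp: same_def)
      next
        assume "eval kept_test s2 = 0"
        then have "bef (z @ [1]) N" using e by blast
        then have "nextb N z c = c" by (simp add: nextb_def)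
        then show "H n Skip s2 4
          (\<lambda>s'. s' (Scalar 9) = nextb N z c \<and> same {Scalar 1, Scalar 9, Scalar 10, Scalar 11} s s')"
          using v sm by (intro H_Skip) auto
      qed auto
    qed (use n in auto)
  qed (use n in auto)
next
  assume "eval (Var 2) s = 0"
  then have "nextb N z c = c" using p by (simp add: nextb_def)
  then show "H n Skip s (76 * n) (\<lambda>s'. s' (Scalar 9) = nextb N z c \<and> same {Scalar 1, Scalar 9, Scalar 10, Scalar 11} s s')"
    using c by (intro H_Skip) (auto simp: same_def)
qed (use n in auto)

text \<open>Lengths \<open>0\<close> are taken out of the set of cut out lengths, in agreement with
  the window test, which never succeeds for them.\<close>

lemma step_com:
  assumes s0: "s (Scalar 0) = n" and n: "1 \<le> n" and v: "arr n s 2 = v" "v \<in> bits n"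
    and N: "arr n s 1 = N" "N \<in> bits n" "s (Scalar 6) = wt N"
    and r: "s (Scalar 7) = r1" "s (Scalar 8) = r2" "r1 < n" "r2 < n"
  shows "H n step_com s (300 * n) (\<lambda>s'. arr n s' 2 = stp n N ({r1, r2} - {0}) v \<and> same (step_W n) s s')"
proof -
  obtain c z where cz: "v = c # z" "c = 0 \<or> c = 1" "z \<in> bits (n - 1)"
    using v n by (cases v) (auto simp: Cons_bits bits_def)
  define b where "b = nextb N z c"
  have b: "b = 0 \<or> b = 1" using cz(2) by (auto simp: b_def nextb_def)
  have z1: "z @ [d] \<in> bits n" if "d = 0 \<or> d = 1" for d using cz(3) n that by (auto simp: snoc_bits)
  let ?R = "\<lambda>s'. arr n s' 2 = stp n N ({r1, r2} - {0}) v \<and> same (step_W n) s s'"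
  show ?thesis unfolding step_com_def
  proof (rule H_SS[OF shift_com[of s n c z, OF s0 n], where ?T2.0 = "275 * n"])
    show "arr n s 2 = c # z" using v cz by simp
  next
    fix s1 assume s1: "s1 (Cell 2 0) = c \<and> arr n s1 2 = z @ [1] \<and> same ({Scalar 1} \<union> {Cell 2 j |j. j \<le> n}) s s1"
    have f1: "s1 (Scalar 0) = n" using s1 s0 by (simp add: same_def)
    show "H n (Seq (neck_com 2) (Seq (Assign 9 (Elem 2 (Const 0))) (Seq
     choose_com (Seq
     (Update 2 (Var 0) (Var 9)) (Seq (Assign 12 (Const 0)) (Seq (window_com 7) (Seq (window_com 8)
     flip_com))))))) s1 (275 * n) ?R"
    proof (rule H_SS[OF neck_com[of s1 n 2 "z @ [1]", OF f1 n _ _ z1], where ?T2.0 = "225 * n"], simp, use s1 in simp, simp)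
      fix s2 assume s2: "same {Scalar 1, Scalar 2} s1 s2 \<and> (if neck (z @ [1]) then 0 < s2 (Scalar 2) \<and> s2 (Scalar 2) \<le> n \<and>
          card {v. \<exists>k. v = rotate k (z @ [1])} = s2 (Scalar 2) else s2 (Scalar 2) = 0)"
      define s3 where "s3 = s2(Scalar 9 := c)"
      have same3: "same (step_W n) s s3" using s1 s2 by (auto simp: same_def s3_def)
      have f3: "s3 (Scalar 0) = n" "s3 (Scalar 6) = wt N" "s3 (Scalar 9) = c" "s3 (Scalar 2) \<noteq> 0 \<longleftrightarrow> neck (z @ [1])"
        using s1 s2 s0 N(3) by (auto simp: same_def s3_def split: if_splits)
      have a3: "arr n s3 2 = z @ [1]" using s1 s2 by (simp add: same_def arr_def s3_def)
      have a31: "arr n s3 1 = N" unfolding N(1)[symmetric] by (rule arr_cong) (use same3 in \<open>simp add: same_def\<close>)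
      show "H n (Seq (Assign 9 (Elem 2 (Const 0))) (Seq
     choose_com (Seq
     (Update 2 (Var 0) (Var 9)) (Seq (Assign 12 (Const 0)) (Seq (window_com 7) (Seq (window_com 8)
     flip_com)))))) s2 (225 * n) ?R"
      proof (rule H_SA[where ?T2.0 = "222 * n"], simp, simp)
        have e3: "s2(Scalar 9 := eval (Elem 2 (Const 0)) s2) = s3" using s1 s2 by (simp add: s3_def same_def)
        show "H n (Seq
     choose_com (Seq
     (Update 2 (Var 0) (Var 9)) (Seq (Assign 12 (Const 0)) (Seq (window_com 7) (Seq (window_com 8)
     flip_com)))))
     (s2(Scalar 9 := eval (Elem 2 (Const 0)) s2)) (222 * n) ?R" unfolding e3
        proof (rule H_SS[OF choose_com[of s3 n z N c, OF f3(1) n a3 z1 a31 N(2) f3(2-4)], where ?T2.0 = "144 * n"], simp)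
          fix s4 assume s4: "s4 (Scalar 9) = nextb N z c \<and> same {Scalar 1, Scalar 9, Scalar 10, Scalar 11} s3 s4"
          define s5 where "s5 = s4(Cell 2 n := b, Scalar 12 := 0)"
          have f4: "s4 (Scalar 0) = n" "s4 (Scalar 9) = b" using s4 f3 by (auto simp: same_def b_def)
          have same5: "same (step_W n) s s5" using same3 s4 by (auto simp: same_def s5_def)
          have a4: "arr n s4 2 = z @ [1]" using a3 s4 by (simp add: same_def arr_def)
          have a5: "arr n s5 2 = z @ [b]" using arr_update_last[OF n a4, of b] by (simp add: arr_def s5_def)
          have f5: "s5 (Scalar 0) = n" "s5 (Scalar 7) = r1" "s5 (Scalar 8) = r2" "s5 (Scalar 12) = 0"
            using sameD[OF same5, of "Scalar 0"] sameD[OF same5, of "Scalar 7"] sameD[OF same5, of "Scalar 8"] r s0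
            by (simp_all add: s5_def)
          show "H n (Seq (Update 2 (Var 0) (Var 9)) (Seq (Assign 12 (Const 0)) (Seq (window_com 7) (Seq (window_com 8)
             flip_com)))) s4 (144 * n) ?R"
          proof (rule H_SU[where ?T2.0 = "141 * n"], simp, simp, simp, (use f4 in simp),
              rule H_SA[where ?T2.0 = "139 * n"], simp, simp)
            let ?t = "s4(Cell 2 (eval (Var 0) s4) := eval (Var 9) s4)"
            have e5: "?t(Scalar 12 := eval (Const 0) ?t) = s5" using f4 by (simp add: s5_def)
            show "H n (Seq (window_com 7) (Seq (window_com 8)
               flip_com))
               (?t(Scalar 12 := eval (Const 0) ?t)) (139 * n) ?R" unfolding e5
            proof (rule H_SS[OF window_com[of s5 n "z @ [b]" 7 r1, OF f5(1) n a5 z1[OF b] _ _ f5(2) r(3)], where ?T2.0 = "89 * n"], simp, simp, use f5 in simp)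
              fix s6 assume s6: "s6 (Scalar 12) = s5 (Scalar 12) + of_bool (inQ n r1 (z @ [b])) \<and>
                 same {Scalar 1, Scalar 4, Scalar 12, Scalar 13} s5 s6"
              have f6: "s6 (Scalar 0) = n" "s6 (Scalar 8) = r2" "s6 (Scalar 12) = of_bool (inQ n r1 (z @ [b]))"
                using s6 f5 by (auto simp: same_def)
              have a6: "arr n s6 2 = z @ [b]" using a5 s6 by (simp add: same_def arr_def)
              show "H n (Seq (window_com 8)
                 flip_com) s6 (89 * n) ?R"
              proof (rule H_SS[OF window_com[of s6 n "z @ [b]" 8 r2, OF f6(1) n a6 z1[OF b] _ _ f6(2) r(4)], where ?T2.0 = "39 * n"], simp, simp, use f6 in simp)
                fix s7 assume s7: "s7 (Scalar 12) = s6 (Scalar 12) + of_bool (inQ n r2 (z @ [b])) \<and>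
                   same {Scalar 1, Scalar 4, Scalar 12, Scalar 13} s6 s7"
                have f7: "s7 (Scalar 0) = n" using s7 f6 by (simp add: same_def)
                have a7: "arr n s7 2 = z @ [b]" using a6 s7 by (simp add: same_def arr_def)
                have same7: "same (step_W n) s s7" using same5 s6 s7 by (auto simp: same_def)
                have q0: "\<not> inQ n 0 w" for w by (simp add: inQ_def)
                have fl: "s7 (Scalar 12) \<noteq> 0 \<longleftrightarrow> (\<exists>r\<in>{r1, r2} - {0}. inQ n r (z @ [b]))"
                  using s7 f6 q0[of "z @ [b]"] by (cases "r1 = 0"; cases "r2 = 0") auto
                have st: "stp n N ({r1, r2} - {0}) v = z @ [if s7 (Scalar 12) \<noteq> 0 then 1 - b else b]"
                  unfolding stp_def Let_def cz(1) list.sel b_def[symmetric] fl ..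
                have cn: "s7 (Cell 2 n) = b"
                proof -
                  have "arr n s7 2 ! (n - 1) = s7 (Cell 2 n)" using n by (simp add: arr_nth)
                  moreover have "length z = n - 1" using bitsD(1)[OF cz(3)] .
                  ultimately show ?thesis using a7 by (simp add: nth_append)
                qed
                show "H n flip_com s7 (39 * n) ?R"
                proof (rule H_Cond[where T' = 6])
                  assume "eval (Var 12) s7 \<noteq> 0"
                  then have "?R (s7(Cell 2 n := 1 - b))"
                    using st arr_update_last[OF n a7, of "1 - b"] same7 by (auto simp: same_def)
                  then show "H n (Update 2 (Var 0) (subE (Const 1) (Elem 2 (Var 0)))) s7 6 ?R"
                    using f7 cn by (intro H_Update) simp_all
                next
                  assume "eval (Var 12) s7 = 0"
                  then have "?R s7" using st a7 same7 by simp
                  then show "H n Skip s7 6 ?R" by (rule H_Skip)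
                qed (use n in auto)
              qed (use n in auto)
            qed (use n in auto)
          qed (use n in auto)
        qed (use n in auto)
      qed (use n in auto)
    qed (use n in auto)
  qed (use n in auto)
qed

section \<open>Splitting the excess, and the output loop\<close>

abbreviation "split_com \<equiv> Cond (Op Lt (addE (Var 0) (Const 1)) (addE (Var 3) (Var 3)))
  (Seq (Assign 7 (Op Quot (addE (Var 0) (Const 1)) (Const 2))) (Assign 8 (subE (Var 3) (Var 7))))
  (Seq (Assign 7 (Var 3)) (Assign 8 (Const 0)))"

definition setup_com :: com where
  "setup_com = Seq (sum_com 1 6) (Seq
     split_com
     (Seq (Update 2 (Var 0) (Const 1)) (Assign 14 (Const 1))))"

definition part1 :: "nat \<Rightarrow> nat \<Rightarrow> nat" where
  "part1 n r = (if n + 1 < 2 * r then (n + 1) div 2 else r)"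

definition part2 :: "nat \<Rightarrow> nat \<Rightarrow> nat" where
  "part2 n r = r - part1 n r"

definition loop_inv :: "nat \<Rightarrow> nat list \<Rightarrow> nat \<Rightarrow> nat \<Rightarrow> nat list \<Rightarrow> store \<Rightarrow> bool" where
  "loop_inv n N r1 r2 v s \<longleftrightarrow> s (Scalar 0) = n \<and> arr n s 1 = N \<and> s (Scalar 6) = wt N \<and>
     s (Scalar 7) = r1 \<and> s (Scalar 8) = r2 \<and> arr n s 2 = v"

lemma setup_com:
  assumes s0: "s (Scalar 0) = n" and n: "1 \<le> n" and N: "arr n s 1 = N" "N \<in> bits n"
    and r: "s (Scalar 3) = r" "r < n" and z: "\<And>j. s (Cell 2 j) = 0"
  shows "H n setup_com s (60 * n) (\<lambda>s'. loop_inv n N (part1 n r) (part2 n r) (replicate (n - 1) 0 @ [1]) s' \<and> s' (Scalar 14) = 1)"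
  unfolding setup_com_def
proof (rule H_SS[OF sum_com[of s n 1 6, OF s0 n _ _ _ _ N], where ?T2.0 = "23"], simp, simp, simp, simp)
  fix s1 assume s1: "s1 (Scalar 6) = wt N \<and> same {Scalar 1, Scalar 6} s s1"
  define s2 where "s2 = s1(Scalar 7 := part1 n r, Scalar 8 := part2 n r)"
  have f1: "s1 (Scalar 0) = n" "s1 (Scalar 3) = r" using s1 s0 r by (simp_all add: same_def)
  show "H n (Seq split_com
     (Seq (Update 2 (Var 0) (Const 1)) (Assign 14 (Const 1)))) s1 23
     (\<lambda>s'. loop_inv n N (part1 n r) (part2 n r) (replicate (n - 1) 0 @ [1]) s' \<and> s' (Scalar 14) = 1)"
  proof (rule H_SS[where ?T1.0 = 18 and ?T2.0 = 5 and ?R1.0 = "\<lambda>s'. s' = s2"], rule H_Cond[where T' = 10])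
    assume "eval (Op Lt (addE (Var 0) (Const 1)) (addE (Var 3) (Var 3))) s1 \<noteq> 0"
    then have "n + 1 < 2 * r" using f1 by (auto split: if_splits)
    then show "H n (Seq (Assign 7 (Op Quot (addE (Var 0) (Const 1)) (Const 2))) (Assign 8 (subE (Var 3) (Var 7)))) s1 10 (\<lambda>s'. s' = s2)"
      using f1 by (intro H_SA[where ?T2.0 = 4] H_Assign) (auto simp: s2_def part1_def part2_def)
  next
    assume "eval (Op Lt (addE (Var 0) (Const 1)) (addE (Var 3) (Var 3))) s1 = 0"
    then have "\<not> n + 1 < 2 * r" using f1 by (auto split: if_splits)
    then show "H n (Seq (Assign 7 (Var 3)) (Assign 8 (Const 0))) s1 10 (\<lambda>s'. s' = s2)"
      using f1 by (intro H_SA[where ?T2.0 = 2] H_Assign) (auto simp: s2_def part1_def part2_def)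
  next
    fix s' assume s': "s' = s2"
    define s4 where "s4 = s2(Cell 2 n := 1, Scalar 14 := 1)"
    have "arr n s4 2 = replicate (n - 1) 0 @ [1]"
    proof (rule nth_equalityI)
      fix i assume "i < length (arr n s4 2)"
      then have i: "i < n" by simp
      show "arr n s4 2 ! i = (replicate (n - 1) 0 @ [1]) ! i"
      proof (cases "i = n - 1")
        case False
        then have "i < n - 1" "Suc i \<noteq> n" using i by auto
        then show ?thesis using i s1 z by (simp add: arr_nth nth_append s4_def s2_def same_def)
      qed (use i in \<open>simp add: arr_nth nth_append s4_def\<close>)
    qed (use n in simp)
    then have "loop_inv n N (part1 n r) (part2 n r) (replicate (n - 1) 0 @ [1]) s4"
      using f1 s1 N(1) by (simp add: loop_inv_def s4_def s2_def same_def arr_def)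
    moreover have "s2 (Scalar 0) = n" using f1 by (simp add: s2_def)
    ultimately show "H n (Seq (Update 2 (Var 0) (Const 1)) (Assign 14 (Const 1))) s' 5
      (\<lambda>s'. loop_inv n N (part1 n r) (part2 n r) (replicate (n - 1) 0 @ [1]) s' \<and> s' (Scalar 14) = 1)"
      unfolding s' by (intro H_SU[where ?T2.0 = 2] H_Assign) (simp_all add: s4_def)
  qed (use f1 r in auto)
qed (use n in auto)

text \<open>\<open>start\<close> is the only string of weight one that ends in \<open>1\<close>, so
  the return to it is seen from a sum and a single letter.\<close>

abbreviation "not_start \<equiv> subE (Const 1) (Op Mul (Op Eq (Var 10) (Const 1)) (Elem 2 (Var 0)))"

definition tail_com :: com where
  "tail_com = Seq (sum_com 2 10) (Assign 14 not_start)"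

definition cycle_com :: com where
  "cycle_com = While (Var 14) (Seq step_com (Seq (Output (Elem 2 (Var 0))) tail_com))"

lemma start_iff:
  assumes v: "v \<in> bits n" and n: "1 \<le> n"
  shows "v = replicate (n - 1) 0 @ [1] \<longleftrightarrow> wt v = 1 \<and> v ! (n - 1) = 1"
proof
  assume "v = replicate (n - 1) 0 @ [1]"
  then show "wt v = 1 \<and> v ! (n - 1) = 1" by (simp add: nth_append)
next
  assume A: "wt v = 1 \<and> v ! (n - 1) = 1"
  have ne: "v \<noteq> []" using bitsD(1)[OF v] n by auto
  then have l: "last v = 1" using A bitsD(1)[OF v] by (simp add: last_conv_nth)
  then have vs: "v = butlast v @ [1]" using ne by (metis append_butlast_last_id)
  then have "butlast v \<in> bits (n - 1)" using v by (metis snoc_bits)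
  moreover have "wt (butlast v) = 0" using A vs by (metis add_diff_cancel_right' add_0 diff_self_eq_0 wt_simps(1-3) add.right_neutral)
  ultimately have "butlast v = replicate (n - 1) 0" by (rule wt_zero)
  then show "v = replicate (n - 1) 0 @ [1]" using vs by simp
qed

lemma tail_com:
  assumes s0: "s (Scalar 0) = n" and n: "1 \<le> n" and v: "arr n s 2 = v" "v \<in> bits n"
  shows "H n tail_com s (40 * n) (\<lambda>s'. s' (Scalar 14) = of_bool (v \<noteq> replicate (n - 1) 0 @ [1]) \<and>
     same {Scalar 1, Scalar 10, Scalar 14} s s')"
  unfolding tail_com_def
proof (rule H_SS[OF sum_com[of s n 2 10, OF s0 n _ _ _ _ v], where ?T2.0 = 10], simp, simp, simp, simp)
  fix s1 assume s1: "s1 (Scalar 10) = wt v \<and> same {Scalar 1, Scalar 10} s s1"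
  have f1: "s1 (Scalar 0) = n" "s1 (Cell 2 n) = v ! (n - 1)"
    using s1 s0 v(1) n arr_nth[of "n - 1" n s 2] by (simp_all add: same_def)
  have b: "v ! (n - 1) = 0 \<or> v ! (n - 1) = 1" using bitsD(2)[OF v(2), of "n - 1"] n by simp
  have "eval not_start s1 = of_bool (v \<noteq> replicate (n - 1) 0 @ [1])"
    unfolding start_iff[OF v(2) n] using b f1 s1 by auto
  moreover have "okE n not_start s1"
    using f1 b by auto
  ultimately show "H n (Assign 14 not_start) s1 10
     (\<lambda>s'. s' (Scalar 14) = of_bool (v \<noteq> replicate (n - 1) 0 @ [1]) \<and> same {Scalar 1, Scalar 10, Scalar 14} s s')"
    using s1 by (intro H_Assign) (simp_all add: same_def del: eval.simps okE.simps)
qed (use n in auto)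

section \<open>Traces of the output loop\<close>

text \<open>\<open>d\<close> bounds the number of events before the first symbol, \<open>D\<close> those after any symbol.\<close>

fun segs :: "nat \<Rightarrow> nat \<Rightarrow> nat \<Rightarrow> nat list \<Rightarrow> event list \<Rightarrow> bool" where
  "segs n D d [] t \<longleftrightarrow> length t \<le> d \<and> (\<forall>ev\<in>set t. quiet n ev)"
| "segs n D d (b # bs) t \<longleftrightarrow> (\<exists>u t'. t = u @ Emit b # t' \<and> length u \<le> d \<and> (\<forall>ev\<in>set u. quiet n ev) \<and> segs n D D bs t')"

text \<open>Silent events in front only delay the first symbol, or the end if there is none.\<close>

lemma segs_prefix:
  assumes "segs n D d bs t" "\<forall>ev\<in>set u. quiet n ev" "length u \<le> e"
  shows "segs n D (e + d) bs (u @ t)"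
proof (cases bs)
  case Nil then show ?thesis using assms by auto
next
  case (Cons b bs')
  then obtain w t' where "t = w @ Emit b # t'" "length w \<le> d" "\<forall>ev\<in>set w. quiet n ev" "segs n D D bs' t'"
    using assms(1) by auto
  then show ?thesis unfolding Cons segs.simps using assms(2,3)
    by (intro exI[of _ "u @ w"] exI[of _ t'] conjI) auto
qed

lemma emitted_append: "emitted (t @ u) = emitted t @ emitted u"
  by (simp add: emitted_def)

lemma emitted_quiet: "\<forall>ev\<in>set t. quiet n ev \<Longrightarrow> emitted t = []"
proof (induction t)
  case (Cons ev t) then show ?case by (cases ev) (auto simp: emitted_def)
qed (simp add: emitted_def)

lemma emit_times_append: "emit_times (u @ t) = emit_times u @ map (\<lambda>i. i + length u) (emit_times t)"
proof -
  have "[0..<length (u @ t)] = [0..<length u] @ map (\<lambda>i. i + length u) [0..<length t]"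
  proof -
    have "[0..<length u + length t] = [0..<length u] @ [length u..<length u + length t]"
      by (rule upt_add_eq_append) simp
    moreover have "map (\<lambda>i. i + length u) [0..<length t] = [length u..<length t + length u]"
      by (rule map_add_upt)
    ultimately show ?thesis by (simp add: add.commute)
  qed
  moreover have "filter (\<lambda>i. \<exists>b. (u @ t) ! i = Emit b) [0..<length u] = filter (\<lambda>i. \<exists>b. u ! i = Emit b) [0..<length u]"
    by (rule filter_cong) (auto simp: nth_append)
  moreover have "filter (\<lambda>i. \<exists>b. (u @ t) ! i = Emit b) (map (\<lambda>i. i + length u) [0..<length t])
      = map (\<lambda>i. i + length u) (filter (\<lambda>i. \<exists>b. t ! i = Emit b) [0..<length t])"
    by (simp add: filter_map o_def nth_append)
  ultimately show ?thesis by (simp add: emit_times_def)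
qed

lemma emit_times_quiet: "\<forall>ev\<in>set t. quiet n ev \<Longrightarrow> emit_times t = []"
  unfolding emit_times_def by (auto simp: filter_empty_conv in_set_conv_nth) (metis nth_mem quiet.simps(5))

lemma emit_times_Cons_Emit: "emit_times (Emit b # t) = 0 # map Suc (emit_times t)"
proof -
  have "emit_times [Emit b] = [0]" by (simp add: emit_times_def)
  then show ?thesis using emit_times_append[of "[Emit b]" t] by simp
qed

lemma segs_emitted: "segs n D d bs t \<Longrightarrow> emitted t = bs"
proof (induction bs arbitrary: d t)
  case Nil then show ?case using emitted_quiet[of t n] by simp
next
  case (Cons b bs)
  then obtain u t' where t: "t = u @ Emit b # t'" "\<forall>ev\<in>set u. quiet n ev" "segs n D D bs t'" by auto
  have "emitted (Emit b # t') = b # emitted t'" by (simp add: emitted_def)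
  then show ?case using t Cons.IH[OF t(3)] emitted_quiet[OF t(2)] by (simp add: emitted_append)
qed

lemma segs_length: "segs n D d bs t \<Longrightarrow> length t \<le> d + length bs * (D + 1)"
proof (induction bs arbitrary: d t)
  case (Cons b bs)
  then obtain u t' where t: "t = u @ Emit b # t'" "length u \<le> d" "segs n D D bs t'" by auto
  then show ?case using Cons.IH[OF t(3)] by simp
qed simp

lemma segs_events: "segs n D d bs t \<Longrightarrow> ev \<in> set t \<Longrightarrow> quiet n ev \<or> (\<exists>b\<in>set bs. ev = Emit b)"
proof (induction bs arbitrary: d t)
  case (Cons b bs)
  then obtain u t' where t: "t = u @ Emit b # t'" "\<forall>ev\<in>set u. quiet n ev" "segs n D D bs t'" by auto
  then show ?case using Cons.IH[OF t(3)] Cons.prems(2) by auto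
qed auto

text \<open>The bound on the first emission is carried along in the induction, as it controls the
  gap between the leading symbol and the rest. The emission itself is a step, hence
  \<open>D + 1\<close>.\<close>

lemma segs_gaps: "segs n D d bs t \<Longrightarrow>
  (\<forall>k. Suc k < length (emit_times t) \<longrightarrow> emit_times t ! Suc k - emit_times t ! k \<le> D + 1) \<and>
  (emit_times t \<noteq> [] \<longrightarrow> emit_times t ! 0 \<le> d)"
proof (induction bs arbitrary: d t)
  case Nil then show ?case using emit_times_quiet[of t n] by simp
next
  case (Cons b bs)
  then obtain u t' where t: "t = u @ Emit b # t'" "length u \<le> d" "\<forall>ev\<in>set u. quiet n ev" "segs n D D bs t'" by auto
  define E where "E = emit_times t'"
  have IH: "\<And>k. Suc k < length E \<Longrightarrow> E ! Suc k - E ! k \<le> D + 1" "E \<noteq> [] \<Longrightarrow> E ! 0 \<le> D"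
    using Cons.IH[OF t(4)] by (auto simp: E_def)
  have et: "emit_times t = length u # map (\<lambda>i. Suc i + length u) E"
    unfolding t(1) emit_times_append emit_times_quiet[OF t(3)] emit_times_Cons_Emit E_def by simp
  have "emit_times t ! Suc k - emit_times t ! k \<le> D + 1" if "Suc k < length (emit_times t)" for k
  proof (cases k)
    case 0
    then have "E \<noteq> []" using that et by auto
    then show ?thesis using IH(2) 0 et by (simp add: nth_map)
  next
    case (Suc k')
    then have "Suc k' < length E" using that et by simp
    then show ?thesis using IH(1)[of k'] Suc et by (simp add: nth_map)
  qed
  then show ?case using et t(2) by simp
qed

lemma H_exec:
  assumes "H n c s T R" "1 \<le> n" "bd n s"
  obtains t s' where "exec c s t s'" "length t \<le> T" "\<forall>ev\<in>set t. quiet n ev" "bd n s'" "R s'"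
  using assms unfolding H_def by blast

text \<open>Before a symbol come the guard, the step and the evaluation of the output, within
  \<open>304 * n\<close>; after it the test for \<open>start\<close> adds at most
  \<open>40 * n\<close>. As the states of one turn are distinct, that test first succeeds after
  exactly \<open>card S\<close> steps.\<close>

lemma cycle_com:
  assumes cut: "cutdown n N ({r1, r2} - {0})" and N: "N \<in> bits n" and r: "r1 < n" "r2 < n"
    and k: "k < card (cutdown.S n N ({r1, r2} - {0}))"
    and s: "loop_inv n N r1 r2 (cutdown.state n N ({r1, r2} - {0}) k) s" "s (Scalar 14) = 1" "bd n s"
  shows "\<exists>t s'. exec cycle_com s t s' \<and> segs n (344 * n) (304 * n)
     (map (\<lambda>i. last (cutdown.state n N ({r1, r2} - {0}) (Suc i))) [k..<card (cutdown.S n N ({r1, r2} - {0}))]) t"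
proof -
  interpret cutdown n N "{r1, r2} - {0}" by (rule cut)
  define L where "L = card S"
  have "\<exists>t s'. exec cycle_com s t s' \<and> segs n (344 * n) (304 * n) (map (\<lambda>i. last (state (Suc i))) [k..<L]) t"
    if "k < L" "loop_inv n N r1 r2 (state k) s" "s (Scalar 14) = 1" "bd n s" for k s
    using that
  proof (induction "L - k" arbitrary: k s rule: less_induct)
    case less
    define v where "v = state (Suc k)"
    have vb: "state j \<in> bits n" for j using S_bits[OF state_S] .
    have li: "s (Scalar 0) = n" "arr n s 1 = N" "s (Scalar 6) = wt N" "s (Scalar 7) = r1" "s (Scalar 8) = r2" "arr n s 2 = state k"
      using less.prems(2) by (auto simp: loop_inv_def)
    obtain t1 s1 where 1: "exec step_com s t1 s1" "length t1 \<le> 300 * n" "\<forall>ev\<in>set t1. quiet n ev" "bd n s1"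
      "arr n s1 2 = stp n N ({r1, r2} - {0}) (state k) \<and> same (step_W n) s s1"
      by (rule H_exec[OF step_com[of s n "state k" N r1 r2, OF li(1) n li(6) vb li(2) N li(3-5) r] n less.prems(4)]) blast
    have li1: "loop_inv n N r1 r2 v s1"
    proof -
      have "arr n s1 1 = N" unfolding li(2)[symmetric] by (rule arr_cong) (use 1(5) in \<open>simp add: same_def\<close>)
      moreover have "s1 (Scalar i) = s (Scalar i)" if "i \<in> {0, 6, 7, 8}" for i
        by (rule sameD[OF conjunct2[OF 1(5)]]) (use that in auto)
      ultimately show ?thesis using 1(5) li by (simp add: loop_inv_def v_def state_def)
    qed
    then have f1: "s1 (Scalar 0) = n" "arr n s1 2 = v" by (auto simp: loop_inv_def)
    have vbn: "v \<in> bits n" using vb by (simp add: v_def)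
    have ne: "v \<noteq> []" using bitsD(1)[OF vbn] n by auto
    have last: "s1 (Cell 2 n) = last v"
    proof -
      have "v ! (n - 1) = s1 (Cell 2 n)" using arr_nth[of "n - 1" n s1 2] f1(2) n by simp
      then show ?thesis using ne bitsD(1)[OF vbn] by (simp add: last_conv_nth)
    qed
    define ot where "ot = eval_trace (Elem 2 (Var 0)) s1"
    have oq: "\<forall>ev\<in>set ot. quiet n ev" "length ot = 2"
      using eval_trace_quiet[OF n 1(4), of "Elem 2 (Var 0)"] f1 by (auto simp: ot_def)
    have O: "exec (Output (Elem 2 (Var 0))) s1 (ot @ [Emit (last v)]) s1"
      using exec.Output[of "Elem 2 (Var 0)" s1] f1 last by (simp add: ot_def)
    obtain t3 s3 where 3: "exec tail_com s1 t3 s3" "length t3 \<le> 40 * n" "\<forall>ev\<in>set t3. quiet n ev" "bd n s3"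
      "s3 (Scalar 14) = of_bool (v \<noteq> replicate (n - 1) 0 @ [1]) \<and> same {Scalar 1, Scalar 10, Scalar 14} s1 s3"
      by (rule H_exec[OF tail_com[of s1 n v, OF f1(1) n f1(2) vbn] n 1(4)]) blast
    have li3: "loop_inv n N r1 r2 v s3" using li1 3(5) by (simp add: loop_inv_def same_def arr_def)
    have body: "exec (Seq step_com (Seq (Output (Elem 2 (Var 0))) tail_com)) s (t1 @ (ot @ [Emit (last v)]) @ t3) s3"
      by (rule exec.Seq[OF 1(1) exec.Seq[OF O 3(1)]])
    have g: "eval (Var 14) s \<noteq> 0" using less.prems(3) by simp
    have n1: "1 \<le> bnd n" using bnd_ge(2)[OF n] by simp
    have "\<exists>t2 s'. exec cycle_com s3 t2 s' \<and> segs n (344 * n) (304 * n) (map (\<lambda>i. last (state (Suc i))) [Suc k..<L]) t2"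
    proof (cases "Suc k = L")
      case True
      then have "v = start" using state_period by (simp add: v_def L_def)
      then have z: "eval (Var 14) s3 = 0" using 3(5) by (simp add: start_def)
      have "exec cycle_com s3 (eval_trace (Var 14) s3 @ [Branch]) s3"
        unfolding cycle_com_def by (rule exec.WhileFalse[OF z])
      moreover have "segs n (344 * n) (304 * n) [] (eval_trace (Var 14) s3 @ [Branch])"
        using z n by simp
      ultimately show ?thesis using True
        by (intro exI[of _ "eval_trace (Var 14) s3 @ [Branch]"] exI[of _ s3]) simp
    next
      case False
      then have lt: "Suc k < L" using less.prems(1) by simp
      have "v \<noteq> start"
      proof
        assume "v = start"
        then have "state (Suc k) = state 0" by (simp add: v_def state_def)
        moreover have "inj_on state {..<L}" using state_bij unfolding bij_betw_def L_def by blast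
        ultimately have "Suc k = 0" using lt by (intro inj_onD[of state "{..<L}" "Suc k" 0]) auto
        then show False by simp
      qed
      then have "s3 (Scalar 14) = 1" using 3(5) by (simp add: start_def)
      then show ?thesis using less.hyps[of "Suc k" s3] lt li3 3(4) by (simp add: v_def)
    qed
    then obtain t2 s' where 2: "exec cycle_com s3 t2 s'"
      "segs n (344 * n) (304 * n) (map (\<lambda>i. last (state (Suc i))) [Suc k..<L]) t2" by blast
    define u where "u = eval_trace (Var 14) s @ Branch # t1 @ ot"
    have teq: "eval_trace (Var 14) s @ Branch # (t1 @ (ot @ [Emit (last v)]) @ t3) @ t2 = u @ Emit (last v) # t3 @ t2"
      by (simp add: u_def)
    have ex: "exec cycle_com s (u @ Emit (last v) # t3 @ t2) s'"
      using exec.WhileTrue[OF g body] 2(1) unfolding cycle_com_def teq[symmetric] by blast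
    have u: "length u \<le> 304 * n" "\<forall>ev\<in>set u. quiet n ev"
      using 1(2,3) oq less.prems(3) n n1 by (auto simp: u_def)
    have "segs n (344 * n) (344 * n) (map (\<lambda>i. last (state (Suc i))) [Suc k..<L]) (t3 @ t2)"
      using segs_prefix[OF 2(2) 3(3,2)] by simp
    then have "segs n (344 * n) (304 * n) (last v # map (\<lambda>i. last (state (Suc i))) [Suc k..<L]) (u @ Emit (last v) # t3 @ t2)"
      unfolding segs.simps using u by blast
    moreover have "map (\<lambda>i. last (state (Suc i))) [k..<L] = last v # map (\<lambda>i. last (state (Suc i))) [Suc k..<L]"
      using less.prems(1) by (simp add: upt_conv_Cons v_def)
    ultimately have "segs n (344 * n) (304 * n) (map (\<lambda>i. last (state (Suc i))) [k..<L]) (u @ Emit (last v) # t3 @ t2)"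
      by simp
    then show ?case using ex by blast
  qed
  then show ?thesis using k s unfolding L_def by blast
qed

definition cut_down_com :: com where
  "cut_down_com = Seq init_com (Seq setup_com cycle_com)"

lemma parts:
  assumes "r < n"
  shows "part1 n r < n" "part2 n r < n" "\<And>x. x \<in> {part1 n r, part2 n r} - {0} \<Longrightarrow> 1 \<le> x \<and> 2 * x \<le> n + 1 \<and> x < n"
    "\<And>x y. x \<in> {part1 n r, part2 n r} - {0} \<Longrightarrow> y \<in> {part1 n r, part2 n r} - {0} \<Longrightarrow> y < x \<Longrightarrow> x + y < n \<and> n \<le> 2 * x"
    "\<Sum>({part1 n r, part2 n r} - {0}) = r"
proof -
  have "part1 n r < n \<and> part2 n r < n \<and> 2 * part1 n r \<le> n + 1 \<and> 2 * part2 n r \<le> n + 1 \<and> part1 n r + part2 n r = r \<and>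
    (part2 n r \<noteq> 0 \<longrightarrow> part2 n r < part1 n r \<and> n \<le> 2 * part1 n r)"
  proof (cases "n + 1 < 2 * r")
    case True
    define h where "h = (n + 1) div 2"
    have h: "2 * h \<le> n + 1" "n \<le> 2 * h" unfolding h_def by linarith+
    have "part1 n r = h" "part2 n r = r - h" using True by (simp_all add: part1_def part2_def h_def)
    then show ?thesis using True h assms by linarith
  next
    case False
    then show ?thesis using assms by (simp add: part1_def part2_def)
  qed
  then have p: "part1 n r < n" "part2 n r < n" "2 * part1 n r \<le> n + 1" "2 * part2 n r \<le> n + 1" "part1 n r + part2 n r = r"
    "part2 n r \<noteq> 0 \<Longrightarrow> part2 n r < part1 n r \<and> n \<le> 2 * part1 n r" by blast+
  show "part1 n r < n" "part2 n r < n" using p by auto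
  show "1 \<le> x \<and> 2 * x \<le> n + 1 \<and> x < n" if "x \<in> {part1 n r, part2 n r} - {0}" for x using that p by auto
  show "x + y < n \<and> n \<le> 2 * x" if "x \<in> {part1 n r, part2 n r} - {0}" "y \<in> {part1 n r, part2 n r} - {0}" "y < x" for x y
  proof -
    have "part2 n r \<noteq> 0" "x = part1 n r" "y = part2 n r" using that p by auto
    then show ?thesis using p assms by simp
  qed
  show "\<Sum>({part1 n r, part2 n r} - {0}) = r"
  proof (cases "part2 n r = 0")
    case True
    moreover have "{part1 n r, 0} - {0} = (if part1 n r = 0 then {} else {part1 n r})" by auto
    ultimately show ?thesis using p by simp
  next
    case False
    then have "{part1 n r, part2 n r} - {0} = {part1 n r, part2 n r}" "part1 n r \<noteq> part2 n r" using p by auto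
    then show ?thesis using p by simp
  qed
qed

lemma cut_down_com:
  assumes n: "1 \<le> n" and L: "2 ^ (n - 1) < L" "L \<le> 2 ^ n"
  shows "\<exists>t s bs. exec cut_down_com (input_store n L) t s \<and> cut_down_de_bruijn n L bs \<and>
     segs n (344 * n) (240 * n * 2 ^ n + 364 * n) bs t"
proof -
  define s where "s = input_store n L"
  have bds: "bd n s" unfolding bd_def
  proof
    fix l show "s l \<le> bnd n"
    proof (cases l)
      case (Cell a i)
      have "L div 2 ^ i mod 2 < 2" by simp
      then have "L div 2 ^ i mod 2 \<le> bnd n" using bnd_ge(2)[OF n] by linarith
      then show ?thesis using Cell by (simp add: s_def)
    qed (use bnd_ge(1)[OF n] in \<open>auto simp: s_def\<close>)
  qed
  have init: "H n init_com s (240 * n * 2 ^ n) (\<lambda>s'. same (init_W n) s s' \<and> arr n s' 1 \<in> bits n \<and> init_done n L s')"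
    by (rule init_com[OF _ n L]) (simp_all add: s_def ctr_def)
  obtain t0 s0 where 0: "exec init_com s t0 s0" "length t0 \<le> 240 * n * 2 ^ n" "\<forall>ev\<in>set t0. quiet n ev" "bd n s0"
    "same (init_W n) s s0 \<and> arr n s0 1 \<in> bits n \<and> init_done n L s0"
    by (rule H_exec[OF init n bds]) blast
  define N r where "N = arr n s0 1" and "r = s0 (Scalar 3)"
  have N: "N \<in> bits n" and r: "r < n" "L + card (remset n N) + r = 2 ^ n"
    using 0(5) by (auto simp: N_def r_def init_done_def)
  have f0: "s0 (Scalar 0) = n" "s0 (Cell 2 j) = 0" for j using 0(5) by (auto simp: same_def s_def)
  define J where "J = {part1 n r, part2 n r} - {0}"
  have cardR: "card (bits n - remset n N) = L + r"
  proof -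
    have "remset n N \<subseteq> bits n" unfolding remset_def by blast
    then have "card (bits n - remset n N) = card (bits n) - card (remset n N)"
      by (intro card_Diff_subset) simp_all
    then show ?thesis using r(2) card_bits[of n] by linarith
  qed
  interpret cutdown n N J
    using n cardR L(1) parts[OF r(1)] unfolding J_def by unfold_locales auto
  have cS: "card S = L"
  proof -
    have "\<Sum>J = r" using parts(5)[OF r(1)] by (simp add: J_def)
    then show ?thesis using card_S r(2) by linarith
  qed
  obtain t1 s1 where 1: "exec setup_com s0 t1 s1" "length t1 \<le> 60 * n" "\<forall>ev\<in>set t1. quiet n ev" "bd n s1"
    "loop_inv n N (part1 n r) (part2 n r) (replicate (n - 1) 0 @ [1]) s1 \<and> s1 (Scalar 14) = 1"
    by (rule H_exec[OF setup_com[of s0 n N r, OF f0(1) n N_def[symmetric] N r_def[symmetric] r(1) f0(2)] n 0(4)]) blast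
  have L0: "0 < card S" using cS L by simp
  have li: "loop_inv n N (part1 n r) (part2 n r) (state 0) s1" using 1(5) by (simp add: state_def start_def)
  obtain t2 s2 where 2: "exec cycle_com s1 t2 s2"
    "segs n (344 * n) (304 * n) (map (\<lambda>i. last (state (Suc i))) [0..<L]) t2"
    using cycle_com[OF _ N parts(1,2)[OF r(1)], folded J_def, OF cutdown_axioms L0 li] 1(4,5) unfolding cS by blast
  have "exec cut_down_com s (t0 @ t1 @ t2) s2"
    unfolding cut_down_com_def by (rule exec.Seq[OF 0(1) exec.Seq[OF 1(1) 2(1)]])
  moreover have "segs n (344 * n) (240 * n * 2 ^ n + (60 * n + 304 * n)) (map (\<lambda>i. last (state (Suc i))) [0..<L]) (t0 @ t1 @ t2)"
    by (rule segs_prefix[OF segs_prefix[OF 2(2) 1(3,2)] 0(3,2)])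
  moreover have "240 * n * 2 ^ n + (60 * n + 304 * n) = 240 * n * 2 ^ n + 364 * n" by simp
  moreover have "cut_down_de_bruijn n L (map (\<lambda>i. last (state (Suc i))) [0..<L])" using state_output unfolding cS .
  ultimately show ?thesis unfolding s_def by metis
qed

theorem theorem2:
  "\<exists>(P :: com) (a :: nat) (b :: nat) (k :: nat).
     \<forall>(n :: nat) (L :: nat). 1 \<le> n \<and> 2 ^ (n - 1) < L \<and> L \<le> 2 ^ n \<longrightarrow>
       (\<exists>t s. exec P (input_store n L) t s \<and>
          cut_down_de_bruijn n L (emitted t) \<and>
          time_per_symbol_le t (a * n) \<and>
          space t \<le> b * n \<and>
          word_size_log t k n)"
proof (rule exI[of _ cut_down_com], rule exI[of _ 1200], rule exI[of _ 25], rule exI[of _ 3], intro allI impI)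
  fix n L :: nat assume A: "1 \<le> n \<and> 2 ^ (n - 1) < L \<and> L \<le> 2 ^ n"
  then have n: "1 \<le> n" and L: "2 ^ (n - 1) < L" "L \<le> 2 ^ n" by auto
  obtain t s bs where t: "exec cut_down_com (input_store n L) t s" and w: "cut_down_de_bruijn n L bs"
    and sg: "segs n (344 * n) (240 * n * 2 ^ n + 364 * n) bs t"
    using cut_down_com[OF n L] by blast
  have em: "emitted t = bs" using segs_emitted[OF sg] .
  have lb: "length bs = L" and sb: "set bs \<subseteq> {0, 1}" using w by (auto simp: cut_down_de_bruijn_def)
  have time: "time_per_symbol_le t (1200 * n)"
  proof -
    have "length t \<le> 240 * n * 2 ^ n + 364 * n + L * (344 * n + 1)" using segs_length[OF sg] lb by simp
    \<comment> \<open>Initialisation is charged to the symbols through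
      \<open>2 ^ n \<le> 2 * L\<close>. Together the summands give
      \<open>480 + 364 + 345 = 1189\<close>.\<close>
    also have "240 * n * 2 ^ n \<le> 240 * n * (2 * L)"
    proof (rule mult_le_mono2)
      have "(2::nat) ^ n = 2 * 2 ^ (n - 1)" using n by (cases n) auto
      then show "2 ^ n \<le> 2 * L" using L(1) by linarith
    qed
    also have "364 * n \<le> 364 * n * L" using L(1) by simp
    also have "L * (344 * n + 1) \<le> L * (345 * n)" using n by (intro mult_le_mono2) simp
    finally have "length t \<le> 240 * n * (2 * L) + 364 * n * L + L * (345 * n)" by simp
    also have "\<dots> = 1189 * n * L" by simp
    also have "\<dots> \<le> 1200 * n * L" by simp
    finally have "run_time t \<le> 1200 * n * length (emitted t)" using em lb by (simp add: run_time_def)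
    moreover have "emit_times t ! Suc k - emit_times t ! k \<le> 1200 * n" if "Suc k < length (emit_times t)" for k
    proof -
      have "emit_times t ! Suc k - emit_times t ! k \<le> 344 * n + 1" using segs_gaps[OF sg] that by blast
      then show ?thesis using n by linarith
    qed
    ultimately show ?thesis by (simp add: time_per_symbol_le_def)
  qed
  have ev: "quiet n e \<or> (\<exists>b\<in>{0, 1}. e = Emit b)" if "e \<in> set t" for e
    using segs_events[OF sg that] sb by blast
  have space: "space t \<le> 25 * n"
  proof -
    \<comment> \<open>Sixteen registers and three arrays with the indices \<open>0\<close> to
      \<open>n + 1\<close> are at most \<open>3 * n + 22\<close> cells.\<close>
    have "cells_used t \<subseteq> Scalar ` {..<16} \<union> (\<lambda>(a, i). Cell a i) ` ({..<3} \<times> {..n + 1})"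
    proof
      fix l assume "l \<in> cells_used t"
      then obtain v where "Load l v \<in> set t \<or> Store l v \<in> set t" by (auto simp: cells_used_def)
      then have "okloc n l" using ev[of "Load l v"] ev[of "Store l v"] by auto
      then show "l \<in> Scalar ` {..<16} \<union> (\<lambda>(a, i). Cell a i) ` ({..<3} \<times> {..n + 1})"
        by (cases l) (auto simp: image_iff)
    qed
    then have "space t \<le> card (Scalar ` {..<16} \<union> (\<lambda>(a, i). Cell a i) ` ({..<3} \<times> {..n + 1}))"
      unfolding space_def by (intro card_mono) auto
    also have "\<dots> \<le> card (Scalar ` {..<16}) + card ((\<lambda>(a, i). Cell a i) ` ({..<3} \<times> {..n + 1}))"
      by (rule card_Un_le)
    also have "\<dots> \<le> 16 + 3 * (n + 2)"
      using card_image_le[of "{..<16::nat}" Scalar] card_image_le[of "{..<3::nat} \<times> {..n + 1}" "\<lambda>(a, i). Cell a i"]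
      by (simp add: card_cartesian_product)
    also have "\<dots> \<le> 25 * n" using n by simp
    finally show ?thesis .
  qed
  have word: "word_size_log t 3 n"
    unfolding word_size_log_def
  proof
    fix v assume v: "v \<in> values_used t"
    have "v \<le> bnd n"
    proof (cases "Emit v \<in> set t")
      case True
      then have "v \<in> {0, 1}" using ev[OF True] by auto
      then show ?thesis using bnd_ge(2)[OF n] by auto
    next
      case False
      then obtain l where "Compute v \<in> set t \<or> Load l v \<in> set t \<or> Store l v \<in> set t"
        using v by (auto simp: values_used_def)
      then show ?thesis using ev[of "Compute v"] ev[of "Load l v"] ev[of "Store l v"] by auto
    qed
    then show "v \<le> (n + 1) ^ 3" by (simp add: bnd_def)
  qed
  show "\<exists>t s. exec cut_down_com (input_store n L) t s \<and> cut_down_de_bruijn n L (emitted t) \<and>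
     time_per_symbol_le t (1200 * n) \<and> space t \<le> 25 * n \<and> word_size_log t 3 n"
    using t w em time space word by auto
qed

end
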